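(* Let $p,q,r$ be polynomials in a category $\mathcal{E}$ with finite limits. If $\begin{bmatrix} q \\ p \end{bmatrix}$ is a polynomial (i.e. is an exponentiable morphism of $\mathcal{E}$), then there is a bijection $$\mathrm{Hom}_{\mathbf{Poly}_{\mathcal{E}}}(p,\,r\triangleleft q)\cong\mathrm{Hom}_{\mathbf{Poly}_{\mathcal{E}}}\left(\begin{bmatrix} q \\ p \end{bmatrix},\,r\right),$$ natural in $p,q,r$, where $p,q$ range over those pairs for which $\begin{bmatrix} q \\ p \end{bmatrix}$ is a polynomial.
   Context: For $f\colon B\to A$ in $\mathcal{E}$, $\Delta_f\colon\mathcal{E}/A\to\mathcal{E}/B$ denotes pullback along $f$; $f$ is exponentiable if $\Delta_f$ has a right adjoint $\Pi_f$. A polynomial in $\mathcal{E}$ is an exponentiable morphism $p\colon P_*\to P$. A morphism of polynomials $\phi\colon p\to q$ is a pair $\phi_1\colon P\to Q$, $\phi^\sharp\colon P\times_Q Q_*\to P_*$ with $p\circ\phi^\sharp$ the projection to $P$, up to isomorphism of the choice of pullback. Composition is $(\psi\circ\phi)_1=\psi_1\circ\phi_1$, $(\psi\circ\phi)^\sharp=\phi^\sharp\circ(P\times_Q\psi^\sharp)$ (using $P\times_R R_*\cong P\times_Q(Q\times_R R_* )$). This gives the category $\mathbf{Poly}_{\mathcal{E}}$. Composition product: $p\triangleleft q$ is the composite of projections $(\Pi_p(Q\times P_* )\times_P P_* )\times_Q Q_*\to\Pi_p(Q\times P_* )\times_P P_*\to\Pi_p(Q\times P_* )$, where $\Pi_p(Q\times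 P_* )\times_P P_*\to Q$ is the counit of $\Delta_p\dashv\Pi_p$ followed by projection. In terms of generalized elements, positions are pairs $(x\colon X\to P,\ f\colon X\times_PP_*\to Q)$ and a direction at $(x,f)$ is a pair $(y,z)$ with $y$ in $P_*$ over $x$ and $z$ in $Q_*$ over $f(y)$. On morphisms, $\phi\triangleleft\psi$ sends $(x,f)$ to $(\phi_1x,\psi_1\circ f\circ\phi^\sharp(x,-))$ and a direction $(y',z')$ there to $(\phi^\sharp(x,y'),\psi^\sharp(f(\phi^\sharp(x,y')),z'))$. For polynomials $p,q$, the morphism $\begin{bmatrix} q \\ p \end{bmatrix}$ of $\mathcal{E}$ is the composite $$\Pi_{\mathrm{id}_P\times q}(p\times\mathrm{id}_{Q_*})\to P\times Q\to P,$$ where $p\times\mathrm{id}_{Q_*}\colon P_*\times Q_*\to P\times Q_*$ is regarded as an object of $\mathcal{E}/(P\times Q_* )$, $\mathrm{id}_P\times q\colon P\times Q_*\to P\times Q$ is exponentiable, and the second map is the projection. It need not be exponentiable in general. Among pairs $p,q$ for which it is a polynomial, it is covariantly functorial in $p$ and contravariantly functorial in $q$. *)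

theory Defs
  imports Main
begin

section \<open>Categories, functors, adjunctions, finite limits\<close>

record ('o, 'a) category =
  obj :: "'o set"
  arr :: "'a set"
  src :: "'a \<Rightarrow> 'o"
  tgt :: "'a \<Rightarrow> 'o"
  idt :: "'o \<Rightarrow> 'a"
  cmp :: "'a \<Rightarrow> 'a \<Rightarrow> 'a" (infixl "\<cdot>\<index>" 75)

definition hom :: "('o, 'a) category \<Rightarrow> 'o \<Rightarrow> 'o \<Rightarrow> 'a set" where
  "hom C X Y = {f \<in> arr C. src C f = X \<and> tgt C f = Y}"

locale category =
  fixes C :: "('o, 'a) category" (structure)
  assumes src_obj: "f \<in> arr C \<Longrightarrow> src C f \<in> obj C"
    and tgt_obj: "f \<in> arr C \<Longrightarrow> tgt C f \<in> obj C"
    and idt_hom: "X \<in> obj C \<Longrightarrow> idt C X \<in> hom C X X"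
    and cmp_hom: "f \<in> hom C X Y \<Longrightarrow> g \<in> hom C Y Z \<Longrightarrow> g \<cdot> f \<in> hom C X Z"
    and idt_left: "f \<in> hom C X Y \<Longrightarrow> idt C Y \<cdot> f = f"
    and idt_right: "f \<in> hom C X Y \<Longrightarrow> f \<cdot> idt C X = f"
    and cmp_assoc: "f \<in> hom C W X \<Longrightarrow> g \<in> hom C X Y \<Longrightarrow> h \<in> hom C Y Z
                      \<Longrightarrow> h \<cdot> (g \<cdot> f) = (h \<cdot> g) \<cdot> f"

record ('o, 'a, 'p, 'b) cat_functor =
  omap :: "'o \<Rightarrow> 'p"
  amap :: "'a \<Rightarrow> 'b"

definition is_functor ::
  "('o, 'a) category \<Rightarrow> ('p, 'b) category \<Rightarrow> ('o, 'a, 'p, 'b) cat_functor \<Rightarrow> bool" where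
  "is_functor C D F \<longleftrightarrow> category C \<and> category D \<and>
     (\<forall>X\<in>obj C. omap F X \<in> obj D) \<and>
     (\<forall>f\<in>arr C. amap F f \<in> hom D (omap F (src C f)) (omap F (tgt C f))) \<and>
     (\<forall>X\<in>obj C. amap F (idt C X) = idt D (omap F X)) \<and>
     (\<forall>f\<in>arr C. \<forall>g\<in>arr C. tgt C f = src C g \<longrightarrow>
        amap F (g \<cdot>\<^bsub>C\<^esub> f) = amap F g \<cdot>\<^bsub>D\<^esub> amap F f)"

definition id_functor :: "('o, 'a, 'o, 'a) cat_functor" where
  "id_functor = \<lparr>omap = (\<lambda>X. X), amap = (\<lambda>f. f)\<rparr>"

definition comp_functor ::
  "('p, 'b, 'q, 'c) cat_functor \<Rightarrow> ('o, 'a, 'p, 'b) cat_functor \<Rightarrow> ('o, 'a, 'q, 'c) cat_functor" where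
  "comp_functor G F = \<lparr>omap = (\<lambda>X. omap G (omap F X)), amap = (\<lambda>f. amap G (amap F f))\<rparr>"

definition is_nat_trans ::
  "('o, 'a) category \<Rightarrow> ('p, 'b) category \<Rightarrow> ('o, 'a, 'p, 'b) cat_functor \<Rightarrow>
   ('o, 'a, 'p, 'b) cat_functor \<Rightarrow> ('o \<Rightarrow> 'b) \<Rightarrow> bool" where
  "is_nat_trans C D F G \<tau> \<longleftrightarrow> is_functor C D F \<and> is_functor C D G \<and>
     (\<forall>X\<in>obj C. \<tau> X \<in> hom D (omap F X) (omap G X)) \<and>
     (\<forall>f\<in>arr C. \<tau> (tgt C f) \<cdot>\<^bsub>D\<^esub> amap F f = amap G f \<cdot>\<^bsub>D\<^esub> \<tau> (src C f))"

text \<open>\<open>adjunction C D F G \<eta> \<epsilon>\<close>: \<open>F : C \<rightarrow> D\<close> is left adjoint to \<open>G : D \<rightarrow> C\<close>, with unit \<open>\<eta>\<close>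
  and counit \<open>\<epsilon>\<close>.\<close>

definition adjunction ::
  "('o, 'a) category \<Rightarrow> ('p, 'b) category \<Rightarrow> ('o, 'a, 'p, 'b) cat_functor \<Rightarrow>
   ('p, 'b, 'o, 'a) cat_functor \<Rightarrow> ('o \<Rightarrow> 'a) \<Rightarrow> ('p \<Rightarrow> 'b) \<Rightarrow> bool" where
  "adjunction C D F G \<eta> \<epsilon> \<longleftrightarrow> is_functor C D F \<and> is_functor D C G \<and>
     is_nat_trans C C id_functor (comp_functor G F) \<eta> \<and>
     is_nat_trans D D (comp_functor F G) id_functor \<epsilon> \<and>
     (\<forall>X\<in>obj C. \<epsilon> (omap F X) \<cdot>\<^bsub>D\<^esub> amap F (\<eta> X) = idt D (omap F X)) \<and>
     (\<forall>Y\<in>obj D. amap G (\<epsilon> Y) \<cdot>\<^bsub>C\<^esub> \<eta> (omap G Y) = idt C (omap G Y))"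

definition is_cone ::
  "('i, 'j) category \<Rightarrow> ('o, 'a) category \<Rightarrow> ('i, 'j, 'o, 'a) cat_functor \<Rightarrow>
   'o \<Rightarrow> ('i \<Rightarrow> 'a) \<Rightarrow> bool" where
  "is_cone J C D L l \<longleftrightarrow> L \<in> obj C \<and> (\<forall>i\<in>obj J. l i \<in> hom C L (omap D i)) \<and>
     (\<forall>a\<in>arr J. amap D a \<cdot>\<^bsub>C\<^esub> l (src J a) = l (tgt J a))"

definition is_limit ::
  "('i, 'j) category \<Rightarrow> ('o, 'a) category \<Rightarrow> ('i, 'j, 'o, 'a) cat_functor \<Rightarrow>
   'o \<Rightarrow> ('i \<Rightarrow> 'a) \<Rightarrow> bool" where
  "is_limit J C D L l \<longleftrightarrow> is_cone J C D L l \<and>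
     (\<forall>M m. is_cone J C D M m \<longrightarrow>
        (\<exists>!h. h \<in> hom C M L \<and> (\<forall>i\<in>obj J. l i \<cdot>\<^bsub>C\<^esub> h = m i)))"

text \<open>Index categories are taken over \<^typ>\<open>nat\<close>; every finite category is isomorphic to such
  a one.\<close>

definition has_finite_limits :: "('o, 'a) category \<Rightarrow> bool" where
  "has_finite_limits C \<longleftrightarrow>
     (\<forall>(J :: (nat, nat) category) D.
        category J \<and> finite (obj J) \<and> finite (arr J) \<and> is_functor J C D
        \<longrightarrow> (\<exists>L l. is_limit J C D L l))"

definition slice :: "('o, 'a) category \<Rightarrow> 'o \<Rightarrow> ('a, 'a \<times> 'a \<times> 'a) category" where
  "slice C A = \<lparr>
     obj = {u \<in> arr C. tgt C u = A},
     arr = {(u, h, v). u \<in> arr C \<and> v \<in> arr C \<and> tgt C u = A \<and> tgt C v = A \<and>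
                       h \<in> hom C (src C u) (src C v) \<and> v \<cdot>\<^bsub>C\<^esub> h = u},
     src = (\<lambda>(u, h, v). u),
     tgt = (\<lambda>(u, h, v). v),
     idt = (\<lambda>u. (u, idt C (src C u), u)),
     cmp = (\<lambda>(_, k, w) (u, h, _). (u, k \<cdot>\<^bsub>C\<^esub> h, w))\<rparr>"

fun underlying :: "'a \<times> 'a \<times> 'a \<Rightarrow> 'a" where
  "underlying (u, h, v) = h"

datatype 'a poly_mor =
  PolyMor (poly_src: 'a) (poly_tgt: 'a) (on_pos: 'a) (on_dir: 'a)

context
  fixes C :: "('o, 'a) category" (structure)
begin

section \<open>Chosen pullbacks and products\<close>

definition is_pullback :: "'a \<Rightarrow> 'a \<Rightarrow> 'a \<Rightarrow> 'a \<Rightarrow> bool" where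
  "is_pullback f g a b \<longleftrightarrow> f \<in> arr C \<and> g \<in> arr C \<and> tgt C f = tgt C g \<and>
     a \<in> hom C (src C a) (src C f) \<and> b \<in> hom C (src C a) (src C g) \<and> f \<cdot> a = g \<cdot> b \<and>
     (\<forall>X x y. x \<in> hom C X (src C f) \<and> y \<in> hom C X (src C g) \<and> f \<cdot> x = g \<cdot> y \<longrightarrow>
        (\<exists>!h. h \<in> hom C X (src C a) \<and> a \<cdot> h = x \<and> b \<cdot> h = y))"

definition pb :: "'a \<Rightarrow> 'a \<Rightarrow> 'a \<times> 'a" where
  "pb f g = (SOME (a, b). is_pullback f g a b)"

definition pb1 :: "'a \<Rightarrow> 'a \<Rightarrow> 'a" where "pb1 f g = fst (pb f g)"

definition pb2 :: "'a \<Rightarrow> 'a \<Rightarrow> 'a" where "pb2 f g = snd (pb f g)"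

definition pb_pair :: "'a \<Rightarrow> 'a \<Rightarrow> 'a \<Rightarrow> 'a \<Rightarrow> 'a" where
  "pb_pair f g x y =
     (THE h. h \<in> hom C (src C x) (src C (pb1 f g)) \<and> pb1 f g \<cdot> h = x \<and> pb2 f g \<cdot> h = y)"

definition is_product :: "'o \<Rightarrow> 'o \<Rightarrow> 'a \<Rightarrow> 'a \<Rightarrow> bool" where
  "is_product X Y a b \<longleftrightarrow> a \<in> hom C (src C a) X \<and> b \<in> hom C (src C a) Y \<and>
     (\<forall>Z x y. x \<in> hom C Z X \<and> y \<in> hom C Z Y \<longrightarrow>
        (\<exists>!h. h \<in> hom C Z (src C a) \<and> a \<cdot> h = x \<and> b \<cdot> h = y))"

definition bprod :: "'o \<Rightarrow> 'o \<Rightarrow> 'a \<times> 'a" where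
  "bprod X Y = (SOME (a, b). is_product X Y a b)"

definition prj1 :: "'o \<Rightarrow> 'o \<Rightarrow> 'a" where "prj1 X Y = fst (bprod X Y)"

definition prj2 :: "'o \<Rightarrow> 'o \<Rightarrow> 'a" where "prj2 X Y = snd (bprod X Y)"

definition pair :: "'o \<Rightarrow> 'o \<Rightarrow> 'a \<Rightarrow> 'a \<Rightarrow> 'a" where
  "pair X Y x y =
     (THE h. h \<in> hom C (src C x) (src C (prj1 X Y)) \<and> prj1 X Y \<cdot> h = x \<and> prj2 X Y \<cdot> h = y)"

definition prod_map :: "'a \<Rightarrow> 'a \<Rightarrow> 'a" where
  "prod_map f g = pair (tgt C f) (tgt C g)
     (f \<cdot> prj1 (src C f) (src C g)) (g \<cdot> prj2 (src C f) (src C g))"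

section \<open>Pullback functors and exponentiable morphisms\<close>

text \<open>For \<open>h : u \<rightarrow> v\<close> over the codomain of \<open>f : B \<rightarrow> A\<close>, the map
  \<open>B \<times>\<^sub>A h : B \<times>\<^sub>A X \<rightarrow> B \<times>\<^sub>A Y\<close>.\<close>

definition pb_map :: "'a \<Rightarrow> 'a \<Rightarrow> 'a \<Rightarrow> 'a \<Rightarrow> 'a" where
  "pb_map f u h v = pb_pair f v (pb1 f u) (h \<cdot> pb2 f u)"

definition Delta :: "'a \<Rightarrow> ('a, 'a \<times> 'a \<times> 'a, 'a, 'a \<times> 'a \<times> 'a) cat_functor" where
  "Delta f = \<lparr>omap = (\<lambda>u. pb1 f u),
              amap = (\<lambda>(u, h, v). (pb1 f u, pb_map f u h v, pb1 f v))\<rparr>"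

definition is_Pi ::
  "'a \<Rightarrow> ('a, 'a \<times> 'a \<times> 'a, 'a, 'a \<times> 'a \<times> 'a) cat_functor \<Rightarrow>
   ('a \<Rightarrow> 'a \<times> 'a \<times> 'a) \<Rightarrow> ('a \<Rightarrow> 'a \<times> 'a \<times> 'a) \<Rightarrow> bool" where
  "is_Pi f G \<eta> \<epsilon> \<longleftrightarrow> adjunction (slice C (tgt C f)) (slice C (src C f)) (Delta f) G \<eta> \<epsilon>"

definition exponentiable :: "'a \<Rightarrow> bool" where
  "exponentiable f \<longleftrightarrow> f \<in> arr C \<and> (\<exists>G \<eta> \<epsilon>. is_Pi f G \<eta> \<epsilon>)"

definition Pi_adj ::
  "'a \<Rightarrow> ('a, 'a \<times> 'a \<times> 'a, 'a, 'a \<times> 'a \<times> 'a) cat_functor \<times>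
         ('a \<Rightarrow> 'a \<times> 'a \<times> 'a) \<times> ('a \<Rightarrow> 'a \<times> 'a \<times> 'a)" where
  "Pi_adj f = (SOME (G, \<eta>, \<epsilon>). is_Pi f G \<eta> \<epsilon>)"

definition Pi_fun :: "'a \<Rightarrow> ('a, 'a \<times> 'a \<times> 'a, 'a, 'a \<times> 'a \<times> 'a) cat_functor" where
  "Pi_fun f = fst (Pi_adj f)"

definition Pi_unit :: "'a \<Rightarrow> 'a \<Rightarrow> 'a \<times> 'a \<times> 'a" where
  "Pi_unit f = fst (snd (Pi_adj f))"

definition Pi_counit :: "'a \<Rightarrow> 'a \<Rightarrow> 'a \<times> 'a \<times> 'a" where
  "Pi_counit f = snd (snd (Pi_adj f))"

text \<open>The underlying map \<open>u \<rightarrow> \<Pi>\<^sub>f v\<close> of the transpose of \<open>h : \<Delta>\<^sub>f u \<rightarrow> v\<close>.\<close>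

definition Pi_transpose :: "'a \<Rightarrow> 'a \<Rightarrow> 'a \<Rightarrow> 'a \<Rightarrow> 'a" where
  "Pi_transpose f u v h =
     underlying (amap (Pi_fun f) (pb1 f u, h, v) \<cdot>\<^bsub>slice C (tgt C f)\<^esub> Pi_unit f u)"

section \<open>The category of polynomials\<close>

text \<open>A polynomial \<open>p : P\<^sub>* \<rightarrow> P\<close> has \<^term>\<open>tgt C p\<close> as its object of positions \<open>P\<close> and
  \<^term>\<open>src C p\<close> as \<open>P\<^sub>*\<close>; the product \<open>P \<times>\<^sub>Q Q\<^sub>*\<close> is the chosen pullback of \<open>\<phi>\<^sub>1\<close> and \<open>q\<close>.
  In \<open>poly_cmp\<close> the map \<open>\<iota>\<close> is the isomorphism
  \<open>P \<times>\<^sub>R R\<^sub>* \<cong> P \<times>\<^sub>Q (Q \<times>\<^sub>R R\<^sub>*)\<close>.\<close>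

definition is_poly_mor :: "'a poly_mor \<Rightarrow> bool" where
  "is_poly_mor \<phi> \<longleftrightarrow>
     (let p = poly_src \<phi>; q = poly_tgt \<phi>; f = on_pos \<phi>; s = on_dir \<phi> in
        exponentiable p \<and> exponentiable q \<and>
        f \<in> hom C (tgt C p) (tgt C q) \<and>
        s \<in> hom C (src C (pb1 f q)) (src C p) \<and>
        p \<cdot> s = pb1 f q)"

definition poly_cmp :: "'a poly_mor \<Rightarrow> 'a poly_mor \<Rightarrow> 'a poly_mor" where
  "poly_cmp \<psi> \<phi> =
     (let p = poly_src \<phi>; q = poly_tgt \<phi>; r = poly_tgt \<psi>;
          f = on_pos \<phi>; g = on_pos \<psi>;
          \<iota> = pb_pair f (pb1 g r) (pb1 (g \<cdot> f) r)
                (pb_pair g r (f \<cdot> pb1 (g \<cdot> f) r) (pb2 (g \<cdot> f) r))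
      in PolyMor p r (g \<cdot> f) (on_dir \<phi> \<cdot> (pb_map f (pb1 g r) (on_dir \<psi>) q \<cdot> \<iota>)))"

definition Poly :: "('a, 'a poly_mor) category" where
  "Poly = \<lparr>
     obj = {p. exponentiable p},
     arr = {\<phi>. is_poly_mor \<phi>},
     src = poly_src,
     tgt = poly_tgt,
     idt = (\<lambda>p. PolyMor p p (idt C (tgt C p)) (pb2 (idt C (tgt C p)) p)),
     cmp = poly_cmp\<rparr>"

section \<open>The composition product\<close>

text \<open>\<open>tri_base p q : \<Pi>\<^sub>p(Q \<times> P\<^sub>*) \<rightarrow> P\<close>, where \<open>Q \<times> P\<^sub>*\<close> lies over \<open>P\<^sub>*\<close>, and
  \<open>tri_eval p q : P\<^sub>* \<times>\<^sub>P \<Pi>\<^sub>p(Q \<times> P\<^sub>*) \<rightarrow> Q\<close>.\<close>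

definition tri_base :: "'a \<Rightarrow> 'a \<Rightarrow> 'a" where
  "tri_base p q = omap (Pi_fun p) (prj2 (tgt C q) (src C p))"

definition tri_eval :: "'a \<Rightarrow> 'a \<Rightarrow> 'a" where
  "tri_eval p q = prj1 (tgt C q) (src C p) \<cdot> underlying (Pi_counit p (prj2 (tgt C q) (src C p)))"

definition tri :: "'a \<Rightarrow> 'a \<Rightarrow> 'a" where
  "tri p q = pb2 p (tri_base p q) \<cdot> pb1 (tri_eval p q) q"

text \<open>The map \<open>X \<rightarrow> \<Pi>\<^sub>p(Q \<times> P\<^sub>*)\<close> given by \<open>x : X \<rightarrow> P\<close> and \<open>f : P\<^sub>* \<times>\<^sub>P X \<rightarrow> Q\<close>.\<close>

definition tri_point :: "'a \<Rightarrow> 'a \<Rightarrow> 'a \<Rightarrow> 'a \<Rightarrow> 'a" where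
  "tri_point p q x f =
     Pi_transpose p x (prj2 (tgt C q) (src C p)) (pair (tgt C q) (src C p) f (pb1 p x))"

text \<open>\<open>(\<phi> \<triangleleft> \<psi>)\<^sub>1\<close> is the formula \<open>(x, f) \<mapsto> (\<phi>\<^sub>1 x, \<psi>\<^sub>1 \<circ> f \<circ> \<phi>\<^sup>\<sharp>(x, -))\<close> evaluated at the universal
  generalized element \<open>x = tri_base p q\<close>, \<open>f = tri_eval p q\<close>; here \<open>s\<close> is the map
  \<open>(y', t) \<mapsto> (\<phi>\<^sup>\<sharp>(x(t), y'), t)\<close>.\<close>

definition tri_map_pos :: "'a poly_mor \<Rightarrow> 'a poly_mor \<Rightarrow> 'a" where
  "tri_map_pos \<phi> \<psi> =
     (let p = poly_src \<phi>; p' = poly_tgt \<phi>; q = poly_src \<psi>; q' = poly_tgt \<psi>;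
          x = tri_base p q; f = tri_eval p q; x' = on_pos \<phi> \<cdot> x;
          s = pb_pair p x
                (on_dir \<phi> \<cdot> pb_pair (on_pos \<phi>) p' (x \<cdot> pb2 p' x') (pb1 p' x'))
                (pb2 p' x')
      in tri_point p' q' x' (on_pos \<psi> \<cdot> (f \<cdot> s)))"

text \<open>\<open>(\<phi> \<triangleleft> \<psi>)\<^sup>\<sharp>\<close> at the universal element of the pullback of \<open>p' \<triangleleft> q'\<close> along \<open>(\<phi> \<triangleleft> \<psi>)\<^sub>1\<close>, which
  consists of a position \<open>t\<close> of \<open>p \<triangleleft> q\<close> and a direction \<open>(y', z')\<close>: with \<open>y = \<phi>\<^sup>\<sharp>(x(t), y')\<close> and
  \<open>w = (y, t)\<close>, the result is \<open>(w, \<psi>\<^sup>\<sharp>(f(w), z'))\<close>.\<close>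

definition tri_map_dir :: "'a poly_mor \<Rightarrow> 'a poly_mor \<Rightarrow> 'a" where
  "tri_map_dir \<phi> \<psi> =
     (let p = poly_src \<phi>; p' = poly_tgt \<phi>; q = poly_src \<psi>; q' = poly_tgt \<psi>;
          m = tri_map_pos \<phi> \<psi>;
          t = pb1 m (tri p' q');
          d' = pb2 m (tri p' q');
          y' = pb1 p' (tri_base p' q') \<cdot> (pb1 (tri_eval p' q') q' \<cdot> d');
          z' = pb2 (tri_eval p' q') q' \<cdot> d';
          y = on_dir \<phi> \<cdot> pb_pair (on_pos \<phi>) p' (tri_base p q \<cdot> t) y';
          w = pb_pair p (tri_base p q) y t
      in pb_pair (tri_eval p q) q w
           (on_dir \<psi> \<cdot> pb_pair (on_pos \<psi>) q' (tri_eval p q \<cdot> w) z'))"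

definition tri_map :: "'a poly_mor \<Rightarrow> 'a poly_mor \<Rightarrow> 'a poly_mor" where
  "tri_map \<phi> \<psi> =
     PolyMor (tri (poly_src \<phi>) (poly_src \<psi>)) (tri (poly_tgt \<phi>) (poly_tgt \<psi>))
       (tri_map_pos \<phi> \<psi>) (tri_map_dir \<phi> \<psi>)"

section \<open>The left coclosure\<close>

text \<open>The morphism \<open>[q; p]\<close> (\<open>q\<close> written above \<open>p\<close>) is \<^term>\<open>bracket q p\<close>. Its generalized
  elements over \<open>x\<close> in \<open>P\<close> are pairs \<open>(y, g)\<close> of a position \<open>y\<close> of \<open>q\<close> and a map \<open>g\<close> from the
  directions of \<open>q\<close> at \<open>y\<close> to the directions of \<open>p\<close> at \<open>x\<close>.\<close>

definition br_exp :: "'a \<Rightarrow> 'a \<Rightarrow> 'a" where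
  "br_exp q p = prod_map (idt C (tgt C p)) q"

definition br_arg :: "'a \<Rightarrow> 'a \<Rightarrow> 'a" where
  "br_arg q p = prod_map p (idt C (src C q))"

definition br_base :: "'a \<Rightarrow> 'a \<Rightarrow> 'a" where
  "br_base q p = omap (Pi_fun (br_exp q p)) (br_arg q p)"

definition bracket :: "'a \<Rightarrow> 'a \<Rightarrow> 'a" where
  "bracket q p = prj1 (tgt C p) (tgt C q) \<cdot> br_base q p"

text \<open>\<open>br_eval q p : (P \<times> Q\<^sub>*) \<times>\<^bsub>P \<times> Q\<^esub> [q; p]\<^sub>* \<rightarrow> P\<^sub>*\<close>, that is, \<open>((x, z), (x, y, g)) \<mapsto> g(z)\<close>.\<close>

definition br_eval :: "'a \<Rightarrow> 'a \<Rightarrow> 'a" where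
  "br_eval q p =
     prj1 (src C p) (src C q) \<cdot> underlying (Pi_counit (br_exp q p) (br_arg q p))"

text \<open>The joint functorial action: \<open>\<psi> : q \<rightarrow> q'\<close> and \<open>\<phi> : p' \<rightarrow> p\<close> induce a morphism of
  polynomials \<open>[q'; p'] \<rightarrow> [q; p]\<close>. On positions it is \<open>\<phi>\<^sub>1\<close>; on directions it sends
  \<open>(x', (y, g))\<close>, with \<open>(y, g)\<close> over \<open>\<phi>\<^sub>1 x'\<close>, to
  \<open>(\<psi>\<^sub>1 y, z' \<mapsto> \<phi>\<^sup>\<sharp>(x', g(\<psi>\<^sup>\<sharp>(y, z'))))\<close>.
  Below, \<open>z'\<close>, \<open>z\<close>, \<open>gz\<close> and \<open>g'\<close> are defined on the pullback of \<open>P' \<times> Q'\<^sub>*\<close> along \<open>b' = (x', \<psi>\<^sub>1 y)\<close>,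
  whose projection \<open>d\<close> forgets \<open>z'\<close>; the map \<open>z' \<mapsto> g'\<close> is then transposed.\<close>

definition br_map_dir :: "'a poly_mor \<Rightarrow> 'a poly_mor \<Rightarrow> 'a" where
  "br_map_dir \<psi> \<phi> =
     (let q = poly_src \<psi>; q' = poly_tgt \<psi>; p' = poly_src \<phi>; p = poly_tgt \<phi>;
          x' = pb1 (on_pos \<phi>) (bracket q p);
          e = pb2 (on_pos \<phi>) (bracket q p);
          y = prj2 (tgt C p) (tgt C q) \<cdot> (br_base q p \<cdot> e);
          b' = pair (tgt C p') (tgt C q') x' (on_pos \<psi> \<cdot> y);
          z' = prj2 (tgt C p') (src C q') \<cdot> pb1 (br_exp q' p') b';
          d = pb2 (br_exp q' p') b';
          z = on_dir \<psi> \<cdot> pb_pair (on_pos \<psi>) q' (y \<cdot> d) z';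
          gz = br_eval q p \<cdot>
                 pb_pair (br_exp q p) (br_base q p)
                   (pair (tgt C p) (src C q) (on_pos \<phi> \<cdot> (x' \<cdot> d)) z) (e \<cdot> d);
          g' = on_dir \<phi> \<cdot> pb_pair (on_pos \<phi>) p (x' \<cdot> d) gz
      in Pi_transpose (br_exp q' p') b' (br_arg q' p') (pair (src C p') (src C q') g' z'))"

definition br_map :: "'a poly_mor \<Rightarrow> 'a poly_mor \<Rightarrow> 'a poly_mor" where
  "br_map \<psi> \<phi> =
     PolyMor (bracket (poly_tgt \<psi>) (poly_src \<phi>)) (bracket (poly_src \<psi>) (poly_tgt \<phi>))
       (on_pos \<phi>) (br_map_dir \<psi> \<phi>)"

end

end

theory Submission
  imports Defs
begin

text \<open>A morphism \<open>p \<rightarrow> r \<triangleleft> q\<close> consists of maps \<open>x : P \<rightarrow> R\<close> and \<open>f : R\<^sub>* \<times>\<^sub>R P \<rightarrow> Q\<close>, and a map sending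
  \<open>(t, y, z)\<close>, with \<open>z\<close> a direction of \<open>q\<close> at \<open>f(t, y)\<close>, to a direction of \<open>p\<close> at \<open>t\<close>. Transposing the
  last map along \<open>id\<^sub>P \<times> q\<close> turns \<open>f\<close> and it into a single map from \<open>P \<times>\<^sub>R R\<^sub>*\<close> to the domain of
  \<open>[q; p]\<close>, which together with \<open>x\<close> is a morphism \<open>[q; p] \<rightarrow> r\<close>. All universal properties are
  expressed on generalized elements: a morphism out of a pullback is a natural function on compatible
  pairs of arrows, so that naturality of the bijection becomes an equality of formulas. That \<open>r \<triangleleft> q\<close>
  and \<open>id\<^sub>P \<times> q\<close> are exponentiable follows from closure of exponentiable morphisms under composition
  and pullback.\<close>

section \<open>Adjunctions and universal arrows\<close>

text \<open>Chosen pullbacks compose only up to isomorphism, and \<open>\<Pi>\<close> is an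
  arbitrary choice of right adjoint, so working with the definitions directly would mean carrying
  coherence isomorphisms through every argument. \<open>pi_rep\<close> removes the choices: it
  states the universal property of \<open>\<Pi>\<^sub>f v\<close> in terms of commuting squares
  alone, and \<open>Pi_universal\<close> and \<open>exponentiable_iff\<close> translate between it
  and the chosen adjoint. The bijection is not obtained from a pair of mutually inverse formulas.
  The relation \<open>transposes\<close> compares the data common to both sides; it is shown to be
  total and single valued from each side, hence the graph of a bijection. Naturality then only asks
  that the relation be stable under composition with morphisms, since uniqueness turns stability
  into an equation.\<close>

lemma hom_iff: "f \<in> hom C X Y \<longleftrightarrow> f \<in> arr C \<and> src C f = X \<and> tgt C f = Y"
  by (simp add: hom_def)

context category
begin

lemma arr_cmp [simp]: "f \<in> arr C \<Longrightarrow> g \<in> arr C \<Longrightarrow> tgt C f = src C g \<Longrightarrow> g \<cdot> f \<in> arr C"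
  and src_cmp [simp]: "f \<in> arr C \<Longrightarrow> g \<in> arr C \<Longrightarrow> tgt C f = src C g \<Longrightarrow> src C (g \<cdot> f) = src C f"
  and tgt_cmp [simp]: "f \<in> arr C \<Longrightarrow> g \<in> arr C \<Longrightarrow> tgt C f = src C g \<Longrightarrow> tgt C (g \<cdot> f) = tgt C g"
  using cmp_hom[of f "src C f" "tgt C f" g "tgt C g"] by (auto simp: hom_iff)

lemma idt_arr [simp]: "X \<in> obj C \<Longrightarrow> idt C X \<in> arr C"
  and src_idt [simp]: "X \<in> obj C \<Longrightarrow> src C (idt C X) = X"
  and tgt_idt [simp]: "X \<in> obj C \<Longrightarrow> tgt C (idt C X) = X"
  using idt_hom[of X] by (auto simp: hom_iff)

lemma cmp_idt_left [simp]: "f \<in> arr C \<Longrightarrow> tgt C f = X \<Longrightarrow> idt C X \<cdot> f = f"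
  and cmp_idt_right [simp]: "f \<in> arr C \<Longrightarrow> src C f = X \<Longrightarrow> f \<cdot> idt C X = f"
  using idt_left idt_right by (auto simp: hom_iff)

lemma assoc [simp]:
  "f \<in> arr C \<Longrightarrow> g \<in> arr C \<Longrightarrow> h \<in> arr C \<Longrightarrow> tgt C f = src C g \<Longrightarrow> tgt C g = src C h
    \<Longrightarrow> h \<cdot> (g \<cdot> f) = h \<cdot> g \<cdot> f"
  by (rule cmp_assoc[of f "src C f" "tgt C f" g "tgt C g" h "tgt C h"]) (auto simp: hom_iff)

declare src_obj [simp] tgt_obj [simp]

end

lemma functor_rules:
  assumes "is_functor C D F"
  shows "category C" "category D"
    "\<And>X. X \<in> obj C \<Longrightarrow> omap F X \<in> obj D"
    "\<And>f. f \<in> arr C \<Longrightarrow> amap F f \<in> arr D"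
    "\<And>f. f \<in> arr C \<Longrightarrow> src D (amap F f) = omap F (src C f)"
    "\<And>f. f \<in> arr C \<Longrightarrow> tgt D (amap F f) = omap F (tgt C f)"
    "\<And>X. X \<in> obj C \<Longrightarrow> amap F (idt C X) = idt D (omap F X)"
    "\<And>f g. f \<in> arr C \<Longrightarrow> g \<in> arr C \<Longrightarrow> tgt C f = src C g
       \<Longrightarrow> amap F (g \<cdot>\<^bsub>C\<^esub> f) = amap F g \<cdot>\<^bsub>D\<^esub> amap F f"
  using assms by (auto simp: is_functor_def hom_iff)

lemma is_functor_id: "category C \<Longrightarrow> is_functor C C id_functor"
  by (auto simp: is_functor_def id_functor_def hom_iff)

lemma is_functor_comp: "is_functor C D F \<Longrightarrow> is_functor D E G \<Longrightarrow> is_functor C E (comp_functor G F)"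
  by (auto simp: is_functor_def comp_functor_def hom_iff)

text \<open>The counit is a universal arrow: its naturality and one triangle identity show that the
  displayed map solves the equation; naturality of the unit and the other triangle identity show
  that every solution has this form.\<close>

lemma adjunction_transpose:
  assumes adj: "adjunction C D F G \<eta> \<epsilon>" and X: "X \<in> obj C" and Y: "Y \<in> obj D"
    and h: "h \<in> hom D (omap F X) Y"
  shows "amap G h \<cdot>\<^bsub>C\<^esub> \<eta> X \<in> hom C X (omap G Y)"
    and "\<epsilon> Y \<cdot>\<^bsub>D\<^esub> amap F (amap G h \<cdot>\<^bsub>C\<^esub> \<eta> X) = h"
    and "k \<in> hom C X (omap G Y) \<Longrightarrow> \<epsilon> Y \<cdot>\<^bsub>D\<^esub> amap F k = h \<Longrightarrow> k = amap G h \<cdot>\<^bsub>C\<^esub> \<eta> X"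
proof -
  have F: "is_functor C D F" and G: "is_functor D C G"
    and n\<eta>: "is_nat_trans C C id_functor (comp_functor G F) \<eta>"
    and n\<epsilon>: "is_nat_trans D D (comp_functor F G) id_functor \<epsilon>"
    and t1: "\<And>X. X \<in> obj C \<Longrightarrow> \<epsilon> (omap F X) \<cdot>\<^bsub>D\<^esub> amap F (\<eta> X) = idt D (omap F X)"
    and t2: "\<And>Y. Y \<in> obj D \<Longrightarrow> amap G (\<epsilon> Y) \<cdot>\<^bsub>C\<^esub> \<eta> (omap G Y) = idt C (omap G Y)"
    using adj by (auto simp: adjunction_def)
  interpret C: category C by (rule functor_rules(1)[OF F])
  interpret D: category D by (rule functor_rules(2)[OF F])
  note [simp] = functor_rules(3-)[OF F] functor_rules(3-)[OF G]
  have [simp]: "\<eta> X \<in> arr C" "src C (\<eta> X) = X" "tgt C (\<eta> X) = omap G (omap F X)" if "X \<in> obj C" for X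
    using n\<eta> that by (auto simp: is_nat_trans_def id_functor_def comp_functor_def hom_iff)
  have [simp]: "\<epsilon> Y \<in> arr D" "tgt D (\<epsilon> Y) = Y" "src D (\<epsilon> Y) = omap F (omap G Y)" if "Y \<in> obj D" for Y
    using n\<epsilon> that by (auto simp: is_nat_trans_def id_functor_def comp_functor_def hom_iff)
  have nat\<eta>: "\<eta> (tgt C f) \<cdot>\<^bsub>C\<^esub> f = amap G (amap F f) \<cdot>\<^bsub>C\<^esub> \<eta> (src C f)" if "f \<in> arr C" for f
    using n\<eta> that by (auto simp: is_nat_trans_def id_functor_def comp_functor_def)
  have nat\<epsilon>: "\<epsilon> (tgt D f) \<cdot>\<^bsub>D\<^esub> amap F (amap G f) = f \<cdot>\<^bsub>D\<^esub> \<epsilon> (src D f)" if "f \<in> arr D" for f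
    using n\<epsilon> that by (auto simp: is_nat_trans_def id_functor_def comp_functor_def)
  have [simp]: "h \<in> arr D" "src D h = omap F X" "tgt D h = Y" using h by (auto simp: hom_iff)
  note [simp] = X Y
  show "amap G h \<cdot>\<^bsub>C\<^esub> \<eta> X \<in> hom C X (omap G Y)" by (simp add: hom_iff)
  have "\<epsilon> Y \<cdot>\<^bsub>D\<^esub> amap F (amap G h \<cdot>\<^bsub>C\<^esub> \<eta> X) = h \<cdot>\<^bsub>D\<^esub> (\<epsilon> (omap F X) \<cdot>\<^bsub>D\<^esub> amap F (\<eta> X))"
    using nat\<epsilon>[of h] by simp
  then show "\<epsilon> Y \<cdot>\<^bsub>D\<^esub> amap F (amap G h \<cdot>\<^bsub>C\<^esub> \<eta> X) = h" by (simp add: t1 del: D.assoc)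
  assume k: "k \<in> hom C X (omap G Y)" and eq: "\<epsilon> Y \<cdot>\<^bsub>D\<^esub> amap F k = h"
  have [simp]: "k \<in> arr C" "src C k = X" "tgt C k = omap G Y" using k by (auto simp: hom_iff)
  have "amap G h \<cdot>\<^bsub>C\<^esub> \<eta> X = amap G (\<epsilon> Y) \<cdot>\<^bsub>C\<^esub> (amap G (amap F k) \<cdot>\<^bsub>C\<^esub> \<eta> X)"
    by (simp add: eq[symmetric])
  also have "\<dots> = (amap G (\<epsilon> Y) \<cdot>\<^bsub>C\<^esub> \<eta> (omap G Y)) \<cdot>\<^bsub>C\<^esub> k"
    using nat\<eta>[of k] by (simp del: C.assoc add: C.assoc[symmetric])
  finally show "k = amap G h \<cdot>\<^bsub>C\<^esub> \<eta> X" by (simp add: t2)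
qed

text \<open>Exponentiability asks for a whole adjunction, while the closure proofs below construct
  one object \<open>\<Pi>\<^sub>f v\<close> at a time. Universal arrows suffice, because
  \<open>G\<close> on morphisms and the unit can be defined as transposes.\<close>

lemma adjunction_if_universal_arrows:
  assumes F: "is_functor C D F"
    and univ: "\<And>Y. Y \<in> obj D \<Longrightarrow> \<exists>W e. W \<in> obj C \<and> e \<in> hom D (omap F W) Y \<and>
      (\<forall>X h. X \<in> obj C \<longrightarrow> h \<in> hom D (omap F X) Y
         \<longrightarrow> (\<exists>!k. k \<in> hom C X W \<and> e \<cdot>\<^bsub>D\<^esub> amap F k = h))"
  shows "\<exists>G \<eta> \<epsilon>. adjunction C D F G \<eta> \<epsilon>"
proof -
  interpret C: category C by (rule functor_rules(1)[OF F])
  interpret D: category D by (rule functor_rules(2)[OF F])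
  note [simp] = functor_rules(3-)[OF F]
  obtain W e where W [simp]: "\<And>Y. Y \<in> obj D \<Longrightarrow> W Y \<in> obj C"
    and e: "\<And>Y. Y \<in> obj D \<Longrightarrow> e Y \<in> hom D (omap F (W Y)) Y"
    and ex: "\<And>X Y h. Y \<in> obj D \<Longrightarrow> X \<in> obj C \<Longrightarrow> h \<in> hom D (omap F X) Y
         \<Longrightarrow> (\<exists>!k. k \<in> hom C X (W Y) \<and> e Y \<cdot>\<^bsub>D\<^esub> amap F k = h)"
    using univ by metis
  have [simp]: "e Y \<in> arr D" "tgt D (e Y) = Y" "src D (e Y) = omap F (W Y)" if "Y \<in> obj D" for Y
    using e[OF that] by (auto simp: hom_iff)
  define T where "T X Y h = (THE k. k \<in> hom C X (W Y) \<and> e Y \<cdot>\<^bsub>D\<^esub> amap F k = h)" for X Y h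
  have T: "T X Y h \<in> hom C X (W Y) \<and> e Y \<cdot>\<^bsub>D\<^esub> amap F (T X Y h) = h"
    if "Y \<in> obj D" "X \<in> obj C" "h \<in> hom D (omap F X) Y" for X Y h
    unfolding T_def using theI'[OF ex[OF that]] .
  have T_arr [simp]: "T X Y h \<in> arr C" "src C (T X Y h) = X" "tgt C (T X Y h) = W Y"
      "e Y \<cdot>\<^bsub>D\<^esub> amap F (T X Y h) = h"
    if "Y \<in> obj D" "X \<in> obj C" "h \<in> arr D" "src D h = omap F X" "tgt D h = Y" for X Y h
    using T[of Y X h] that by (auto simp: hom_iff)
  \<comment> \<open>Maps into \<open>W Y\<close> can be compared after composition with
    \<open>e Y\<close>. The functor laws, naturality of the unit and the second triangle identity
    are all proved this way.\<close>
  have uniq: "k = k'" if "Y \<in> obj D" "k \<in> arr C" "k' \<in> arr C" "src C k = src C k'" "tgt C k = W Y" "tgt C k' = W Y"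
    "e Y \<cdot>\<^bsub>D\<^esub> amap F k = e Y \<cdot>\<^bsub>D\<^esub> amap F k'" for Y k k'
  proof -
    have "\<exists>!m. m \<in> hom C (src C k) (W Y) \<and> e Y \<cdot>\<^bsub>D\<^esub> amap F m = e Y \<cdot>\<^bsub>D\<^esub> amap F k"
      by (rule ex) (use that in \<open>auto simp: hom_iff\<close>)
    then show ?thesis using that by (auto simp: hom_iff)
  qed
  define G where "G = \<lparr>omap = W, amap = (\<lambda>h. T (W (src D h)) (tgt D h) (h \<cdot>\<^bsub>D\<^esub> e (src D h)))\<rparr>"
  define \<eta> where "\<eta> X = T X (omap F X) (idt D (omap F X))" for X
  have [simp]: "omap G Y = W Y" for Y by (simp add: G_def)
  have [simp]: "\<eta> X \<in> arr C" "src C (\<eta> X) = X" "tgt C (\<eta> X) = W (omap F X)"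
    "e (omap F X) \<cdot>\<^bsub>D\<^esub> amap F (\<eta> X) = idt D (omap F X)" if "X \<in> obj C" for X
    using that by (auto simp: \<eta>_def)
  have [simp]: "amap G h \<in> arr C" "src C (amap G h) = W (src D h)" "tgt C (amap G h) = W (tgt D h)"
    and e_nat: "e (tgt D h) \<cdot>\<^bsub>D\<^esub> amap F (amap G h) = h \<cdot>\<^bsub>D\<^esub> e (src D h)" if "h \<in> arr D" for h
    using that by (auto simp: G_def)
  have G: "is_functor D C G"
    unfolding is_functor_def
  proof (intro conjI ballI impI)
    show "amap G (idt D X) = idt C (omap G X)" if "X \<in> obj D" for X
      by (rule uniq[of X]) (use that e_nat[of "idt D X"] in auto)
  next
    fix f g assume fg [simp]: "f \<in> arr D" "g \<in> arr D" "tgt D f = src D g"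
    have "e (tgt D g) \<cdot>\<^bsub>D\<^esub> amap F (amap G g \<cdot>\<^bsub>C\<^esub> amap G f) = g \<cdot>\<^bsub>D\<^esub> (e (tgt D f) \<cdot>\<^bsub>D\<^esub> amap F (amap G f))"
      by (simp add: e_nat)
    also have "\<dots> = g \<cdot>\<^bsub>D\<^esub> f \<cdot>\<^bsub>D\<^esub> e (src D f)"
      by (subst e_nat) auto
    also have "\<dots> = e (tgt D g) \<cdot>\<^bsub>D\<^esub> amap F (amap G (g \<cdot>\<^bsub>D\<^esub> f))"
      using e_nat[of "g \<cdot>\<^bsub>D\<^esub> f"] by simp
    finally show "amap G (g \<cdot>\<^bsub>D\<^esub> f) = amap G g \<cdot>\<^bsub>C\<^esub> amap G f"
      by (intro uniq[of "tgt D g"]) auto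
  qed (auto simp: hom_iff C.category_axioms D.category_axioms)
  have [simp]: "g \<cdot>\<^bsub>D\<^esub> e (omap F X) \<cdot>\<^bsub>D\<^esub> amap F (\<eta> X) = g"
    if "X \<in> obj C" "g \<in> arr D" "src D g = omap F X" for X g
    using D.assoc[of "amap F (\<eta> X)" "e (omap F X)" g] that by simp
  have "\<eta> (tgt C f) \<cdot>\<^bsub>C\<^esub> f = amap G (amap F f) \<cdot>\<^bsub>C\<^esub> \<eta> (src C f)" if [simp]: "f \<in> arr C" for f
    by (rule uniq[of "omap F (tgt C f)"]) (use e_nat[of "amap F f"] in auto)
  moreover have "amap G (e Y) \<cdot>\<^bsub>C\<^esub> \<eta> (W Y) = idt C (W Y)" if [simp]: "Y \<in> obj D" for Y
    by (rule uniq[of Y]) (use e_nat[of "e Y"] in auto)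
  ultimately have "adjunction C D F G \<eta> e"
    using F G is_functor_id[OF C.category_axioms] is_functor_id[OF D.category_axioms]
      is_functor_comp[OF F G] is_functor_comp[OF G F] e_nat
    by (auto simp: adjunction_def is_nat_trans_def id_functor_def comp_functor_def hom_iff)
  then show ?thesis by blast
qed

section \<open>Pullbacks and products\<close>

lemma (in category) ex_product:
  assumes lim: "has_finite_limits C" and X: "X \<in> obj C" and Y: "Y \<in> obj C"
  shows "\<exists>a b. is_product C X Y a b"
proof -
  \<comment> \<open>The discrete category on two objects; each object doubles as its identity
    arrow.\<close>
  define J :: "(nat, nat) category" where
    "J = \<lparr>obj = {0, 1}, arr = {0, 1}, src = id, tgt = id, idt = id, cmp = (\<lambda>g f. f)\<rparr>"
  define D :: "(nat, nat, 'o, 'a) cat_functor" where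
    "D = \<lparr>omap = (\<lambda>i. if i = 0 then X else Y), amap = (\<lambda>i. idt C (if i = 0 then X else Y))\<rparr>"
  have "category J" by unfold_locales (auto simp: J_def hom_iff)
  moreover have "is_functor J C D"
    using \<open>category J\<close> category_axioms X Y by (auto simp: is_functor_def J_def D_def hom_iff)
  moreover have "finite (obj J)" "finite (arr J)" by (auto simp: J_def)
  ultimately obtain L l where L: "is_limit J C D L l"
    using lim unfolding has_finite_limits_def by blast
  have cone: "is_cone J C D M m \<longleftrightarrow> M \<in> obj C \<and> m 0 \<in> hom C M X \<and> m 1 \<in> hom C M Y" for M m
    using X Y by (auto simp: is_cone_def J_def D_def hom_iff)
  have l: "l 0 \<in> hom C L X" "l 1 \<in> hom C L Y" using L cone[of L l] by (auto simp: is_limit_def)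
  have "\<exists>!h. h \<in> hom C Z L \<and> l 0 \<cdot> h = x \<and> l 1 \<cdot> h = y" if "x \<in> hom C Z X" "y \<in> hom C Z Y" for Z x y
  proof -
    have "is_cone J C D Z (\<lambda>i. if i = 0 then x else y)"
      using that by (auto simp: cone hom_iff)
    then have "\<exists>!h. h \<in> hom C Z L \<and> (\<forall>i\<in>obj J. l i \<cdot> h = (if i = 0 then x else y))"
      using L by (auto simp: is_limit_def)
    then show ?thesis by (simp add: J_def)
  qed
  then show ?thesis using l unfolding is_product_def by (intro exI[of _ "l 0"] exI[of _ "l 1"]) (auto simp: hom_iff)
qed

lemma (in category) ex_pullback:
  assumes lim: "has_finite_limits C" and f: "f \<in> arr C" and g: "g \<in> arr C" and fg: "tgt C f = tgt C g"
  shows "\<exists>a b. is_pullback C f g a b"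
proof -
  \<comment> \<open>The cospan \<open>0 \<rightarrow> 2 \<leftarrow> 1\<close>: arrows
    \<open>0\<close>, \<open>1\<close>, \<open>2\<close> are identities, \<open>3\<close> and
    \<open>4\<close> are the two legs. A leg can only be followed by an identity, so a composite is
    the later arrow if the earlier one is an identity, and the earlier one otherwise.\<close>
  define J :: "(nat, nat) category" where
    "J = \<lparr>obj = {0, 1, 2}, arr = {0, 1, 2, 3, 4},
      src = (\<lambda>a. if a = 3 then 0 else if a = 4 then 1 else a), tgt = (\<lambda>a. if a < 3 then a else 2),
      idt = id, cmp = (\<lambda>b a. if a < 3 then b else a)\<rparr>"
  define D :: "(nat, nat, 'o, 'a) cat_functor" where
    "D = \<lparr>omap = (\<lambda>i. if i = 0 then src C f else if i = 1 then src C g else tgt C f),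
      amap = (\<lambda>i. if i = 3 then f else if i = 4 then g else
                idt C (if i = 0 then src C f else if i = 1 then src C g else tgt C f))\<rparr>"
  have "category J" by unfold_locales (auto simp: J_def hom_iff)
  moreover have "is_functor J C D"
    using \<open>category J\<close> category_axioms f g fg by (auto simp: is_functor_def J_def D_def hom_iff)
  moreover have "finite (obj J)" "finite (arr J)" by (auto simp: J_def)
  ultimately obtain L l where L: "is_limit J C D L l"
    using lim unfolding has_finite_limits_def by blast
  have cone: "is_cone J C D M m \<longleftrightarrow> M \<in> obj C \<and> m 0 \<in> hom C M (src C f) \<and> m 1 \<in> hom C M (src C g)
      \<and> m 2 = f \<cdot> m 0 \<and> f \<cdot> m 0 = g \<cdot> m 1" for M m
    using f g fg by (auto simp: is_cone_def J_def D_def hom_iff)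
  have l: "l 0 \<in> hom C L (src C f)" "l 1 \<in> hom C L (src C g)" "f \<cdot> l 0 = g \<cdot> l 1" "l 2 = f \<cdot> l 0"
    using L cone[of L l] by (auto simp: is_limit_def)
  have "\<exists>!h. h \<in> hom C Z L \<and> l 0 \<cdot> h = x \<and> l 1 \<cdot> h = y"
    if "x \<in> hom C Z (src C f)" "y \<in> hom C Z (src C g)" "f \<cdot> x = g \<cdot> y" for Z x y
  proof -
    \<comment> \<open>The leg at the corner \<open>2\<close> is forced to be
      \<open>f \<cdot> x\<close>, so cones over the cospan amount to commuting squares.\<close>
    have "is_cone J C D Z (\<lambda>i. if i = 0 then x else if i = 1 then y else f \<cdot> x)"
      using that by (auto simp: cone hom_iff)
    then have ex: "\<exists>!h. h \<in> hom C Z L \<and> (\<forall>i\<in>obj J. l i \<cdot> h = (if i = 0 then x else if i = 1 then y else f \<cdot> x))"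
      using L by (auto simp: is_limit_def)
    have eq: "(\<forall>i\<in>obj J. l i \<cdot> h = (if i = 0 then x else if i = 1 then y else f \<cdot> x)) \<longleftrightarrow>
       l 0 \<cdot> h = x \<and> l 1 \<cdot> h = y" if "h \<in> hom C Z L" for h
      using that l f g by (auto simp: J_def hom_iff)
    show ?thesis using ex eq by (metis (no_types, lifting))
  qed
  then show ?thesis using l f g fg unfolding is_pullback_def by (intro exI[of _ "l 0"] exI[of _ "l 1"]) (auto simp: hom_iff)
qed

section \<open>Slice categories\<close>

lemma slice_simps [simp]:
  "u \<in> obj (slice C A) \<longleftrightarrow> u \<in> arr C \<and> tgt C u = A"
  "(u, h, v) \<in> arr (slice C A) \<longleftrightarrow> u \<in> arr C \<and> v \<in> arr C \<and> tgt C u = A \<and> tgt C v = A \<and>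
     h \<in> hom C (src C u) (src C v) \<and> v \<cdot>\<^bsub>C\<^esub> h = u"
  "src (slice C A) (u, h, v) = u" "tgt (slice C A) (u, h, v) = v"
  "idt (slice C A) u = (u, idt C (src C u), u)"
  "(v', k, w) \<cdot>\<^bsub>slice C A\<^esub> (u, h, v) = (u, k \<cdot>\<^bsub>C\<^esub> h, w)"
  by (auto simp: slice_def)

lemma hom_slice_iff:
  "h \<in> hom (slice C A) u v \<longleftrightarrow> (\<exists>k. h = (u, k, v) \<and> u \<in> arr C \<and> v \<in> arr C \<and>
     tgt C u = A \<and> tgt C v = A \<and> k \<in> hom C (src C u) (src C v) \<and> v \<cdot>\<^bsub>C\<^esub> k = u)"
  by (cases h) (auto simp: hom_iff[of _ "slice C A"])

lemma category_slice:
  assumes "category C"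
  shows "category (slice C A)"
proof -
  interpret category C by fact
  show ?thesis by unfold_locales (auto simp: hom_iff)
qed

text \<open>A \<^emph>\<open>square\<close> is a generalized element \<open>(x, y)\<close> of the pullback of \<open>f\<close> and \<open>g\<close>.\<close>

definition square :: "('o, 'a) category \<Rightarrow> 'a \<Rightarrow> 'a \<Rightarrow> 'a \<Rightarrow> 'a \<Rightarrow> bool" where
  "square C f g x y \<longleftrightarrow> x \<in> arr C \<and> y \<in> arr C \<and> src C x = src C y \<and> tgt C x = src C f \<and>
     tgt C y = src C g \<and> f \<cdot>\<^bsub>C\<^esub> x = g \<cdot>\<^bsub>C\<^esub> y"

locale finite_limits = category C for C :: "('o, 'a) category" (structure) +
  assumes finite_limits: "has_finite_limits C"
begin

lemma is_pullback_pb: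
  "f \<in> arr C \<Longrightarrow> g \<in> arr C \<Longrightarrow> tgt C f = tgt C g \<Longrightarrow> is_pullback C f g (pb1 C f g) (pb2 C f g)"
  unfolding pb1_def pb2_def pb_def
  using someI_ex[of "\<lambda>(a, b). is_pullback C f g a b"] ex_pullback[OF finite_limits, of f g]
  by (auto simp: case_prod_unfold)

lemma is_product_prj: "X \<in> obj C \<Longrightarrow> Y \<in> obj C \<Longrightarrow> is_product C X Y (prj1 C X Y) (prj2 C X Y)"
  unfolding prj1_def prj2_def bprod_def
  using someI_ex[of "\<lambda>(a, b). is_product C X Y a b"] ex_product[OF finite_limits, of X Y]
  by (auto simp: case_prod_unfold)

lemma pb_simps [simp]:
  assumes "f \<in> arr C" "g \<in> arr C" "tgt C f = tgt C g"
  shows "pb1 C f g \<in> arr C" "pb2 C f g \<in> arr C" "src C (pb2 C f g) = src C (pb1 C f g)"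
    "tgt C (pb1 C f g) = src C f" "tgt C (pb2 C f g) = src C g"
  using is_pullback_pb[OF assms] by (auto simp: is_pullback_def hom_iff)

lemma pb_commutes:
  "f \<in> arr C \<Longrightarrow> g \<in> arr C \<Longrightarrow> tgt C f = tgt C g \<Longrightarrow> f \<cdot> pb1 C f g = g \<cdot> pb2 C f g"
  using is_pullback_pb by (auto simp: is_pullback_def)

lemma square_pb [simp]:
  "f \<in> arr C \<Longrightarrow> g \<in> arr C \<Longrightarrow> tgt C f = tgt C g \<Longrightarrow> square C f g (pb1 C f g) (pb2 C f g)"
  by (simp add: square_def pb_commutes)

lemma square_cmp:
  assumes "square C f g x y" "f \<in> arr C" "g \<in> arr C" "h \<in> arr C" "tgt C h = src C x"
  shows "square C f g (x \<cdot> h) (y \<cdot> h)"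
  using assms by (auto simp: square_def)

lemma pb_pair:
  assumes "f \<in> arr C" "g \<in> arr C" "tgt C f = tgt C g" "square C f g x y"
  shows "pb_pair C f g x y \<in> arr C" "src C (pb_pair C f g x y) = src C y"
    "tgt C (pb_pair C f g x y) = src C (pb1 C f g)"
    "pb1 C f g \<cdot> pb_pair C f g x y = x" "pb2 C f g \<cdot> pb_pair C f g x y = y"
proof -
  have "\<exists>!h. h \<in> hom C (src C x) (src C (pb1 C f g)) \<and> pb1 C f g \<cdot> h = x \<and> pb2 C f g \<cdot> h = y"
    using is_pullback_pb[OF assms(1-3)] unfolding is_pullback_def
    by (elim conjE allE[of _ "src C x"] allE[of _ x] allE[of _ y])
      (use assms(4) in \<open>simp add: hom_iff square_def\<close>)
  from theI'[OF this] assms(4)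
  show "pb_pair C f g x y \<in> arr C" "src C (pb_pair C f g x y) = src C y"
    "tgt C (pb_pair C f g x y) = src C (pb1 C f g)"
    "pb1 C f g \<cdot> pb_pair C f g x y = x" "pb2 C f g \<cdot> pb_pair C f g x y = y"
    unfolding pb_pair_def[symmetric] by (auto simp: hom_iff square_def)
qed

text \<open>Simplification nests composites to the left, so a projection of a pairing often occurs
  behind a further factor \<open>k\<close>; these are the projection laws in that form.\<close>

lemma cmp_pb_pair:
  assumes "f \<in> arr C" "g \<in> arr C" "tgt C f = tgt C g" "square C f g x y" "k \<in> arr C"
  shows "src C k = src C f \<Longrightarrow> k \<cdot> pb1 C f g \<cdot> pb_pair C f g x y = k \<cdot> x"
    "src C k = src C g \<Longrightarrow> k \<cdot> pb2 C f g \<cdot> pb_pair C f g x y = k \<cdot> y"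
  using assoc[of "pb_pair C f g x y" "pb1 C f g" k] assoc[of "pb_pair C f g x y" "pb2 C f g" k]
  by (simp_all add: assms pb_pair)

lemma pb_eqI:
  assumes "f \<in> arr C" "g \<in> arr C" "tgt C f = tgt C g" "h \<in> arr C" "h' \<in> arr C" "src C h = src C h'"
    "tgt C h = src C (pb1 C f g)" "tgt C h' = src C (pb1 C f g)"
    "pb1 C f g \<cdot> h = pb1 C f g \<cdot> h'" "pb2 C f g \<cdot> h = pb2 C f g \<cdot> h'"
  shows "h = h'"
proof -
  have "f \<cdot> pb1 C f g \<cdot> h = g \<cdot> pb2 C f g \<cdot> h" using assms by (simp add: pb_commutes)
  then have "\<exists>!k. k \<in> hom C (src C h) (src C (pb1 C f g)) \<and> pb1 C f g \<cdot> k = pb1 C f g \<cdot> h \<and> pb2 C f g \<cdot> k = pb2 C f g \<cdot> h"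
    using is_pullback_pb[OF assms(1-3)] unfolding is_pullback_def
    by (elim conjE allE[of _ "src C h"] allE[of _ "pb1 C f g \<cdot> h"] allE[of _ "pb2 C f g \<cdot> h"])
      (use assms(1-8) in \<open>simp add: hom_iff\<close>)
  then show ?thesis using assms by (auto simp: hom_iff)
qed

lemma pb_pair_cmp:
  assumes "f \<in> arr C" "g \<in> arr C" "tgt C f = tgt C g" "square C f g x y" "h \<in> arr C" "tgt C h = src C y"
  shows "pb_pair C f g x y \<cdot> h = pb_pair C f g (x \<cdot> h) (y \<cdot> h)"
proof -
  have sq: "square C f g (x \<cdot> h) (y \<cdot> h)" using square_cmp assms by (auto simp: square_def)
  show ?thesis
    by (rule pb_eqI[of f g]) (use assms in \<open>auto simp: pb_pair[OF assms(1-4)] pb_pair[OF assms(1-3) sq] square_def\<close>)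
qed

lemma pb_pair_pb [simp]:
  "f \<in> arr C \<Longrightarrow> g \<in> arr C \<Longrightarrow> tgt C f = tgt C g \<Longrightarrow> pb_pair C f g (pb1 C f g) (pb2 C f g) = idt C (src C (pb1 C f g))"
  by (rule pb_eqI[of f g]) (simp_all add: pb_pair)

lemma prj_simps [simp]:
  assumes "X \<in> obj C" "Y \<in> obj C"
  shows "prj1 C X Y \<in> arr C" "prj2 C X Y \<in> arr C" "src C (prj2 C X Y) = src C (prj1 C X Y)"
    "tgt C (prj1 C X Y) = X" "tgt C (prj2 C X Y) = Y"
  using is_product_prj[OF assms] by (auto simp: is_product_def hom_iff)

lemma pair [simp]:
  assumes "x \<in> arr C" "y \<in> arr C" "src C x = src C y" "tgt C x = X" "tgt C y = Y"
  shows "pair C X Y x y \<in> arr C" "src C (pair C X Y x y) = src C y"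
    "tgt C (pair C X Y x y) = src C (prj1 C X Y)"
    "prj1 C X Y \<cdot> pair C X Y x y = x" "prj2 C X Y \<cdot> pair C X Y x y = y"
proof -
  have "\<exists>!h. h \<in> hom C (src C x) (src C (prj1 C X Y)) \<and> prj1 C X Y \<cdot> h = x \<and> prj2 C X Y \<cdot> h = y"
    using is_product_prj[OF tgt_obj[OF assms(1)] tgt_obj[OF assms(2)]] unfolding is_product_def assms(4,5)
    by (elim conjE allE[of _ "src C x"] allE[of _ x] allE[of _ y])
      (use assms in \<open>simp add: hom_iff\<close>)
  from theI'[OF this] assms
  show "pair C X Y x y \<in> arr C" "src C (pair C X Y x y) = src C y"
    "tgt C (pair C X Y x y) = src C (prj1 C X Y)"
    "prj1 C X Y \<cdot> pair C X Y x y = x" "prj2 C X Y \<cdot> pair C X Y x y = y"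
    unfolding pair_def[symmetric] by (auto simp: hom_iff)
qed

lemma cmp_pair [simp]:
  assumes "x \<in> arr C" "y \<in> arr C" "src C x = src C y" "tgt C x = X" "tgt C y = Y" "k \<in> arr C"
  shows "src C k = X \<Longrightarrow> k \<cdot> prj1 C X Y \<cdot> pair C X Y x y = k \<cdot> x"
    "src C k = Y \<Longrightarrow> k \<cdot> prj2 C X Y \<cdot> pair C X Y x y = k \<cdot> y"
  using assoc[of "pair C X Y x y" "prj1 C X Y" k] assoc[of "pair C X Y x y" "prj2 C X Y" k]
  using assms tgt_obj[of x] tgt_obj[of y] by simp_all

lemma prod_eqI:
  assumes "X \<in> obj C" "Y \<in> obj C" "h \<in> arr C" "h' \<in> arr C" "src C h = src C h'"
    "tgt C h = src C (prj1 C X Y)" "tgt C h' = src C (prj1 C X Y)"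
    "prj1 C X Y \<cdot> h = prj1 C X Y \<cdot> h'" "prj2 C X Y \<cdot> h = prj2 C X Y \<cdot> h'"
  shows "h = h'"
proof -
  have "\<exists>!k. k \<in> hom C (src C h) (src C (prj1 C X Y)) \<and> prj1 C X Y \<cdot> k = prj1 C X Y \<cdot> h \<and> prj2 C X Y \<cdot> k = prj2 C X Y \<cdot> h"
    using is_product_prj[OF assms(1,2)] unfolding is_product_def
    by (elim conjE allE[of _ "src C h"] allE[of _ "prj1 C X Y \<cdot> h"] allE[of _ "prj2 C X Y \<cdot> h"])
      (use assms(1-7) in \<open>simp add: hom_iff\<close>)
  then show ?thesis using assms by (auto simp: hom_iff)
qed

lemma pair_cmp [simp]:
  assumes "x \<in> arr C" "y \<in> arr C" "src C x = src C y" "tgt C x = X" "tgt C y = Y" "h \<in> arr C" "tgt C h = src C y"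
  shows "pair C X Y x y \<cdot> h = pair C X Y (x \<cdot> h) (y \<cdot> h)"
  by (rule prod_eqI[of X Y]) (use assms in auto)

lemma is_functor_Delta:
  assumes [simp]: "f \<in> arr C"
  shows "is_functor (slice C (tgt C f)) (slice C (src C f)) (Delta C f)"
proof -
  have m: "square C f v (pb1 C f u) (h \<cdot> pb2 C f u)" if [simp]: "u \<in> arr C" "v \<in> arr C" "h \<in> arr C"
    "tgt C u = tgt C f" "tgt C v = tgt C f" "src C h = src C u" "tgt C h = src C v" and "v \<cdot> h = u" for u v h
    using pb_commutes[of f u] \<open>v \<cdot> h = u\<close> by (simp add: square_def)
  note [simp] = pb_pair[OF _ _ _ m] cmp_pb_pair[OF _ _ _ m]
  show ?thesis
    unfolding is_functor_def
  proof (intro conjI ballI impI)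
    fix k l assume kl: "k \<in> arr (slice C (tgt C f))" "l \<in> arr (slice C (tgt C f))"
      "tgt (slice C (tgt C f)) k = src (slice C (tgt C f)) l"
    obtain u h v h' w where k: "k = (u, h, v)" and l: "l = (v, h', w)"
      using kl by (cases k, cases l) auto
    have hs [simp]: "u \<in> arr C" "v \<in> arr C" "w \<in> arr C" "h \<in> arr C" "h' \<in> arr C" "tgt C u = tgt C f" "tgt C v = tgt C f" "tgt C w = tgt C f"
       "src C h = src C u" "tgt C h = src C v" "src C h' = src C v" "tgt C h' = src C w" "v \<cdot> h = u" "w \<cdot> h' = v"
      using kl by (auto simp: k l hom_iff)
    have "pb_pair C f w (pb1 C f u) (h' \<cdot> h \<cdot> pb2 C f u) =
       pb_pair C f w (pb1 C f v) (h' \<cdot> pb2 C f v) \<cdot> pb_pair C f v (pb1 C f u) (h \<cdot> pb2 C f u)"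
      by (rule pb_eqI[of f w]) (auto simp: hom_iff)
    then show "amap (Delta C f) (l \<cdot>\<^bsub>slice C (tgt C f)\<^esub> k) = amap (Delta C f) l \<cdot>\<^bsub>slice C (src C f)\<^esub> amap (Delta C f) k"
      by (simp add: k l Delta_def pb_map_def)
  qed (auto simp: category_slice category_axioms hom_iff Delta_def pb_map_def)
qed

section \<open>Exponentiability on generalized elements\<close>

text \<open>\<open>over f u v H\<close>: \<open>H\<close> acts on the generalized elements of the pullback \<open>B \<times>\<^sub>A U\<close> of
  \<open>f : B \<rightarrow> A\<close> and \<open>u : U \<rightarrow> A\<close> as a morphism \<open>B \<times>\<^sub>A U \<rightarrow> V\<close> over \<open>B\<close> does. By Yoneda, \<open>pi_rep\<close> is
  then the universal property of \<open>\<Pi>\<^sub>f v\<close>, independently of any choice of pullbacks.\<close>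

definition over :: "'a \<Rightarrow> 'a \<Rightarrow> 'a \<Rightarrow> ('a \<Rightarrow> 'a \<Rightarrow> 'a) \<Rightarrow> bool" where
  "over f u v H \<longleftrightarrow> (\<forall>b s. square C f u b s \<longrightarrow>
     H b s \<in> arr C \<and> src C (H b s) = src C s \<and> tgt C (H b s) = src C v \<and> v \<cdot> H b s = b \<and>
     (\<forall>r\<in>arr C. tgt C r = src C s \<longrightarrow> H b s \<cdot> r = H (b \<cdot> r) (s \<cdot> r)))"

definition pi_rep :: "'a \<Rightarrow> 'a \<Rightarrow> 'a \<Rightarrow> ('a \<Rightarrow> 'a \<Rightarrow> 'a) \<Rightarrow> bool" where
  "pi_rep f v w ev \<longleftrightarrow> w \<in> arr C \<and> tgt C w = tgt C f \<and> over f w v ev \<and>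
     (\<forall>u H. u \<in> arr C \<longrightarrow> tgt C u = tgt C f \<longrightarrow> over f u v H \<longrightarrow>
        (\<exists>!k. k \<in> hom C (src C u) (src C w) \<and> w \<cdot> k = u \<and>
           (\<forall>b s. square C f u b s \<longrightarrow> ev b (k \<cdot> s) = H b s)))"

lemma overD:
  assumes "over f u v H" "square C f u b s"
  shows "H b s \<in> arr C" "src C (H b s) = src C s" "tgt C (H b s) = src C v" "v \<cdot> H b s = b"
    "r \<in> arr C \<Longrightarrow> tgt C r = src C s \<Longrightarrow> H b s \<cdot> r = H (b \<cdot> r) (s \<cdot> r)"
  using assms by (auto simp: over_def)

text \<open>One half of the Yoneda correspondence: a map out of the chosen pullback acts on
  generalized elements by composition with the pairing.\<close>

lemma over_pb_pair:
  assumes "f \<in> arr C" "u \<in> arr C" "v \<in> arr C" "tgt C u = tgt C f" "h \<in> hom C (src C (pb1 C f u)) (src C v)"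
    "v \<cdot> h = pb1 C f u"
  shows "over f u v (\<lambda>b s. h \<cdot> pb_pair C f u b s)"
  unfolding over_def
proof (intro allI impI)
  fix b s assume sq: "square C f u b s"
  have [simp]: "b \<in> arr C" "s \<in> arr C" "src C b = src C s" "tgt C s = src C u" using sq by (auto simp: square_def)
  note [simp] = pb_pair[OF assms(1,2) assms(4)[symmetric] sq] assms
  have [simp]: "h \<in> arr C" "src C h = src C (pb1 C f u)" "tgt C h = src C v"
    using assms(5) by (auto simp: hom_iff)
  show "h \<cdot> pb_pair C f u b s \<in> arr C \<and> src C (h \<cdot> pb_pair C f u b s) = src C s \<and>
    tgt C (h \<cdot> pb_pair C f u b s) = src C v \<and> v \<cdot> (h \<cdot> pb_pair C f u b s) = b \<and>
    (\<forall>r\<in>arr C. tgt C r = src C s \<longrightarrow> h \<cdot> pb_pair C f u b s \<cdot> r = h \<cdot> pb_pair C f u (b \<cdot> r) (s \<cdot> r))"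
    using sq by (simp add: pb_pair_cmp[symmetric])
qed

text \<open>The other half: the projections of the chosen pullback form its generic element, of
  which every element is a restriction, so naturality determines \<open>H\<close> from its value
  there.\<close>

lemma over_eq:
  assumes "f \<in> arr C" "u \<in> arr C" "tgt C u = tgt C f" "over f u v H" "square C f u b s"
  shows "H b s = H (pb1 C f u) (pb2 C f u) \<cdot> pb_pair C f u b s"
  using overD(5)[OF assms(4), of "pb1 C f u" "pb2 C f u" "pb_pair C f u b s"] assms
  by (simp add: pb_pair)

text \<open>The left side is the equation in the slice category that characterizes a transpose
  \<open>k\<close>; the right side is the same condition on elements. They agree because
  \<open>pb_map\<close> acts by \<open>(b, s) \<mapsto> (b, k \<cdot> s)\<close>, and because the
  right side at the generic element is the left side.\<close>

lemma eval_pb_map_iff: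
  assumes "f \<in> arr C" "u \<in> arr C" "v \<in> arr C" "w \<in> arr C" "tgt C u = tgt C f" "tgt C w = tgt C f"
    "e \<in> hom C (src C (pb1 C f w)) (src C v)" "over f u v H" "k \<in> hom C (src C u) (src C w)" "w \<cdot> k = u"
  shows "e \<cdot> pb_map C f u k w = H (pb1 C f u) (pb2 C f u) \<longleftrightarrow>
    (\<forall>b s. square C f u b s \<longrightarrow> e \<cdot> pb_pair C f w b (k \<cdot> s) = H b s)" (is "?L \<longleftrightarrow> ?R")
proof
  note [simp] = assms(1-6)
  have [simp]: "e \<in> arr C" "src C e = src C (pb1 C f w)" "tgt C e = src C v"
    "k \<in> arr C" "src C k = src C u" "tgt C k = src C w"
    using assms by (auto simp: hom_iff)
  have sq: "square C f w b (k \<cdot> s)" if "square C f u b s" for b s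
    using that assms(10) by (auto simp: square_def)
  show ?R if ?L
  proof (intro allI impI)
    fix b s assume s: "square C f u b s"
    have [simp]: "b \<in> arr C" "s \<in> arr C" "src C b = src C s" "tgt C s = src C u" using s by (auto simp: square_def)
    note m [simp] = pb_pair[OF _ _ _ sq[OF square_pb]] pb_pair[OF _ _ _ s] cmp_pb_pair[OF _ _ _ s]
    have "pb_pair C f w b (k \<cdot> s) = pb_map C f u k w \<cdot> pb_pair C f u b s"
      unfolding pb_map_def by (subst pb_pair_cmp[OF _ _ _ sq[OF square_pb]]) simp_all
    then have "e \<cdot> pb_pair C f w b (k \<cdot> s) = e \<cdot> pb_map C f u k w \<cdot> pb_pair C f u b s"
      by (simp add: pb_map_def)
    then show "e \<cdot> pb_pair C f w b (k \<cdot> s) = H b s"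
      unfolding that using over_eq[OF _ _ _ assms(8) s] by simp
  qed
  show ?L if ?R using that by (simp add: pb_map_def)
qed

lemma is_Pi_Pi_fun:
  assumes "exponentiable C f"
  shows "is_Pi C f (Pi_fun C f) (Pi_unit C f) (Pi_counit C f)"
  using someI_ex[of "\<lambda>(G, \<eta>, \<epsilon>). is_Pi C f G \<eta> \<epsilon>"] assms
  unfolding exponentiable_def Pi_fun_def Pi_unit_def Pi_counit_def Pi_adj_def
  by (auto simp: case_prod_unfold)

lemma exponentiable_arr [simp]: "exponentiable C f \<Longrightarrow> f \<in> arr C"
  by (simp add: exponentiable_def)

text \<open>Here the chosen adjoint is turned into a universal property: its counit gives
  evaluation, and the transpose is characterized by an equivalence, so that existence and uniqueness
  are available together. \<open>H\<close> appears at the projections because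
  \<open>Pi_transpose\<close> takes a map out of the chosen pullback.\<close>

lemma Pi_universal:
  assumes f: "exponentiable C f" and v: "v \<in> arr C" "tgt C v = src C f"
  defines "w \<equiv> omap (Pi_fun C f) v"
    and "e \<equiv> underlying (Pi_counit C f v)"
  shows "w \<in> arr C" "tgt C w = tgt C f" "e \<in> hom C (src C (pb1 C f w)) (src C v)" "v \<cdot> e = pb1 C f w"
    and "\<And>u H. u \<in> arr C \<Longrightarrow> tgt C u = tgt C f \<Longrightarrow> over f u v H \<Longrightarrow>
       k = Pi_transpose C f u v (H (pb1 C f u) (pb2 C f u)) \<longleftrightarrow>
       k \<in> hom C (src C u) (src C w) \<and> w \<cdot> k = u \<and>
           (\<forall>b s. square C f u b s \<longrightarrow> e \<cdot> pb_pair C f w b (k \<cdot> s) = H b s)"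
proof -
  let ?A = "slice C (tgt C f)" and ?B = "slice C (src C f)"
  note [simp] = f v
  have adj: "adjunction ?A ?B (Delta C f) (Pi_fun C f) (Pi_unit C f) (Pi_counit C f)"
    using is_Pi_Pi_fun[OF f] by (simp add: is_Pi_def)
  have "is_functor ?B ?A (Pi_fun C f)" using adj by (simp add: adjunction_def)
  from functor_rules(3)[OF this, of v] show w: "w \<in> arr C" "tgt C w = tgt C f"
    by (auto simp: w_def)
  note [simp] = w
  have "Pi_counit C f v \<in> hom ?B (pb1 C f w) v"
    using adj v by (simp add: adjunction_def is_nat_trans_def comp_functor_def id_functor_def Delta_def w_def)
  then have counit: "Pi_counit C f v = (pb1 C f w, e, v)" and e: "e \<in> hom C (src C (pb1 C f w)) (src C v)" "v \<cdot> e = pb1 C f w"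
    by (auto simp: hom_slice_iff e_def)
  then show "e \<in> hom C (src C (pb1 C f w)) (src C v)" "v \<cdot> e = pb1 C f w" by auto
  fix u H assume u [simp]: "u \<in> arr C" "tgt C u = tgt C f" and H: "over f u v H"
  let ?h = "H (pb1 C f u) (pb2 C f u)"
  have h: "(pb1 C f u, ?h, v) \<in> hom ?B (omap (Delta C f) u) v"
    using overD[OF H square_pb] by (simp add: hom_slice_iff Delta_def) (simp add: hom_iff)
  note tr = adjunction_transpose[OF adj _ _ h, folded w_def]
  define K where "K = amap (Pi_fun C f) (pb1 C f u, ?h, v) \<cdot>\<^bsub>?A\<^esub> Pi_unit C f u"
  have K: "K \<in> hom ?A u w" "Pi_counit C f v \<cdot>\<^bsub>?B\<^esub> amap (Delta C f) K = (pb1 C f u, ?h, v)"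
    using tr(1,2) by (auto simp: K_def)
  have K': "K = (u, Pi_transpose C f u v ?h, w)"
    using K(1) by (auto simp: hom_slice_iff Pi_transpose_def K_def)
  have iff: "e \<cdot> pb_map C f u k w = ?h \<longleftrightarrow> (\<forall>b s. square C f u b s \<longrightarrow> e \<cdot> pb_pair C f w b (k \<cdot> s) = H b s)"
    if "k \<in> hom C (src C u) (src C w)" "w \<cdot> k = u" for k
    using eval_pb_map_iff[OF _ _ _ _ _ _ e(1) H that] by simp
  have k: "Pi_counit C f v \<cdot>\<^bsub>?B\<^esub> amap (Delta C f) (u, k, w) = (pb1 C f u, e \<cdot> pb_map C f u k w, v)" for k
    by (simp add: counit Delta_def)
  show "k = Pi_transpose C f u v ?h \<longleftrightarrow> k \<in> hom C (src C u) (src C w) \<and> w \<cdot> k = u \<and>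
           (\<forall>b s. square C f u b s \<longrightarrow> e \<cdot> pb_pair C f w b (k \<cdot> s) = H b s)" (is "?l \<longleftrightarrow> ?r")
  proof
    show ?r if ?l
    proof -
      have k1: "k \<in> hom C (src C u) (src C w)" "w \<cdot> k = u" using K(1) that by (auto simp: hom_slice_iff K')
      moreover have "e \<cdot> pb_map C f u k w = ?h" using K(2) k that by (auto simp: K')
      ultimately show ?r using iff by blast
    qed
    show ?l if r: ?r
    proof -
      have "e \<cdot> pb_map C f u k w = ?h" using iff r by blast
      then have "(u, k, w) = K" unfolding K_def
        by (intro tr(3)) (use r in \<open>auto simp: hom_slice_iff k\<close>)
      then show ?l by (simp add: K')
    qed
  qed
qed

lemma pi_rep_Pi_fun:
  assumes "exponentiable C f" "v \<in> arr C" "tgt C v = src C f"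
  shows "pi_rep f v (omap (Pi_fun C f) v) (\<lambda>b s. underlying (Pi_counit C f v) \<cdot> pb_pair C f (omap (Pi_fun C f) v) b s)"
  unfolding pi_rep_def
  using over_pb_pair[OF _ _ _ _ Pi_universal(3,4)[OF assms]] Pi_universal(1,2)[OF assms] assms
  by (simp add: Pi_universal(5)[OF assms, symmetric])

text \<open>A criterion without any functor or chosen adjoint; both closure proofs go through it.
  From right to left, \<open>ev\<close> at the generic element of the pullback is a universal arrow
  from \<open>Delta C f\<close> to \<open>v\<close>, and universal arrows assemble into an
  adjunction.\<close>

lemma exponentiable_iff:
  "exponentiable C f \<longleftrightarrow> f \<in> arr C \<and> (\<forall>v\<in>arr C. tgt C v = src C f \<longrightarrow> (\<exists>w ev. pi_rep f v w ev))"
proof (intro iffI conjI ballI impI)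
  assume f: "f \<in> arr C \<and> (\<forall>v\<in>arr C. tgt C v = src C f \<longrightarrow> (\<exists>w ev. pi_rep f v w ev))"
  then have [simp]: "f \<in> arr C" by simp
  let ?A = "slice C (tgt C f)" and ?B = "slice C (src C f)"
  have "\<exists>G \<eta> \<epsilon>. adjunction ?A ?B (Delta C f) G \<eta> \<epsilon>"
  proof (rule adjunction_if_universal_arrows[OF is_functor_Delta])
    fix v assume "v \<in> obj ?B"
    then have v [simp]: "v \<in> arr C" "tgt C v = src C f" by auto
    then obtain w ev where w [simp]: "w \<in> arr C" "tgt C w = tgt C f" and ev: "over f w v ev"
      and ex: "\<And>u H. u \<in> arr C \<Longrightarrow> tgt C u = tgt C f \<Longrightarrow> over f u v H \<Longrightarrow>
        \<exists>!k. k \<in> hom C (src C u) (src C w) \<and> w \<cdot> k = u \<and>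
           (\<forall>b s. square C f u b s \<longrightarrow> ev b (k \<cdot> s) = H b s)"
      using f unfolding pi_rep_def by blast
    define e where "e = ev (pb1 C f w) (pb2 C f w)"
    have e: "e \<in> hom C (src C (pb1 C f w)) (src C v)" "v \<cdot> e = pb1 C f w"
      using overD[OF ev square_pb] by (auto simp: hom_iff e_def)
    have ev_eq: "ev b s = e \<cdot> pb_pair C f w b s" if "square C f w b s" for b s
      unfolding e_def by (rule over_eq[OF _ _ _ ev]) (use that in auto)
    show "\<exists>w e. w \<in> obj ?A \<and> e \<in> hom ?B (omap (Delta C f) w) v \<and> (\<forall>u h. u \<in> obj ?A \<longrightarrow> h \<in> hom ?B (omap (Delta C f) u) v
         \<longrightarrow> (\<exists>!k. k \<in> hom ?A u w \<and> e \<cdot>\<^bsub>?B\<^esub> amap (Delta C f) k = h))"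
    proof (intro exI[of _ w] exI[of _ "(pb1 C f w, e, v)"] conjI allI impI)
      fix u h' assume "u \<in> obj ?A" and h': "h' \<in> hom ?B (omap (Delta C f) u) v"
      then have u [simp]: "u \<in> arr C" "tgt C u = tgt C f" by auto
      obtain h where h: "h' = (pb1 C f u, h, v)" "h \<in> hom C (src C (pb1 C f u)) (src C v)" "v \<cdot> h = pb1 C f u"
        using h' by (auto simp: hom_slice_iff Delta_def)
      define H where "H b s = h \<cdot> pb_pair C f u b s" for b s
      have H: "over f u v H" unfolding H_def by (rule over_pb_pair) (use h in auto)
      have Hh: "H (pb1 C f u) (pb2 C f u) = h" using h by (simp add: H_def hom_iff)
      have iff: "e \<cdot> pb_map C f u k w = h \<longleftrightarrow> (\<forall>b s. square C f u b s \<longrightarrow> ev b (k \<cdot> s) = H b s)"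
        if "k \<in> hom C (src C u) (src C w)" "w \<cdot> k = u" for k
      proof -
        have "square C f w b (k \<cdot> s)" if "square C f u b s" for b s
          using that \<open>k \<in> _\<close> \<open>w \<cdot> k = u\<close> by (auto simp: square_def hom_iff)
        then show ?thesis using eval_pb_map_iff[OF _ _ _ _ _ _ e(1) H that] by (auto simp: ev_eq Hh)
      qed
      \<comment> \<open>For maps over the base, the slice equation and the elementwise one are
        equivalent, so unique existence transfers from one to the other.\<close>
      define P where "P k \<longleftrightarrow> k \<in> hom C (src C u) (src C w) \<and> w \<cdot> k = u \<and> e \<cdot> pb_map C f u k w = h" for k
      have P: "P k \<longleftrightarrow> k \<in> hom C (src C u) (src C w) \<and> w \<cdot> k = u \<and>
           (\<forall>b s. square C f u b s \<longrightarrow> ev b (k \<cdot> s) = H b s)" for k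
        unfolding P_def using iff[of k] by blast
      have ex1: "\<exists>!k. P k" using ex[OF u H] unfolding P .
      then obtain k where "P k" by blast
      then have k: "k \<in> hom C (src C u) (src C w)" "w \<cdot> k = u" "e \<cdot> pb_map C f u k w = h"
        by (simp_all add: P_def)
      show "\<exists>!k. k \<in> hom ?A u w \<and> (pb1 C f w, e, v) \<cdot>\<^bsub>?B\<^esub> amap (Delta C f) k = h'"
      proof (rule ex1I[of _ "(u, k, w)"])
        show "(u, k, w) \<in> hom ?A u w \<and> (pb1 C f w, e, v) \<cdot>\<^bsub>?B\<^esub> amap (Delta C f) (u, k, w) = h'"
          using k by (simp add: hom_slice_iff h Delta_def)
        fix K assume K: "K \<in> hom ?A u w \<and> (pb1 C f w, e, v) \<cdot>\<^bsub>?B\<^esub> amap (Delta C f) K = h'"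
        then obtain k' where k': "K = (u, k', w)" "k' \<in> hom C (src C u) (src C w)" "w \<cdot> k' = u"
          unfolding hom_slice_iff by blast
        have "e \<cdot> pb_map C f u k' w = h" using K by (simp add: k'(1) Delta_def h)
        then show "K = (u, k, w)" using ex1 \<open>P k\<close> k' by (auto simp: P_def)
      qed
    next
      show "w \<in> obj ?A" "(pb1 C f w, e, v) \<in> hom ?B (omap (Delta C f) w) v"
        using e by (simp_all add: hom_slice_iff Delta_def)
    qed
  qed simp
  then show "exponentiable C f" by (simp add: exponentiable_def is_Pi_def)
next
  fix v assume "exponentiable C f" "v \<in> arr C" "tgt C v = src C f"
  then show "\<exists>w ev. pi_rep f v w ev" using pi_rep_Pi_fun by blast
qed simp

lemma squareD:
  assumes "square C f g x y"
  shows "x \<in> arr C" "y \<in> arr C" "src C x = src C y" "tgt C x = src C f" "tgt C y = src C g" "f \<cdot> x = g \<cdot> y"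
  using assms by (auto simp: square_def)

lemma pi_repD:
  assumes "pi_rep f v w ev"
  shows "w \<in> arr C" "tgt C w = tgt C f" "over f w v ev"
  using assms by (auto simp: pi_rep_def)

lemma pi_rep_ex:
  assumes "pi_rep f v w ev" "over f u v H" "u \<in> arr C" "tgt C u = tgt C f"
  obtains k where "k \<in> arr C" "src C k = src C u" "tgt C k = src C w" "w \<cdot> k = u"
    "\<And>b s. square C f u b s \<Longrightarrow> ev b (k \<cdot> s) = H b s"
proof -
  have "\<exists>k. k \<in> hom C (src C u) (src C w) \<and> w \<cdot> k = u \<and> (\<forall>b s. square C f u b s \<longrightarrow> ev b (k \<cdot> s) = H b s)"
    using assms unfolding pi_rep_def by blast
  then show thesis using that by (auto simp: hom_iff)
qed

lemma over_cmp:
  assumes "over f w v H" "f \<in> arr C" "w \<in> arr C" "tgt C w = tgt C f" "k \<in> arr C" "tgt C k = src C w"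
  shows "over f (w \<cdot> k) v (\<lambda>b s. H b (k \<cdot> s))"
  unfolding over_def
proof (intro allI impI)
  fix b s assume s: "square C f (w \<cdot> k) b s"
  then have s': "square C f w b (k \<cdot> s)" using assms by (auto simp: square_def)
  show "H b (k \<cdot> s) \<in> arr C \<and> src C (H b (k \<cdot> s)) = src C s \<and> tgt C (H b (k \<cdot> s)) = src C v \<and>
    v \<cdot> H b (k \<cdot> s) = b \<and> (\<forall>r\<in>arr C. tgt C r = src C s \<longrightarrow> H b (k \<cdot> s) \<cdot> r = H (b \<cdot> r) (k \<cdot> (s \<cdot> r)))"
    using overD[OF assms(1) s'] squareD[OF s] assms(2-) by simp
qed

text \<open>Extensionality for \<open>\<Pi>\<^sub>f v\<close>: both maps represent the same family,
  namely \<open>ev\<close> composed with \<open>k'\<close>, so the uniqueness clause identifies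
  them.\<close>

lemma pi_rep_unique:
  assumes rep: "pi_rep f v w ev" and "f \<in> arr C" and k: "k \<in> arr C" "k' \<in> arr C" "src C k = src C k'"
      "tgt C k = src C w" "tgt C k' = src C w" "w \<cdot> k = w \<cdot> k'"
    and eq: "\<And>b s. square C f (w \<cdot> k) b s \<Longrightarrow> ev b (k \<cdot> s) = ev b (k' \<cdot> s)"
  shows "k = k'"
proof -
  have [simp]: "w \<in> arr C" "tgt C w = tgt C f" using pi_repD[OF rep] by auto
  have "over f (w \<cdot> k) v (\<lambda>b s. ev b (k' \<cdot> s))"
    unfolding k(6) by (rule over_cmp) (use pi_repD[OF rep] assms in auto)
  then have "\<exists>!m. m \<in> hom C (src C (w \<cdot> k)) (src C w) \<and> w \<cdot> m = w \<cdot> k \<and>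
      (\<forall>b s. square C f (w \<cdot> k) b s \<longrightarrow> ev b (m \<cdot> s) = ev b (k' \<cdot> s))"
    using rep unfolding pi_rep_def
    by (elim conjE allE[of _ "w \<cdot> k"] allE[of _ "\<lambda>b s. ev b (k' \<cdot> s)"])
      (use k in \<open>simp del: k(6)\<close>)
  then obtain m where m: "\<And>k. k \<in> hom C (src C (w \<cdot> k)) (src C w) \<Longrightarrow> w \<cdot> k = w \<cdot> k' \<Longrightarrow>
      (\<And>b s. square C f (w \<cdot> k') b s \<Longrightarrow> ev b (k \<cdot> s) = ev b (k' \<cdot> s)) \<Longrightarrow> k = m"
    unfolding k(6) by (elim ex1E) metis
  show ?thesis using m[of k] m[of k'] k eq by (simp add: hom_iff)
qed

lemma pi_repI:
  assumes "w \<in> arr C" "tgt C w = tgt C f" "over f w v ev"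
    and "\<And>u H. u \<in> arr C \<Longrightarrow> tgt C u = tgt C f \<Longrightarrow> over f u v H \<Longrightarrow>
      \<exists>k. k \<in> arr C \<and> src C k = src C u \<and> tgt C k = src C w \<and> w \<cdot> k = u \<and>
        (\<forall>b s. square C f u b s \<longrightarrow> ev b (k \<cdot> s) = H b s)"
    and uniq: "\<And>k k'. k \<in> arr C \<Longrightarrow> k' \<in> arr C \<Longrightarrow> src C k = src C k' \<Longrightarrow> tgt C k = src C w \<Longrightarrow>
      tgt C k' = src C w \<Longrightarrow> w \<cdot> k = w \<cdot> k' \<Longrightarrow>
      (\<And>b s. square C f (w \<cdot> k) b s \<Longrightarrow> ev b (k \<cdot> s) = ev b (k' \<cdot> s)) \<Longrightarrow> k = k'"
  shows "pi_rep f v w ev"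
  unfolding pi_rep_def
proof (intro conjI allI impI)
  fix u H assume u: "u \<in> arr C" "tgt C u = tgt C f" "over f u v H"
  from assms(4)[OF u] obtain k where k: "k \<in> arr C \<and> src C k = src C u \<and> tgt C k = src C w \<and> w \<cdot> k = u \<and>
    (\<forall>b s. square C f u b s \<longrightarrow> ev b (k \<cdot> s) = H b s)" by (rule exE)
  show "\<exists>!k. k \<in> hom C (src C u) (src C w) \<and> w \<cdot> k = u \<and> (\<forall>b s. square C f u b s \<longrightarrow> ev b (k \<cdot> s) = H b s)"
  proof (rule ex1I[of _ k])
    fix k' assume k': "k' \<in> hom C (src C u) (src C w) \<and> w \<cdot> k' = u \<and> (\<forall>b s. square C f u b s \<longrightarrow> ev b (k' \<cdot> s) = H b s)"
    show "k' = k" by (rule uniq) (use k k' in \<open>auto simp: hom_iff\<close>)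
  qed (use k in \<open>auto simp: hom_iff\<close>)
qed (use assms(1-3) in auto)

section \<open>Closure of exponentiable morphisms under composition and pullback\<close>

text \<open>The product along a composite is the iterated product
  \<open>\<Pi>\<^sub>f (\<Pi>\<^sub>g v)\<close>. An element \<open>t\<close> is evaluated at
  \<open>c\<close> in two stages: at \<open>g \<cdot> c\<close>, which gives an element of
  \<open>\<Pi>\<^sub>g v\<close>, and then at \<open>c\<close>. With squares in place of chosen
  pullbacks, the pullback along \<open>f \<cdot> g\<close> is never compared with an iterated
  one.\<close>

lemma exponentiable_cmp:
  assumes f: "exponentiable C f" and g: "exponentiable C g" and fg: "tgt C g = src C f"
  shows "exponentiable C (f \<cdot> g)"
  unfolding exponentiable_iff
proof (intro conjI ballI impI)
  note [simp] = exponentiable_arr[OF f] exponentiable_arr[OF g] fg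
  show "f \<cdot> g \<in> arr C" by simp
  fix v assume v [simp]: "v \<in> arr C" "tgt C v = src C (f \<cdot> g)"
  then obtain w1 ev1 where rep1: "pi_rep g v w1 ev1" using pi_rep_Pi_fun[OF g, of v] by auto
  note r1 [simp] = pi_repD(1,2)[OF rep1]
  obtain w2 ev2 where rep2: "pi_rep f w1 w2 ev2" using pi_rep_Pi_fun[OF f, of w1] by auto
  note r2 [simp] = pi_repD(1,2)[OF rep2]
  note ev1 = overD[OF pi_repD(3)[OF rep1]] and ev2 = overD[OF pi_repD(3)[OF rep2]]
  have sq2: "square C f w2 (g \<cdot> c) t" if "square C (f \<cdot> g) w2 c t" for c t
    using that by (auto simp: square_def)
  have sq1: "square C g w1 c (ev2 (g \<cdot> c) t)" if "square C (f \<cdot> g) w2 c t" for c t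
    using ev2[OF sq2[OF that]] squareD[OF that] by (auto simp: square_def)
  have "pi_rep (f \<cdot> g) v w2 (\<lambda>c t. ev1 c (ev2 (g \<cdot> c) t))"
  proof (rule pi_repI)
    show "over (f \<cdot> g) w2 v (\<lambda>c t. ev1 c (ev2 (g \<cdot> c) t))"
      unfolding over_def
    proof (intro allI impI)
      fix c t assume t: "square C (f \<cdot> g) w2 c t"
      show "ev1 c (ev2 (g \<cdot> c) t) \<in> arr C \<and> src C (ev1 c (ev2 (g \<cdot> c) t)) = src C t \<and>
         tgt C (ev1 c (ev2 (g \<cdot> c) t)) = src C v \<and> v \<cdot> ev1 c (ev2 (g \<cdot> c) t) = c \<and>
         (\<forall>r\<in>arr C. tgt C r = src C t \<longrightarrow> ev1 c (ev2 (g \<cdot> c) t) \<cdot> r = ev1 (c \<cdot> r) (ev2 (g \<cdot> (c \<cdot> r)) (t \<cdot> r)))"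
        using ev1[OF sq1[OF t]] ev2[OF sq2[OF t]] squareD[OF t] by simp
    qed
  next
    fix u H assume u [simp]: "u \<in> arr C" "tgt C u = tgt C (f \<cdot> g)" and H: "over (f \<cdot> g) u v H"
    \<comment> \<open>Currying: for fixed \<open>(b, s)\<close>, \<open>H\<close> restricts to a
      family on the fibre of \<open>g\<close> over \<open>b\<close>, which a map \<open>k\<close>
      into \<open>\<Pi>\<^sub>g v\<close> represents.\<close>
    have ex: "\<exists>k. k \<in> arr C \<and> src C k = src C s \<and> tgt C k = src C w1 \<and> w1 \<cdot> k = b \<and>
       (\<forall>c r. square C g b c r \<longrightarrow> ev1 c (k \<cdot> r) = H c (s \<cdot> r))" if s: "square C f u b s" for b s
    proof -
      note [simp] = squareD[OF s]
      have "over g b v (\<lambda>c r. H c (s \<cdot> r))"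
        unfolding over_def
      proof (intro allI impI)
        fix c r assume r: "square C g b c r"
        have "f \<cdot> g \<cdot> c = u \<cdot> s \<cdot> r"
          using squareD[OF r] by (simp del: assoc add: assoc[symmetric]) simp
        then have "square C (f \<cdot> g) u c (s \<cdot> r)"
          using squareD[OF r] by (simp add: square_def)
        from overD[OF H this]
        show "H c (s \<cdot> r) \<in> arr C \<and> src C (H c (s \<cdot> r)) = src C r \<and> tgt C (H c (s \<cdot> r)) = src C v \<and>
          v \<cdot> H c (s \<cdot> r) = c \<and> (\<forall>q\<in>arr C. tgt C q = src C r \<longrightarrow> H c (s \<cdot> r) \<cdot> q = H (c \<cdot> q) (s \<cdot> (r \<cdot> q)))"
          using squareD[OF r] by simp
      qed
      then obtain k where "k \<in> arr C" "src C k = src C b" "tgt C k = src C w1" "w1 \<cdot> k = b"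
        "\<And>c r. square C g b c r \<Longrightarrow> ev1 c (k \<cdot> r) = H c (s \<cdot> r)"
        by (rule pi_rep_ex[OF rep1]) (simp, simp, rule that)
      then show ?thesis by auto
    qed
    \<comment> \<open>The representing map is chosen separately for each \<open>(b, s)\<close>; that
      the choices are natural is recovered from uniqueness in
      \<open>\<Pi>\<^sub>g v\<close>.\<close>
    define H1 where "H1 b s = (SOME k. k \<in> arr C \<and> src C k = src C s \<and> tgt C k = src C w1 \<and> w1 \<cdot> k = b \<and>
       (\<forall>c r. square C g b c r \<longrightarrow> ev1 c (k \<cdot> r) = H c (s \<cdot> r)))" for b s
    have H1: "\<And>b s. square C f u b s \<Longrightarrow> H1 b s \<in> arr C" "\<And>b s. square C f u b s \<Longrightarrow> src C (H1 b s) = src C s"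
      "\<And>b s. square C f u b s \<Longrightarrow> tgt C (H1 b s) = src C w1" "\<And>b s. square C f u b s \<Longrightarrow> w1 \<cdot> H1 b s = b"
      "\<And>b s c r. square C f u b s \<Longrightarrow> square C g b c r \<Longrightarrow> ev1 c (H1 b s \<cdot> r) = H c (s \<cdot> r)"
      using someI_ex[OF ex, folded H1_def] by blast+
    have "over f u w1 H1"
      unfolding over_def
    proof (intro allI impI conjI ballI)
      fix b s r assume s: "square C f u b s" and r [simp]: "r \<in> arr C" "tgt C r = src C s"
      note [simp] = squareD[OF s] H1(1-4)[OF s]
      have sr: "square C f u (b \<cdot> r) (s \<cdot> r)" using s by (intro square_cmp) auto
      note [simp] = H1(1-4)[OF sr]
      show "H1 b s \<cdot> r = H1 (b \<cdot> r) (s \<cdot> r)"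
      proof (rule pi_rep_unique[OF rep1])
        fix c q assume q: "square C g (w1 \<cdot> (H1 b s \<cdot> r)) c q"
        then have q1: "square C g b c (r \<cdot> q)" and q2: "square C g (b \<cdot> r) c q" by (auto simp: square_def)
        note [simp] = squareD[OF q2]
        show "ev1 c (H1 b s \<cdot> r \<cdot> q) = ev1 c (H1 (b \<cdot> r) (s \<cdot> r) \<cdot> q)"
          using H1(5)[OF s q1] H1(5)[OF sr q2] by simp
      qed auto
    qed (use H1 in auto)
    then obtain k where k [simp]: "k \<in> arr C" "src C k = src C u" "tgt C k = src C w2" "w2 \<cdot> k = u"
      and ks: "\<And>b s. square C f u b s \<Longrightarrow> ev2 b (k \<cdot> s) = H1 b s"
      by (rule pi_rep_ex[OF rep2]) (simp, simp, rule that)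
    have "ev1 c (ev2 (g \<cdot> c) (k \<cdot> s)) = H c s" if s: "square C (f \<cdot> g) u c s" for c s
    proof -
      note [simp] = squareD[OF s]
      \<comment> \<open>The element \<open>c\<close> lies over \<open>g \<cdot> c\<close> without a
        change of stage, whence the identity in the second square.\<close>
      have sq: "square C f u (g \<cdot> c) s" and sq': "square C g (g \<cdot> c) c (idt C (src C s))" by (simp_all add: square_def)
      show ?thesis using H1(1-4)[OF sq] H1(5)[OF sq sq'] by (simp add: ks[OF sq])
    qed
    then show "\<exists>k. k \<in> arr C \<and> src C k = src C u \<and> tgt C k = src C w2 \<and> w2 \<cdot> k = u \<and>
        (\<forall>c s. square C (f \<cdot> g) u c s \<longrightarrow> ev1 c (ev2 (g \<cdot> c) (k \<cdot> s)) = H c s)"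
      by (intro exI[of _ k]) auto
  next
    fix k k' assume k [simp]: "k \<in> arr C" "k' \<in> arr C" "src C k = src C k'" "tgt C k = src C w2" "tgt C k' = src C w2"
      "w2 \<cdot> k = w2 \<cdot> k'"
      and eq: "\<And>c s. square C (f \<cdot> g) (w2 \<cdot> k) c s \<Longrightarrow> ev1 c (ev2 (g \<cdot> c) (k \<cdot> s)) = ev1 c (ev2 (g \<cdot> c) (k' \<cdot> s))"
    show "k = k'"
    proof (rule pi_rep_unique[OF rep2])
      fix b s assume s: "square C f (w2 \<cdot> k) b s"
      note [simp] = squareD(1-5)[OF s]
      have s1: "square C f w2 b (k \<cdot> s)" "square C f w2 b (k' \<cdot> s)"
        using squareD[OF s] by (simp_all add: square_def)
      note [simp] = ev2[OF s1(1)] ev2[OF s1(2)]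
      show "ev2 b (k \<cdot> s) = ev2 b (k' \<cdot> s)"
      proof (rule pi_rep_unique[OF rep1])
        fix c r assume "square C g (w1 \<cdot> ev2 b (k \<cdot> s)) c r"
        then have r: "square C g b c r" by simp
        note [simp] = squareD(1-5)[OF r]
        have "f \<cdot> g \<cdot> c = w2 \<cdot> k' \<cdot> s \<cdot> r"
          using squareD[OF s] squareD(6)[OF r] by (simp del: assoc add: assoc[symmetric]) simp
        then have "square C (f \<cdot> g) (w2 \<cdot> k) c (s \<cdot> r)" by (simp add: square_def)
        from eq[OF this] show "ev1 c (ev2 b (k \<cdot> s) \<cdot> r) = ev1 c (ev2 b (k' \<cdot> s) \<cdot> r)"
          using squareD(6)[OF r] by simp
      qed auto
    qed auto
  qed auto
  then show "\<exists>w ev. pi_rep (f \<cdot> g) v w ev" by blast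
qed

lemma is_pullbackD:
  assumes "is_pullback C f g a b"
  shows "f \<in> arr C" "g \<in> arr C" "tgt C f = tgt C g" "a \<in> arr C" "b \<in> arr C" "src C b = src C a"
    "tgt C a = src C f" "tgt C b = src C g" "f \<cdot> a = g \<cdot> b"
  using assms by (auto simp: is_pullback_def hom_iff)

text \<open>The given pullback need not be the chosen one, so its pairing is only available as some
  function \<open>pr\<close>.\<close>

lemma is_pullback_pairing:
  assumes "is_pullback C f g a b"
  obtains pr where "\<And>x y. square C f g x y \<Longrightarrow> pr x y \<in> arr C" "\<And>x y. square C f g x y \<Longrightarrow> src C (pr x y) = src C y"
    "\<And>x y. square C f g x y \<Longrightarrow> tgt C (pr x y) = src C a" "\<And>x y. square C f g x y \<Longrightarrow> a \<cdot> pr x y = x"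
    "\<And>x y. square C f g x y \<Longrightarrow> b \<cdot> pr x y = y"
proof -
  have "\<exists>h. h \<in> arr C \<and> src C h = src C y \<and> tgt C h = src C a \<and> a \<cdot> h = x \<and> b \<cdot> h = y" if "square C f g x y" for x y
  proof -
    have "\<exists>!h. h \<in> hom C (src C y) (src C a) \<and> a \<cdot> h = x \<and> b \<cdot> h = y"
      using assms unfolding is_pullback_def
      by (elim conjE allE[of _ "src C y"] allE[of _ x] allE[of _ y])
        (use squareD[OF that] in \<open>simp add: hom_iff\<close>)
    then show ?thesis by (auto simp: hom_iff)
  qed
  then show thesis using that by metis
qed

lemma is_pullback_eqI:
  assumes "is_pullback C f g a b" "h \<in> arr C" "h' \<in> arr C" "src C h = src C h'"
    "tgt C h = src C a" "tgt C h' = src C a" "a \<cdot> h = a \<cdot> h'" "b \<cdot> h = b \<cdot> h'"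
  shows "h = h'"
proof -
  note pb = is_pullbackD[OF assms(1)]
  have "f \<cdot> (a \<cdot> h) = g \<cdot> (b \<cdot> h)" using pb assms(2,5) by simp
  then have "\<exists>!k. k \<in> hom C (src C h) (src C a) \<and> a \<cdot> k = a \<cdot> h \<and> b \<cdot> k = b \<cdot> h"
    using assms(1) unfolding is_pullback_def
    by (elim conjE allE[of _ "src C h"] allE[of _ "a \<cdot> h"] allE[of _ "b \<cdot> h"])
      (use assms(2-6) pb in \<open>simp add: hom_iff\<close>)
  then show ?thesis using assms by (auto simp: hom_iff)
qed

lemma is_pullback_sym:
  assumes "is_pullback C f g a b"
  shows "is_pullback C g f b a"
proof -
  have "\<exists>!h. h \<in> hom C X (src C b) \<and> b \<cdot> h = y \<and> a \<cdot> h = x"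
    if "y \<in> hom C X (src C g)" "x \<in> hom C X (src C f)" "g \<cdot> y = f \<cdot> x" for X x y
  proof -
    have "\<exists>!h. h \<in> hom C X (src C a) \<and> a \<cdot> h = x \<and> b \<cdot> h = y"
      using assms that(1,2) that(3)[symmetric] unfolding is_pullback_def by blast
    moreover have "(h \<in> hom C X (src C a) \<and> a \<cdot> h = x \<and> b \<cdot> h = y) \<longleftrightarrow>
        h \<in> hom C X (src C b) \<and> b \<cdot> h = y \<and> a \<cdot> h = x" for h
      using is_pullbackD(6)[OF assms] by auto
    ultimately show ?thesis by simp
  qed
  then show ?thesis
    unfolding is_pullback_def using is_pullbackD[OF assms] by (simp add: hom_iff)
qed

text \<open>Write \<open>f : B \<rightarrow> A\<close> and \<open>g : A' \<rightarrow> A\<close>. A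
  section of \<open>v\<close> over the fibre of \<open>b\<close> at \<open>a'\<close> is a section
  of \<open>a \<cdot> v\<close> over the fibre of \<open>f\<close> at \<open>g(a')\<close> whose
  image under \<open>v\<close> is the canonical section \<open>x \<mapsto> (x, a')\<close> of
  \<open>a\<close>. Hence \<open>\<Pi>\<^sub>b v\<close> is the pullback of
  \<open>\<Pi>\<^sub>f (a \<cdot> v) \<rightarrow> \<Pi>\<^sub>f a\<close> along the map
  \<open>A' \<rightarrow> \<Pi>\<^sub>f a\<close> that names the canonical section.\<close>

lemma exponentiable_pullback:
  assumes pb: "is_pullback C f g a b" and f: "exponentiable C f"
  shows "exponentiable C b"
  unfolding exponentiable_iff
proof (intro conjI ballI impI)
  note [simp] = is_pullbackD[OF pb]
  show "b \<in> arr C" by simp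
  fix v assume v [simp]: "v \<in> arr C" "tgt C v = src C b"
  obtain w1 ev1 where rep1: "pi_rep f (a \<cdot> v) w1 ev1" using pi_rep_Pi_fun[OF f, of "a \<cdot> v"] by auto
  obtain w0 ev0 where rep0: "pi_rep f a w0 ev0" using pi_rep_Pi_fun[OF f, of a] by auto
  note [simp] = pi_repD(1,2)[OF rep1] pi_repD(1,2)[OF rep0]
  note ev1 = overD[OF pi_repD(3)[OF rep1]] and ev0 = overD[OF pi_repD(3)[OF rep0]]
  obtain pr where pr: "\<And>x y. square C f g x y \<Longrightarrow> pr x y \<in> arr C" "\<And>x y. square C f g x y \<Longrightarrow> src C (pr x y) = src C y"
    "\<And>x y. square C f g x y \<Longrightarrow> tgt C (pr x y) = src C a" "\<And>x y. square C f g x y \<Longrightarrow> a \<cdot> pr x y = x"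
    "\<And>x y. square C f g x y \<Longrightarrow> b \<cdot> pr x y = y"
    using is_pullback_pairing[OF pb] by blast
  have pr_cmp: "pr x y \<cdot> r = pr (x \<cdot> r) (y \<cdot> r)" if xy: "square C f g x y" and [simp]: "r \<in> arr C" "tgt C r = src C y" for x y r
  proof -
    note [simp] = squareD(1-5)[OF xy]
    have xyr: "square C f g (x \<cdot> r) (y \<cdot> r)" using xy by (intro square_cmp) auto
    show ?thesis by (rule is_pullback_eqI[OF pb]) (simp_all add: pr[OF xy] pr[OF xyr])
  qed
  \<comment> \<open>The map \<open>m\<close> obtained from this family is
    \<open>\<Pi>\<^sub>f\<close> applied to \<open>v\<close>, seen as a morphism from
    \<open>a \<cdot> v\<close> to \<open>a\<close> over the domain of \<open>f\<close>.\<close>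
  have "over f w1 a (\<lambda>x s. v \<cdot> ev1 x s)"
    unfolding over_def
  proof (intro allI impI)
    fix x s assume s: "square C f w1 x s"
    show "v \<cdot> ev1 x s \<in> arr C \<and> src C (v \<cdot> ev1 x s) = src C s \<and> tgt C (v \<cdot> ev1 x s) = src C a \<and>
       a \<cdot> (v \<cdot> ev1 x s) = x \<and> (\<forall>r\<in>arr C. tgt C r = src C s \<longrightarrow> v \<cdot> ev1 x s \<cdot> r = v \<cdot> ev1 (x \<cdot> r) (s \<cdot> r))"
      using ev1[OF s] squareD[OF s] by (simp flip: assoc)
  qed
  then obtain m where m [simp]: "m \<in> arr C" "src C m = src C w1" "tgt C m = src C w0" "w0 \<cdot> m = w1"
    and ev_m: "\<And>x s. square C f w1 x s \<Longrightarrow> ev0 x (m \<cdot> s) = v \<cdot> ev1 x s"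
      by (rule pi_rep_ex[OF rep0]) (simp, simp, rule that)
  \<comment> \<open>The map \<open>n\<close> obtained from the pairing names the canonical
    section.\<close>
  have "over f g a pr" using pr pr_cmp by (auto simp: over_def)
  then obtain n where n [simp]: "n \<in> arr C" "src C n = src C g" "tgt C n = src C w0" "w0 \<cdot> n = g"
    and ev_n: "\<And>x s. square C f g x s \<Longrightarrow> ev0 x (n \<cdot> s) = pr x s"
      by (rule pi_rep_ex[OF rep0]) (simp, simp, rule that)
  let ?w = "pb1 C n m" and ?t = "pb2 C n m"
  have w1t: "w1 \<cdot> ?t = g \<cdot> ?w"
    using pb_commutes[of n m] assoc[of ?t m w0] assoc[of ?w n w0] by simp
  have sq1: "square C f w1 (a \<cdot> c) (?t \<cdot> s)" and sqg: "square C f g (a \<cdot> c) (?w \<cdot> s)" if "square C b ?w c s" for c s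
  proof -
    note [simp] = squareD(1-5)[OF that] w1t
    have "g \<cdot> b \<cdot> c = g \<cdot> ?w \<cdot> s" using squareD(6)[OF that] by (simp flip: assoc)
    then show "square C f w1 (a \<cdot> c) (?t \<cdot> s)" "square C f g (a \<cdot> c) (?w \<cdot> s)" by (simp_all add: square_def)
  qed
  have "pi_rep b v ?w (\<lambda>c s. ev1 (a \<cdot> c) (?t \<cdot> s))"
  proof (rule pi_repI)
    show "over b ?w v (\<lambda>c s. ev1 (a \<cdot> c) (?t \<cdot> s))"
      unfolding over_def
    proof (intro allI impI)
      fix c s assume s: "square C b ?w c s"
      note [simp] = squareD(1-5)[OF s] ev1(1-4)[OF sq1[OF s]]
      have "v \<cdot> ev1 (a \<cdot> c) (?t \<cdot> s) = ev0 (a \<cdot> c) (m \<cdot> ?t \<cdot> s)"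
        using ev_m[OF sq1[OF s]] by simp
      also have "\<dots> = pr (a \<cdot> c) (?w \<cdot> s)" using ev_n[OF sqg[OF s]] pb_commutes[of n m] by simp
      finally have b: "b \<cdot> v \<cdot> ev1 (a \<cdot> c) (?t \<cdot> s) = b \<cdot> c"
        using pr[OF sqg[OF s]] squareD(6)[OF s] assoc[of "ev1 (a \<cdot> c) (?t \<cdot> s)" v b] by simp
      \<comment> \<open>Equality in the pullback is tested on both projections: along
        \<open>a\<close> it is a property of \<open>ev1\<close>, along \<open>b\<close> it comes
        from the agreement of \<open>n\<close> and \<open>m\<close> on the new object.\<close>
      have "v \<cdot> ev1 (a \<cdot> c) (?t \<cdot> s) = c"
        by (rule is_pullback_eqI[OF pb]) (use b in simp_all)
      then show "ev1 (a \<cdot> c) (?t \<cdot> s) \<in> arr C \<and> src C (ev1 (a \<cdot> c) (?t \<cdot> s)) = src C s \<and>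
         tgt C (ev1 (a \<cdot> c) (?t \<cdot> s)) = src C v \<and> v \<cdot> ev1 (a \<cdot> c) (?t \<cdot> s) = c \<and>
         (\<forall>r\<in>arr C. tgt C r = src C s \<longrightarrow> ev1 (a \<cdot> c) (?t \<cdot> s) \<cdot> r = ev1 (a \<cdot> (c \<cdot> r)) (?t \<cdot> (s \<cdot> r)))"
        using ev1(5)[OF sq1[OF s]] by simp
    qed
  next
    fix u H assume u [simp]: "u \<in> arr C" "tgt C u = tgt C b" and H: "over b u v H"
    have sqg': "square C f g x (u \<cdot> s)" if "square C f (g \<cdot> u) x s" for x s using that by (auto simp: square_def)
    have sqb: "square C b u (pr x (u \<cdot> s)) s" if "square C f (g \<cdot> u) x s" for x s
      using pr[OF sqg'[OF that]] squareD[OF that] by (auto simp: square_def)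
    have "over f (g \<cdot> u) (a \<cdot> v) (\<lambda>x s. H (pr x (u \<cdot> s)) s)"
      unfolding over_def
    proof (intro allI impI)
      fix x s assume s: "square C f (g \<cdot> u) x s"
      note [simp] = squareD(1-5)[OF s] overD(1-4)[OF H sqb[OF s]] pr[OF sqg'[OF s]]
      show "H (pr x (u \<cdot> s)) s \<in> arr C \<and> src C (H (pr x (u \<cdot> s)) s) = src C s \<and>
         tgt C (H (pr x (u \<cdot> s)) s) = src C (a \<cdot> v) \<and> a \<cdot> v \<cdot> H (pr x (u \<cdot> s)) s = x \<and>
         (\<forall>r\<in>arr C. tgt C r = src C s \<longrightarrow> H (pr x (u \<cdot> s)) s \<cdot> r = H (pr (x \<cdot> r) (u \<cdot> (s \<cdot> r))) (s \<cdot> r))"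
        using overD(5)[OF H sqb[OF s]] pr_cmp[OF sqg'[OF s]] by (simp flip: assoc)
    qed
    then obtain t where t [simp]: "t \<in> arr C" "src C t = src C (g \<cdot> u)" "tgt C t = src C w1" "w1 \<cdot> t = g \<cdot> u"
      and ev_t: "\<And>x s. square C f (g \<cdot> u) x s \<Longrightarrow> ev1 x (t \<cdot> s) = H (pr x (u \<cdot> s)) s"
      by (rule pi_rep_ex[OF rep1]) (simp, simp, rule that)
    \<comment> \<open>Both sides evaluate to the canonical section, since \<open>v\<close> applied
      to a value of \<open>H\<close> returns the element of the pullback at which \<open>H\<close>
      was taken.\<close>
    have "n \<cdot> u = m \<cdot> t"
    proof (rule pi_rep_unique[OF rep0])
      fix x s assume "square C f (w0 \<cdot> (n \<cdot> u)) x s"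
      then have s: "square C f (g \<cdot> u) x s" by simp
      note [simp] = squareD(1-5)[OF s]
      have s': "square C f w1 x (t \<cdot> s)" using squareD(6)[OF s] by (simp add: square_def)
      have "ev0 x (n \<cdot> u \<cdot> s) = pr x (u \<cdot> s)" using ev_n[OF sqg'[OF s]] by simp
      also have "\<dots> = ev0 x (m \<cdot> t \<cdot> s)" using ev_m[OF s'] ev_t[OF s] overD[OF H sqb[OF s]] by simp
      finally show "ev0 x (n \<cdot> u \<cdot> s) = ev0 x (m \<cdot> t \<cdot> s)" .
    qed auto
    then have ut: "square C n m u t" by (simp add: square_def)
    define k where "k = pb_pair C n m u t"
    note k [simp] = pb_pair[OF _ _ _ ut, folded k_def]
    have "ev1 (a \<cdot> c) (?t \<cdot> (k \<cdot> s)) = H c s" if s: "square C b u c s" for c s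
    proof -
      note [simp] = squareD[OF s]
      have "f \<cdot> a \<cdot> c = g \<cdot> u \<cdot> s" by simp (simp flip: assoc)
      then have s': "square C f (g \<cdot> u) (a \<cdot> c) s" by (simp add: square_def)
      have "pr (a \<cdot> c) (u \<cdot> s) = c" by (rule is_pullback_eqI[OF pb]) (simp_all add: pr[OF sqg'[OF s']])
      then show ?thesis using ev_t[OF s'] by simp
    qed
    then show "\<exists>k. k \<in> arr C \<and> src C k = src C u \<and> tgt C k = src C ?w \<and> ?w \<cdot> k = u \<and>
        (\<forall>c s. square C b u c s \<longrightarrow> ev1 (a \<cdot> c) (?t \<cdot> (k \<cdot> s)) = H c s)"
      by (intro exI[of _ k]) auto
  next
    fix k k' assume k [simp]: "k \<in> arr C" "k' \<in> arr C" "src C k = src C k'" "tgt C k = src C ?w" "tgt C k' = src C ?w"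
      "?w \<cdot> k = ?w \<cdot> k'"
      and eq: "\<And>c s. square C b (?w \<cdot> k) c s \<Longrightarrow> ev1 (a \<cdot> c) (?t \<cdot> (k \<cdot> s)) = ev1 (a \<cdot> c) (?t \<cdot> (k' \<cdot> s))"
    have gwk: "g \<cdot> ?w \<cdot> k = g \<cdot> ?w \<cdot> k'" using assoc[of k ?w g] assoc[of k' ?w g] by simp
    have "?t \<cdot> k = ?t \<cdot> k'"
    proof (rule pi_rep_unique[OF rep1])
      fix x s assume "square C f (w1 \<cdot> (?t \<cdot> k)) x s"
      then have s: "square C f (g \<cdot> ?w \<cdot> k) x s" by (simp add: w1t)
      note [simp] = squareD(1-5)[OF s] gwk
      have s': "square C f g x (?w \<cdot> k' \<cdot> s)" using squareD(6)[OF s] by (simp add: square_def)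
      \<comment> \<open>An evaluation at \<open>x\<close> over \<open>f\<close> is an evaluation
        over \<open>b\<close> at the paired element, whose \<open>a\<close> component is
        \<open>x\<close>; there the hypothesis applies.\<close>
      have "square C b (?w \<cdot> k) (pr x (?w \<cdot> k' \<cdot> s)) s" by (simp add: square_def pr[OF s'])
      from eq[OF this] show "ev1 x (?t \<cdot> k \<cdot> s) = ev1 x (?t \<cdot> k' \<cdot> s)" by (simp add: pr[OF s'])
    qed (auto simp: w1t gwk)
    then show "k = k'" by - (rule pb_eqI[of n m], simp_all)
  qed auto
  then show "\<exists>w ev. pi_rep b v w ev" by blast
qed

lemma exponentiable_pb1:
  "exponentiable C g \<Longrightarrow> f \<in> arr C \<Longrightarrow> tgt C f = tgt C g \<Longrightarrow> exponentiable C (pb1 C f g)"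
  by (rule exponentiable_pullback[OF is_pullback_sym[OF is_pullback_pb]]) simp_all

lemma exponentiable_pb2:
  "exponentiable C f \<Longrightarrow> g \<in> arr C \<Longrightarrow> tgt C f = tgt C g \<Longrightarrow> exponentiable C (pb2 C f g)"
  by (rule exponentiable_pullback[OF is_pullback_pb]) simp_all

section \<open>Products of a morphism with an identity\<close>

lemma prod_map [simp]:
  assumes [simp]: "f \<in> arr C" "g \<in> arr C"
  shows "prod_map C f g \<in> arr C" "src C (prod_map C f g) = src C (prj1 C (src C f) (src C g))"
    "tgt C (prod_map C f g) = src C (prj1 C (tgt C f) (tgt C g))"
    "prj1 C (tgt C f) (tgt C g) \<cdot> prod_map C f g = f \<cdot> prj1 C (src C f) (src C g)"
    "prj2 C (tgt C f) (tgt C g) \<cdot> prod_map C f g = g \<cdot> prj2 C (src C f) (src C g)"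
  by (simp_all add: prod_map_def)

text \<open>The \<open>X\<close> component passes through \<open>id \<times> g\<close> unchanged, so
  \<open>id \<times> g\<close> is the base change of \<open>g\<close> along a projection. This is
  the source of its exponentiability.\<close>

lemma is_pullback_idt_prod:
  assumes [simp]: "X \<in> obj C" "g \<in> arr C"
  shows "is_pullback C g (prj2 C X (tgt C g)) (prj2 C X (src C g)) (prod_map C (idt C X) g)"
proof -
  note [simp] = prod_map[OF idt_arr[OF assms(1)] assms(2), simplified]
  have "\<exists>!h. h \<in> hom C Z (src C (prj2 C X (src C g))) \<and> prj2 C X (src C g) \<cdot> h = z \<and> prod_map C (idt C X) g \<cdot> h = t"
    if z: "z \<in> hom C Z (src C g)" and t: "t \<in> hom C Z (src C (prj2 C X (tgt C g)))" and eq: "g \<cdot> z = prj2 C X (tgt C g) \<cdot> t"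
    for Z z t
  proof (rule ex1I[of _ "pair C X (src C g) (prj1 C X (tgt C g) \<cdot> t) z"])
    have [simp]: "z \<in> arr C" "src C z = Z" "tgt C z = src C g" "t \<in> arr C" "src C t = Z" "tgt C t = src C (prj1 C X (tgt C g))"
      using z t by (auto simp: hom_iff)
    let ?h = "pair C X (src C g) (prj1 C X (tgt C g) \<cdot> t) z"
    have "prod_map C (idt C X) g \<cdot> ?h = t"
      by (rule prod_eqI[of X "tgt C g"]) (simp_all add: eq)
    then show "?h \<in> hom C Z (src C (prj2 C X (src C g))) \<and> prj2 C X (src C g) \<cdot> ?h = z \<and> prod_map C (idt C X) g \<cdot> ?h = t"
      by (simp add: hom_iff)
    fix h assume h: "h \<in> hom C Z (src C (prj2 C X (src C g))) \<and> prj2 C X (src C g) \<cdot> h = z \<and> prod_map C (idt C X) g \<cdot> h = t"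
    then have [simp]: "h \<in> arr C" "src C h = Z" "tgt C h = src C (prj1 C X (src C g))" "prj2 C X (src C g) \<cdot> h = z"
      and t': "t = prod_map C (idt C X) g \<cdot> h"
      by (auto simp: hom_iff)
    show "h = ?h" by (rule prod_eqI[of X "src C g"]) (simp_all add: t')
  qed
  then show ?thesis by (simp add: is_pullback_def hom_iff)
qed

lemma exponentiable_idt_prod:
  "X \<in> obj C \<Longrightarrow> exponentiable C g \<Longrightarrow> exponentiable C (prod_map C (idt C X) g)"
  by (rule exponentiable_pullback[OF is_pullback_idt_prod]) simp_all

section \<open>Evaluation and transposition for the chosen adjoint\<close>

definition Pi_eval :: "'a \<Rightarrow> 'a \<Rightarrow> 'a \<Rightarrow> 'a \<Rightarrow> 'a" where
  "Pi_eval f v b s = underlying (Pi_counit C f v) \<cdot> pb_pair C f (omap (Pi_fun C f) v) b s"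

lemma pi_rep_Pi_eval:
  "exponentiable C f \<Longrightarrow> v \<in> arr C \<Longrightarrow> tgt C v = src C f \<Longrightarrow> pi_rep f v (omap (Pi_fun C f) v) (Pi_eval f v)"
  using pi_rep_Pi_fun unfolding Pi_eval_def by blast

lemma Pi_transpose:
  assumes "exponentiable C f" "v \<in> arr C" "tgt C v = src C f" "u \<in> arr C" "tgt C u = tgt C f" "over f u v H"
    and k: "k = Pi_transpose C f u v (H (pb1 C f u) (pb2 C f u))"
  shows "k \<in> arr C" "src C k = src C u" "tgt C k = src C (omap (Pi_fun C f) v)" "omap (Pi_fun C f) v \<cdot> k = u"
    "square C f u b s \<Longrightarrow> Pi_eval f v b (k \<cdot> s) = H b s"
  using Pi_universal(5)[OF assms(1-6), of k] k unfolding Pi_eval_def by (auto simp: hom_iff)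

section \<open>Morphisms of polynomials\<close>

text \<open>\<open>dir \<phi> t d\<close> is the direction \<open>\<phi>\<^sup>\<sharp>(t, d)\<close> of \<open>p\<close>, for generalized elements \<open>t\<close> of \<open>P\<close> and \<open>d\<close> of
  \<open>Q\<^sub>*\<close> lying over the same element of \<open>Q\<close>.\<close>

definition dir :: "'a poly_mor \<Rightarrow> 'a \<Rightarrow> 'a \<Rightarrow> 'a" where
  "dir \<phi> t d = on_dir \<phi> \<cdot> pb_pair C (on_pos \<phi>) (poly_tgt \<phi>) t d"

lemma is_poly_morD:
  assumes "is_poly_mor C \<phi>"
  shows "exponentiable C (poly_src \<phi>)" "exponentiable C (poly_tgt \<phi>)" "on_pos \<phi> \<in> arr C"
    "src C (on_pos \<phi>) = tgt C (poly_src \<phi>)" "tgt C (on_pos \<phi>) = tgt C (poly_tgt \<phi>)"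
    "on_dir \<phi> \<in> arr C" "src C (on_dir \<phi>) = src C (pb1 C (on_pos \<phi>) (poly_tgt \<phi>))" "tgt C (on_dir \<phi>) = src C (poly_src \<phi>)"
    "poly_src \<phi> \<cdot> on_dir \<phi> = pb1 C (on_pos \<phi>) (poly_tgt \<phi>)" "poly_src \<phi> \<in> arr C" "poly_tgt \<phi> \<in> arr C"
  using assms by (auto simp: is_poly_mor_def Let_def hom_iff)

lemma over_dir:
  assumes "is_poly_mor C \<phi>"
  shows "over (on_pos \<phi>) (poly_tgt \<phi>) (poly_src \<phi>) (dir \<phi>)"
  unfolding dir_def by (rule over_pb_pair) (use is_poly_morD[OF assms] in \<open>simp_all add: hom_iff\<close>)

lemmas dir = overD[OF over_dir]

text \<open>Morphisms of polynomials are built below from their action \<open>H\<close> on elements;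
  \<open>on_dir\<close> is recovered as its value at the generic pair.\<close>

lemma is_poly_morI:
  assumes pq: "exponentiable C p" "exponentiable C q" and f: "f \<in> arr C" "src C f = tgt C p" "tgt C f = tgt C q"
    and H: "over f q p H" and s: "s = H (pb1 C f q) (pb2 C f q)"
  shows "is_poly_mor C (PolyMor p q f s)"
    and "square C f q t d \<Longrightarrow> dir (PolyMor p q f s) t d = H t d"
proof -
  note [simp] = pq[THEN exponentiable_arr] f
  have "square C f q (pb1 C f q) (pb2 C f q)" by simp
  from overD[OF H this] show "is_poly_mor C (PolyMor p q f s)"
    using pq by (simp add: is_poly_mor_def hom_iff s)
  assume td: "square C f q t d"
  have "H t d = s \<cdot> pb_pair C f q t d"
    unfolding s by (rule over_eq[OF _ _ _ H td]) simp_all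
  then show "dir (PolyMor p q f s) t d = H t d" by (simp add: dir_def)
qed

lemma poly_mor_eqI:
  assumes "is_poly_mor C \<phi>" "is_poly_mor C \<psi>" "poly_src \<phi> = poly_src \<psi>" "poly_tgt \<phi> = poly_tgt \<psi>" "on_pos \<phi> = on_pos \<psi>"
    and "\<And>t d. square C (on_pos \<phi>) (poly_tgt \<phi>) t d \<Longrightarrow> dir \<phi> t d = dir \<psi> t d"
  shows "\<phi> = \<psi>"
proof -
  have "dir \<phi> (pb1 C (on_pos \<phi>) (poly_tgt \<phi>)) (pb2 C (on_pos \<phi>) (poly_tgt \<phi>)) =
     dir \<psi> (pb1 C (on_pos \<phi>) (poly_tgt \<phi>)) (pb2 C (on_pos \<phi>) (poly_tgt \<phi>))"
    using is_poly_morD[OF assms(1)] by (intro assms(6)) simp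
  then have "on_dir \<phi> = on_dir \<psi>"
    using is_poly_morD[OF assms(1)] is_poly_morD[OF assms(2)] assms(3-5) by (simp add: dir_def)
  then show ?thesis using assms(3-5) by (simp add: poly_mor.expand)
qed

text \<open>The isomorphism \<open>\<iota>\<close> only regroups \<open>(t, d)\<close> as
  \<open>(t, (\<phi>\<^sub>1 t, d))\<close>. On elements it therefore disappears, and composition
  becomes substitution; later arguments about directions use this form.\<close>

lemma poly_cmp:
  assumes \<phi>: "is_poly_mor C \<phi>" and \<psi>: "is_poly_mor C \<psi>" and eq: "poly_tgt \<phi> = poly_src \<psi>"
  shows "is_poly_mor C (poly_cmp C \<psi> \<phi>)"
    and "square C (on_pos \<psi> \<cdot> on_pos \<phi>) (poly_tgt \<psi>) t d \<Longrightarrow>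
      dir (poly_cmp C \<psi> \<phi>) t d = dir \<phi> t (dir \<psi> (on_pos \<phi> \<cdot> t) d)"
proof -
  define p q r f g where defs: "p = poly_src \<phi>" "q = poly_src \<psi>" "r = poly_tgt \<psi>" "f = on_pos \<phi>" "g = on_pos \<psi>"
  note [simp] = is_poly_morD(3-)[OF \<phi>, unfolded eq, folded defs] is_poly_morD(3-)[OF \<psi>, folded defs]
  note dir\<phi> = dir[OF \<phi>, unfolded eq, folded defs] and dir\<psi> = dir[OF \<psi>, folded defs]
  define H where "H t d = dir \<phi> t (dir \<psi> (f \<cdot> t) d)" for t d
  have sq1: "square C g r (f \<cdot> t) d" if "square C (g \<cdot> f) r t d" for t d using that by (auto simp: square_def)
  have sq2: "square C f q t (dir \<psi> (f \<cdot> t) d)" if "square C (g \<cdot> f) r t d" for t d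
    using dir\<psi>[OF sq1[OF that]] squareD[OF that] by (simp add: square_def)
  have H: "over (g \<cdot> f) r p H"
    unfolding over_def
  proof (intro allI impI)
    fix t d assume s: "square C (g \<cdot> f) r t d"
    show "H t d \<in> arr C \<and> src C (H t d) = src C d \<and> tgt C (H t d) = src C p \<and>
           p \<cdot> H t d = t \<and> (\<forall>k\<in>arr C. tgt C k = src C d \<longrightarrow> H t d \<cdot> k = H (t \<cdot> k) (d \<cdot> k))"
      unfolding H_def using dir\<psi>[OF sq1[OF s]] dir\<phi>[OF sq2[OF s]] squareD[OF s] by simp
  qed
  let ?t = "pb1 C (g \<cdot> f) r" and ?d = "pb2 C (g \<cdot> f) r"
  define \<iota> where "\<iota> = pb_pair C f (pb1 C g r) ?t (pb_pair C g r (f \<cdot> ?t) ?d)"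
  have td: "square C (g \<cdot> f) r ?t ?d" by simp
  note [simp] = pb_pair[OF _ _ _ sq1[OF td]]
  have sq\<iota>: "square C f (pb1 C g r) ?t (pb_pair C g r (f \<cdot> ?t) ?d)" by (simp add: square_def)
  have sqm: "square C f q (pb1 C f (pb1 C g r)) (on_dir \<psi> \<cdot> pb2 C f (pb1 C g r))"
    using pb_commutes[of f "pb1 C g r"] by (simp add: square_def)
  note [simp] = pb_pair[OF _ _ _ sq\<iota>] cmp_pb_pair[OF _ _ _ sq\<iota>]
  \<comment> \<open>\<open>pb_map\<close> applies \<open>\<psi>\<^sup>\<sharp>\<close> to the second
    component of the regrouped pair.\<close>
  have "pb_map C f (pb1 C g r) (on_dir \<psi>) q \<cdot> \<iota> = pb_pair C f q ?t (on_dir \<psi> \<cdot> pb_pair C g r (f \<cdot> ?t) ?d)"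
    unfolding pb_map_def \<iota>_def by (subst pb_pair_cmp[OF _ _ _ sqm]) simp_all
  then have "on_dir \<phi> \<cdot> (pb_map C f (pb1 C g r) (on_dir \<psi>) q \<cdot> \<iota>) = H ?t ?d"
    by (simp add: H_def dir_def eq flip: defs)
  then have cmp: "poly_cmp C \<psi> \<phi> = PolyMor p r (g \<cdot> f) (H ?t ?d)"
    by (simp add: poly_cmp_def Let_def eq \<iota>_def flip: defs)
  have "exponentiable C p" "exponentiable C r" using is_poly_morD[OF \<phi>] is_poly_morD[OF \<psi>] by (simp_all add: defs)
  note mor = is_poly_morI[OF this _ _ _ H refl]
  show "is_poly_mor C (poly_cmp C \<psi> \<phi>)" unfolding cmp by (rule mor) simp_all
  show "square C (on_pos \<psi> \<cdot> on_pos \<phi>) (poly_tgt \<psi>) t d \<Longrightarrow>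
      dir (poly_cmp C \<psi> \<phi>) t d = dir \<phi> t (dir \<psi> (on_pos \<phi> \<cdot> t) d)"
    using mor(2)[of t d] by (simp add: cmp H_def flip: defs)
qed

lemma poly_cmp_simps [simp]:
  "poly_src (poly_cmp C \<psi> \<phi>) = poly_src \<phi>" "poly_tgt (poly_cmp C \<psi> \<phi>) = poly_tgt \<psi>"
  "on_pos (poly_cmp C \<psi> \<phi>) = on_pos \<psi> \<cdot> on_pos \<phi>"
  by (simp_all add: poly_cmp_def Let_def)

lemma Poly_simps [simp]:
  "p \<in> obj (Poly C) \<longleftrightarrow> exponentiable C p"
  "\<psi> \<cdot>\<^bsub>Poly C\<^esub> \<phi> = poly_cmp C \<psi> \<phi>"
  by (simp_all add: Poly_def)

lemma hom_Poly_iff: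
  "\<phi> \<in> hom (Poly C) p q \<longleftrightarrow> is_poly_mor C \<phi> \<and> poly_src \<phi> = p \<and> poly_tgt \<phi> = q"
  by (simp add: Poly_def hom_def)

lemma hom_PolyD:
  assumes "\<phi> \<in> hom (Poly C) p q"
  shows "poly_src \<phi> = p" "poly_tgt \<phi> = q" "exponentiable C p" "exponentiable C q" "p \<in> arr C" "q \<in> arr C"
    "on_pos \<phi> \<in> arr C" "src C (on_pos \<phi>) = tgt C p" "tgt C (on_pos \<phi>) = tgt C q"
    "over (on_pos \<phi>) q p (dir \<phi>)"
  using assms is_poly_morD(1-5)[of \<phi>] over_dir[of \<phi>] by (auto simp: hom_Poly_iff)

lemmas dir_hom = overD[OF hom_PolyD(10)]

lemma hom_PolyI:
  assumes "exponentiable C p" "exponentiable C q" "f \<in> arr C" "src C f = tgt C p" "tgt C f = tgt C q"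
    "over f q p H" "s = H (pb1 C f q) (pb2 C f q)"
  shows "PolyMor p q f s \<in> hom (Poly C) p q"
    and "square C f q t d \<Longrightarrow> dir (PolyMor p q f s) t d = H t d"
  using is_poly_morI[OF assms] by (simp_all add: hom_Poly_iff)

lemma hom_Poly_eqI:
  assumes "\<phi> \<in> hom (Poly C) p q" "\<psi> \<in> hom (Poly C) p q" "on_pos \<phi> = on_pos \<psi>"
    and "\<And>t d. square C (on_pos \<phi>) q t d \<Longrightarrow> dir \<phi> t d = dir \<psi> t d"
  shows "\<phi> = \<psi>"
  using assms by (intro poly_mor_eqI[of \<phi> \<psi>]) (auto simp: hom_Poly_iff)

lemma hom_Poly_cmp:
  assumes "\<phi> \<in> hom (Poly C) p q" "\<psi> \<in> hom (Poly C) q r"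
  shows "poly_cmp C \<psi> \<phi> \<in> hom (Poly C) p r"
    and "square C (on_pos \<psi> \<cdot> on_pos \<phi>) r t d \<Longrightarrow>
      dir (poly_cmp C \<psi> \<phi>) t d = dir \<phi> t (dir \<psi> (on_pos \<phi> \<cdot> t) d)"
  using poly_cmp[of \<phi> \<psi>] assms by (auto simp: hom_Poly_iff)

section \<open>The composition product\<close>

text \<open>The analogue of \<open>over\<close> for maps from the pullback to a plain object
  \<open>Y\<close>, used where no structure map constrains the value, as for the \<open>Q\<close>
  component of a position of \<open>p \<triangleleft> q\<close>.\<close>

definition natural :: "'a \<Rightarrow> 'a \<Rightarrow> 'o \<Rightarrow> ('a \<Rightarrow> 'a \<Rightarrow> 'a) \<Rightarrow> bool" where
  "natural f u Y F \<longleftrightarrow> (\<forall>b s. square C f u b s \<longrightarrow>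
     F b s \<in> arr C \<and> src C (F b s) = src C s \<and> tgt C (F b s) = Y \<and>
     (\<forall>r\<in>arr C. tgt C r = src C s \<longrightarrow> F b s \<cdot> r = F (b \<cdot> r) (s \<cdot> r)))"

lemma naturalD:
  assumes "natural f u Y F" "square C f u b s"
  shows "F b s \<in> arr C" "src C (F b s) = src C s" "tgt C (F b s) = Y"
    "r \<in> arr C \<Longrightarrow> tgt C r = src C s \<Longrightarrow> F b s \<cdot> r = F (b \<cdot> r) (s \<cdot> r)"
  using assms by (auto simp: natural_def)

text \<open>For a position \<open>\<tau> = (x, f)\<close> of \<open>p \<triangleleft> q\<close> and a direction \<open>y\<close> of \<open>p\<close> at \<open>x\<close>, \<open>tri_ev p q y \<tau>\<close> is
  \<open>f(y)\<close>; \<open>tri_pt p q y \<tau> z\<close> says that \<open>(y, z)\<close> is a direction at \<open>\<tau>\<close>, and \<open>tri_dir p q y \<tau> z\<close> is that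
  direction.\<close>

definition tri_ev :: "'a \<Rightarrow> 'a \<Rightarrow> 'a \<Rightarrow> 'a \<Rightarrow> 'a" where
  "tri_ev p q y \<tau> = tri_eval C p q \<cdot> pb_pair C p (tri_base C p q) y \<tau>"

definition tri_pt :: "'a \<Rightarrow> 'a \<Rightarrow> 'a \<Rightarrow> 'a \<Rightarrow> 'a \<Rightarrow> bool" where
  "tri_pt p q y \<tau> z \<longleftrightarrow> square C p (tri_base C p q) y \<tau> \<and> z \<in> arr C \<and> src C z = src C \<tau> \<and>
     tgt C z = src C q \<and> q \<cdot> z = tri_ev p q y \<tau>"

definition tri_dir :: "'a \<Rightarrow> 'a \<Rightarrow> 'a \<Rightarrow> 'a \<Rightarrow> 'a \<Rightarrow> 'a" where
  "tri_dir p q y \<tau> z = pb_pair C (tri_eval C p q) q (pb_pair C p (tri_base C p q) y \<tau>) z"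

lemma tri_ptD:
  assumes "tri_pt p q y \<tau> z"
  shows "square C p (tri_base C p q) y \<tau>" "z \<in> arr C" "src C z = src C \<tau>" "tgt C z = src C q"
    "q \<cdot> z = tri_ev p q y \<tau>"
  using assms by (auto simp: tri_pt_def)

context
  fixes p q
  assumes p: "exponentiable C p" and q: "exponentiable C q"
begin

lemma pi_rep_tri: "pi_rep p (prj2 C (tgt C q) (src C p)) (tri_base C p q) (Pi_eval p (prj2 C (tgt C q) (src C p)))"
  unfolding tri_base_def using p q by (intro pi_rep_Pi_eval) auto

lemma tri_base: "tri_base C p q \<in> arr C" "tgt C (tri_base C p q) = tgt C p"
  using pi_repD[OF pi_rep_tri] by auto

lemma tri_eval: "tri_eval C p q \<in> arr C" "src C (tri_eval C p q) = src C (pb1 C p (tri_base C p q))"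
  "tgt C (tri_eval C p q) = tgt C q"
  using Pi_universal(3)[OF p, of "prj2 C (tgt C q) (src C p)"] p q
  unfolding tri_eval_def tri_base_def by (auto simp: hom_iff)

lemma tri_ev_eq:
  assumes "square C p (tri_base C p q) y \<tau>"
  shows "tri_ev p q y \<tau> = prj1 C (tgt C q) (src C p) \<cdot> Pi_eval p (prj2 C (tgt C q) (src C p)) y \<tau>"
  using Pi_universal(3)[OF p, of "prj2 C (tgt C q) (src C p)"] p q tri_base
    pb_pair[OF _ _ _ assms]
  unfolding tri_ev_def tri_eval_def Pi_eval_def tri_base_def[symmetric] by (auto simp: hom_iff)

lemma natural_tri_ev: "natural p (tri_base C p q) (tgt C q) (tri_ev p q)"
  unfolding natural_def
proof (intro allI impI)
  fix y \<tau> assume y\<tau>: "square C p (tri_base C p q) y \<tau>"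
  note [simp] = p q tri_base tri_eval squareD(1-5)[OF y\<tau>] pb_pair[OF _ _ _ y\<tau>]
  show "tri_ev p q y \<tau> \<in> arr C \<and> src C (tri_ev p q y \<tau>) = src C \<tau> \<and> tgt C (tri_ev p q y \<tau>) = tgt C q \<and>
    (\<forall>r\<in>arr C. tgt C r = src C \<tau> \<longrightarrow> tri_ev p q y \<tau> \<cdot> r = tri_ev p q (y \<cdot> r) (\<tau> \<cdot> r))"
    unfolding tri_ev_def using y\<tau> by (simp add: pb_pair_cmp flip: assoc)
qed

lemmas tri_ev = naturalD[OF natural_tri_ev]

text \<open>\<open>\<Pi>\<^sub>p\<close> is applied to the projection
  \<open>Q \<times> P\<^sub>* \<rightarrow> P\<^sub>*\<close>, so the second component of an
  evaluation at \<open>y\<close> is forced to be \<open>y\<close>. Positions over the same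
  \<open>x\<close> are thus distinguished by \<open>tri_ev\<close> alone.\<close>

lemma tri_unique:
  assumes k: "k \<in> arr C" "k' \<in> arr C" "src C k = src C k'" "tgt C k = src C (tri_base C p q)" "tgt C k' = src C (tri_base C p q)"
      "tri_base C p q \<cdot> k = tri_base C p q \<cdot> k'"
    and eq: "\<And>y s. square C p (tri_base C p q \<cdot> k) y s \<Longrightarrow> tri_ev p q y (k \<cdot> s) = tri_ev p q y (k' \<cdot> s)"
  shows "k = k'"
proof (rule pi_rep_unique[OF pi_rep_tri])
  note [simp] = p q tri_base k
  fix y s assume s: "square C p (tri_base C p q \<cdot> k) y s"
  have sk: "square C p (tri_base C p q) y (k \<cdot> s)" "square C p (tri_base C p q) y (k' \<cdot> s)"
    using squareD[OF s] by (simp_all add: square_def)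
  note [simp] = squareD(1-5)[OF s] overD(1-4)[OF pi_repD(3)[OF pi_rep_tri] sk(1)] overD(1-4)[OF pi_repD(3)[OF pi_rep_tri] sk(2)]
  show "Pi_eval p (prj2 C (tgt C q) (src C p)) y (k \<cdot> s) = Pi_eval p (prj2 C (tgt C q) (src C p)) y (k' \<cdot> s)"
    by (rule prod_eqI[of "tgt C q" "src C p"]) (use eq[OF s] in \<open>simp_all add: tri_ev_eq sk\<close>)
qed (use k p in auto)

text \<open>A map \<open>F\<close> to \<open>Q\<close> becomes a map over \<open>P\<^sub>*\<close>
  once it is paired with \<open>y\<close>; its transpose is the position
  \<open>(x, F)\<close>.\<close>

lemma tri_point:
  assumes x: "x \<in> arr C" "tgt C x = tgt C p" and F: "natural p x (tgt C q) F"
    and k: "k = tri_point C p q x (F (pb1 C p x) (pb2 C p x))"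
  shows "k \<in> arr C" "src C k = src C x" "tgt C k = src C (tri_base C p q)" "tri_base C p q \<cdot> k = x"
    "square C p x y s \<Longrightarrow> tri_ev p q y (k \<cdot> s) = F y s"
proof -
  note [simp] = p q x
  have *: "over p x (prj2 C (tgt C q) (src C p)) (\<lambda>y s. pair C (tgt C q) (src C p) (F y s) y)"
    unfolding over_def
  proof (intro allI impI)
    fix y s assume s: "square C p x y s"
    note [simp] = squareD(1-5)[OF s] naturalD[OF F s]
    let ?h = "pair C (tgt C q) (src C p) (F y s) y"
    show "?h \<in> arr C \<and> src C ?h = src C s \<and> tgt C ?h = src C (prj2 C (tgt C q) (src C p)) \<and>
      prj2 C (tgt C q) (src C p) \<cdot> ?h = y \<and>
      (\<forall>r\<in>arr C. tgt C r = src C s \<longrightarrow> ?h \<cdot> r = pair C (tgt C q) (src C p) (F (y \<cdot> r) (s \<cdot> r)) (y \<cdot> r))"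
      by simp
  qed
  note tr = Pi_transpose[OF p _ _ x *, folded tri_base_def, OF _ _ k[unfolded tri_point_def]]
  show 1: "k \<in> arr C" "src C k = src C x" "tgt C k = src C (tri_base C p q)" "tri_base C p q \<cdot> k = x"
    using tr(1-4) by simp_all
  assume s: "square C p x y s"
  note [simp] = squareD(1-5)[OF s] naturalD[OF F s] tri_base 1
  have "square C p (tri_base C p q) y (k \<cdot> s)" using squareD[OF s] by (simp add: square_def)
  from tri_ev_eq[OF this] show "tri_ev p q y (k \<cdot> s) = F y s"
    using tr(5)[OF _ _ s] by simp
qed

lemma tri: "tri C p q \<in> arr C" "src C (tri C p q) = src C (pb1 C (tri_eval C p q) q)"
    "tgt C (tri C p q) = src C (tri_base C p q)"
  using p q tri_base tri_eval by (simp_all add: tri_def)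

text \<open>Of the two composed projections, one is a base change of \<open>p\<close> along
  \<open>tri_base\<close>, the other a base change of \<open>q\<close> along
  \<open>tri_eval\<close>.\<close>

lemma exponentiable_tri: "exponentiable C (tri C p q)"
  unfolding tri_def using p q tri_base tri_eval
  by (intro exponentiable_cmp exponentiable_pb1 exponentiable_pb2) auto

lemma tri_dir:
  assumes pt: "tri_pt p q y \<tau> z"
  shows "tri_dir p q y \<tau> z \<in> arr C" "src C (tri_dir p q y \<tau> z) = src C \<tau>"
    "tgt C (tri_dir p q y \<tau> z) = src C (tri C p q)" "tri C p q \<cdot> tri_dir p q y \<tau> z = \<tau>"
    "pb1 C p (tri_base C p q) \<cdot> pb1 C (tri_eval C p q) q \<cdot> tri_dir p q y \<tau> z = y"
    "pb2 C (tri_eval C p q) q \<cdot> tri_dir p q y \<tau> z = z"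
    "r \<in> arr C \<Longrightarrow> tgt C r = src C \<tau> \<Longrightarrow> tri_dir p q y \<tau> z \<cdot> r = tri_dir p q (y \<cdot> r) (\<tau> \<cdot> r) (z \<cdot> r)"
proof -
  note y\<tau> = tri_ptD(1)[OF pt]
  note [simp] = p q tri_base tri_eval squareD(1-5)[OF y\<tau>] pb_pair[OF _ _ _ y\<tau>] tri_ptD(2-4)[OF pt]
  have sq: "square C (tri_eval C p q) q (pb_pair C p (tri_base C p q) y \<tau>) z"
    using tri_ptD(5)[OF pt] by (simp add: square_def tri_ev_def)
  note [simp] = pb_pair[OF _ _ _ sq] cmp_pb_pair[OF _ _ _ sq]
  show "tri_dir p q y \<tau> z \<in> arr C" "src C (tri_dir p q y \<tau> z) = src C \<tau>"
    "tgt C (tri_dir p q y \<tau> z) = src C (tri C p q)" "tri C p q \<cdot> tri_dir p q y \<tau> z = \<tau>"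
    "pb1 C p (tri_base C p q) \<cdot> pb1 C (tri_eval C p q) q \<cdot> tri_dir p q y \<tau> z = y"
    "pb2 C (tri_eval C p q) q \<cdot> tri_dir p q y \<tau> z = z"
    by (simp_all add: tri_dir_def tri_def)
  assume r [simp]: "r \<in> arr C" "tgt C r = src C \<tau>"
  show "tri_dir p q y \<tau> z \<cdot> r = tri_dir p q (y \<cdot> r) (\<tau> \<cdot> r) (z \<cdot> r)"
    using sq y\<tau> by (simp add: tri_dir_def pb_pair_cmp)
qed

text \<open>The domain of \<open>tri\<close> is an iterated pullback, so a direction is recovered
  from its components. Claims about arbitrary directions reduce to those of the form
  \<open>tri_dir\<close>.\<close>

lemma tri_decompose:
  assumes d: "d \<in> arr C" "tgt C d = src C (tri C p q)"
  defines "y \<equiv> pb1 C p (tri_base C p q) \<cdot> pb1 C (tri_eval C p q) q \<cdot> d"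
    and "z \<equiv> pb2 C (tri_eval C p q) q \<cdot> d"
  shows "tri_pt p q y (tri C p q \<cdot> d) z" "d = tri_dir p q y (tri C p q \<cdot> d) z"
proof -
  note [simp] = p q tri_base tri_eval tri d
  have y: "y = pb1 C p (tri_base C p q) \<cdot> (pb1 C (tri_eval C p q) q \<cdot> d)"
    and \<tau>: "tri C p q \<cdot> d = pb2 C p (tri_base C p q) \<cdot> (pb1 C (tri_eval C p q) q \<cdot> d)"
    by (simp_all add: y_def tri_def)
  have sq: "square C p (tri_base C p q) y (tri C p q \<cdot> d)"
    unfolding y \<tau> by (rule square_cmp) simp_all
  have [simp]: "pb_pair C p (tri_base C p q) y (tri C p q \<cdot> d) = pb1 C (tri_eval C p q) q \<cdot> d"
    unfolding y \<tau> by (subst pb_pair_cmp[symmetric]) simp_all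
  show "tri_pt p q y (tri C p q \<cdot> d) z"
    unfolding tri_pt_def tri_ev_def using sq by (simp add: z_def pb_commutes)
  show "d = tri_dir p q y (tri C p q \<cdot> d) z"
    unfolding tri_dir_def by (simp add: z_def pb_pair_cmp[symmetric])
qed

end

text \<open>The defining formulas \<open>tri_map_pos\<close> and \<open>tri_map_dir\<close> are
  values, at generic elements, of families given by the formulas for
  \<open>\<phi> \<triangleleft> \<psi>\<close> on elements. Recognizing them as such yields both
  well-definedness and the action on all elements.\<close>

lemma tri_map:
  assumes \<phi>: "\<phi> \<in> hom (Poly C) p p'" and \<psi>: "\<psi> \<in> hom (Poly C) q q'"
  defines "m \<equiv> on_pos (tri_map C \<phi> \<psi>)"
  shows "tri_map C \<phi> \<psi> \<in> hom (Poly C) (tri C p q) (tri C p' q')"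
    and "m \<in> arr C" "src C m = src C (tri_base C p q)" "tgt C m = src C (tri_base C p' q')"
    and "tri_base C p' q' \<cdot> m = on_pos \<phi> \<cdot> tri_base C p q"
    and "\<tau> \<in> arr C \<Longrightarrow> tgt C \<tau> = src C (tri_base C p q) \<Longrightarrow> square C p' (tri_base C p' q') y' (m \<cdot> \<tau>) \<Longrightarrow>
      square C p (tri_base C p q) (dir \<phi> (tri_base C p q \<cdot> \<tau>) y') \<tau> \<and>
      tri_ev p' q' y' (m \<cdot> \<tau>) = on_pos \<psi> \<cdot> tri_ev p q (dir \<phi> (tri_base C p q \<cdot> \<tau>) y') \<tau>"
    and "\<tau> \<in> arr C \<Longrightarrow> tgt C \<tau> = src C (tri_base C p q) \<Longrightarrow> tri_pt p' q' y' (m \<cdot> \<tau>) z' \<Longrightarrow>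
      y = dir \<phi> (tri_base C p q \<cdot> \<tau>) y' \<Longrightarrow> z = dir \<psi> (tri_ev p q y \<tau>) z' \<Longrightarrow>
      tri_pt p q y \<tau> z \<and> dir (tri_map C \<phi> \<psi>) \<tau> (tri_dir p' q' y' (m \<cdot> \<tau>) z') = tri_dir p q y \<tau> z"
proof -
  note [simp] = hom_PolyD(1-9)[OF \<phi>] hom_PolyD(1-9)[OF \<psi>]
  have pq: "exponentiable C p" "exponentiable C q" and pq': "exponentiable C p'" "exponentiable C q'" by simp_all
  note [simp] = tri_base[OF pq] tri_base[OF pq'] tri_eval[OF pq] tri_eval[OF pq'] tri[OF pq] tri[OF pq']
  let ?x = "tri_base C p q" and ?x' = "on_pos \<phi> \<cdot> tri_base C p q"
  \<comment> \<open>The component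
    \<open>\<psi>\<^sub>1 \<circ> f \<circ> \<phi>\<^sup>\<sharp>(x, -)\<close> of the image
    position, at an arbitrary element instead of the universal one.\<close>
  define F where "F y' \<tau> = on_pos \<psi> \<cdot> tri_ev p q (dir \<phi> (?x \<cdot> \<tau>) y') \<tau>" for y' \<tau>
  have sq\<phi>: "square C (on_pos \<phi>) p' (?x \<cdot> \<tau>) y'" if "square C p' ?x' y' \<tau>" for y' \<tau>
    using squareD[OF that] by (simp add: square_def)
  have sqx: "square C p ?x (dir \<phi> (?x \<cdot> \<tau>) y') \<tau>" if "square C p' ?x' y' \<tau>" for y' \<tau>
    using squareD[OF that] dir_hom[OF \<phi> sq\<phi>[OF that]] by (simp add: square_def)
  have F: "natural p' ?x' (tgt C q') F"
    unfolding natural_def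
  proof (intro allI impI)
    fix y' \<tau> assume s: "square C p' ?x' y' \<tau>"
    note [simp] = squareD(1-5)[OF s]
    show "F y' \<tau> \<in> arr C \<and> src C (F y' \<tau>) = src C \<tau> \<and> tgt C (F y' \<tau>) = tgt C q' \<and>
       (\<forall>r\<in>arr C. tgt C r = src C \<tau> \<longrightarrow> F y' \<tau> \<cdot> r = F (y' \<cdot> r) (\<tau> \<cdot> r))"
      unfolding F_def using tri_ev[OF pq sqx[OF s]] dir_hom[OF \<phi> sq\<phi>[OF s]] by (simp flip: assoc)
  qed
  let ?y' = "pb1 C p' ?x'" and ?\<tau> = "pb2 C p' ?x'"
  have sq: "square C p' ?x' ?y' ?\<tau>" by simp
  note sq\<phi>[OF sq, simp] sqx[OF sq, simp]
  note [simp] = pb_pair[OF _ _ _ sqx[OF sq]] pb_pair[OF _ _ _ sq\<phi>[OF sq]]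
  have m: "m = tri_point C p' q' ?x' (F ?y' ?\<tau>)"
    unfolding m_def tri_map_def tri_map_pos_def Let_def F_def tri_ev_def dir_def by simp
  note M = tri_point[OF pq' _ _ F m]
  show m1: "m \<in> arr C" "src C m = src C (tri_base C p q)" "tgt C m = src C (tri_base C p' q')" "tri_base C p' q' \<cdot> m = ?x'"
    using M(1-4) by simp_all
  note [simp] = m1(1-3)
  have sq': "square C p' ?x' y' \<tau>" if "\<tau> \<in> arr C" "tgt C \<tau> = src C (tri_base C p q)" "square C p' (tri_base C p' q') y' (m \<cdot> \<tau>)"
    for y' \<tau>
    using that squareD[OF that(3)] m1(4) by (simp add: square_def)
  have ev: "tri_ev p' q' y' (m \<cdot> \<tau>) = F y' \<tau>" if "square C p' ?x' y' \<tau>" for y' \<tau> using M(5)[OF _ _ that] by simp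
  show "square C p ?x (dir \<phi> (?x \<cdot> \<tau>) y') \<tau> \<and> tri_ev p' q' y' (m \<cdot> \<tau>) = on_pos \<psi> \<cdot> tri_ev p q (dir \<phi> (?x \<cdot> \<tau>) y') \<tau>"
    if "\<tau> \<in> arr C" "tgt C \<tau> = src C (tri_base C p q)" "square C p' (tri_base C p' q') y' (m \<cdot> \<tau>)"
    using ev[OF sq'[OF that]] sqx[OF sq'[OF that]] by (simp add: F_def)
  \<comment> \<open>The action on directions as a function of the components \<open>y'\<close> and
    \<open>z'\<close>; \<open>H\<close> below supplies the components of a direction
    \<open>d\<close>.\<close>
  define G where "G y' \<tau> z' = tri_dir p q (dir \<phi> (?x \<cdot> \<tau>) y') \<tau> (dir \<psi> (tri_ev p q (dir \<phi> (?x \<cdot> \<tau>) y') \<tau>) z')" for y' \<tau> z'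
  have sq\<psi>: "square C (on_pos \<psi>) q' (tri_ev p q (dir \<phi> (?x \<cdot> \<tau>) y') \<tau>) z'"
    if s: "square C p' ?x' y' \<tau>" and pt: "tri_pt p' q' y' (m \<cdot> \<tau>) z'" for y' \<tau> z'
    using tri_ev[OF pq sqx[OF s]] ev[OF s] tri_ptD[OF pt] squareD[OF s] by (simp add: square_def F_def)
  have pt: "tri_pt p q (dir \<phi> (?x \<cdot> \<tau>) y') \<tau> (dir \<psi> (tri_ev p q (dir \<phi> (?x \<cdot> \<tau>) y') \<tau>) z')"
    if s: "square C p' ?x' y' \<tau>" and pt: "tri_pt p' q' y' (m \<cdot> \<tau>) z'" for y' \<tau> z'
    using dir_hom[OF \<psi> sq\<psi>[OF s pt]] sqx[OF s] squareD[OF s] tri_ptD(2-4)[OF pt] by (simp add: tri_pt_def)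
  let ?y = "\<lambda>d. pb1 C p' (tri_base C p' q') \<cdot> pb1 C (tri_eval C p' q') q' \<cdot> d"
    and ?z = "\<lambda>d. pb2 C (tri_eval C p' q') q' \<cdot> d"
  define H where "H \<tau> d = G (?y d) \<tau> (?z d)" for \<tau> d
  have dec: "square C p' ?x' (?y d) \<tau>" "tri_pt p' q' (?y d) (m \<cdot> \<tau>) (?z d)" "d = tri_dir p' q' (?y d) (m \<cdot> \<tau>) (?z d)"
    if s: "square C m (tri C p' q') \<tau> d" for \<tau> d
  proof -
    note [simp] = squareD(1-5)[OF s]
    show pt: "tri_pt p' q' (?y d) (m \<cdot> \<tau>) (?z d)" "d = tri_dir p' q' (?y d) (m \<cdot> \<tau>) (?z d)"
      using tri_decompose[OF pq', of d] squareD(6)[OF s] by simp_all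
    show "square C p' ?x' (?y d) \<tau>"
      by (rule sq') (use tri_ptD(1)[OF pt(1)] in simp_all)
  qed
  have H: "over m (tri C p' q') (tri C p q) H"
    unfolding over_def
  proof (intro allI impI)
    fix \<tau> d assume s: "square C m (tri C p' q') \<tau> d"
    note [simp] = squareD(1-5)[OF s]
    note td = tri_dir[OF pq pt[OF dec(1,2)[OF s]], folded G_def, folded H_def]
    have "H \<tau> d \<cdot> r = H (\<tau> \<cdot> r) (d \<cdot> r)" if [simp]: "r \<in> arr C" "tgt C r = src C d" for r
      using td(7)[of r] dir_hom(5)[OF \<psi> sq\<psi>[OF dec(1,2)[OF s]], of r] tri_ev(4)[OF pq sqx[OF dec(1)[OF s]], of r]
        dir_hom(5)[OF \<phi> sq\<phi>[OF dec(1)[OF s]], of r]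
      by (simp add: H_def G_def)
    then show "H \<tau> d \<in> arr C \<and> src C (H \<tau> d) = src C d \<and> tgt C (H \<tau> d) = src C (tri C p q) \<and> tri C p q \<cdot> H \<tau> d = \<tau> \<and>
      (\<forall>r\<in>arr C. tgt C r = src C d \<longrightarrow> H \<tau> d \<cdot> r = H (\<tau> \<cdot> r) (d \<cdot> r))"
      using td(1-4) by simp
  qed
  have pos: "tri_map_pos C \<phi> \<psi> = m" by (simp add: m_def tri_map_def)
  have "tri_map_dir C \<phi> \<psi> = H (pb1 C m (tri C p' q')) (pb2 C m (tri C p' q'))"
    unfolding tri_map_dir_def Let_def H_def G_def tri_dir_def tri_ev_def dir_def pos by simp
  then have tm: "tri_map C \<phi> \<psi> = PolyMor (tri C p q) (tri C p' q') m (H (pb1 C m (tri C p' q')) (pb2 C m (tri C p' q')))"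
    by (simp add: tri_map_def pos)
  note mor = hom_PolyI[OF exponentiable_tri[OF pq] exponentiable_tri[OF pq'] _ _ _ H refl, folded tm]
  show "tri_map C \<phi> \<psi> \<in> hom (Poly C) (tri C p q) (tri C p' q')" by (rule mor) simp_all
  show "tri_pt p q y \<tau> z \<and> dir (tri_map C \<phi> \<psi>) \<tau> (tri_dir p' q' y' (m \<cdot> \<tau>) z') = tri_dir p q y \<tau> z"
    if \<tau> [simp]: "\<tau> \<in> arr C" "tgt C \<tau> = src C (tri_base C p q)" and pt': "tri_pt p' q' y' (m \<cdot> \<tau>) z'" and y: "y = dir \<phi> (?x \<cdot> \<tau>) y'"
      and z: "z = dir \<psi> (tri_ev p q y \<tau>) z'"
  proof
    have s: "square C p' ?x' y' \<tau>" by (rule sq'[OF \<tau> tri_ptD(1)[OF pt']])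
    show "tri_pt p q y \<tau> z" unfolding z y by (rule pt[OF s pt'])
    note [simp] = tri_dir(1-6)[OF pq' pt']
    have "square C m (tri C p' q') \<tau> (tri_dir p' q' y' (m \<cdot> \<tau>) z')" by (simp add: square_def)
    from mor(2)[OF _ _ _ this] show "dir (tri_map C \<phi> \<psi>) \<tau> (tri_dir p' q' y' (m \<cdot> \<tau>) z') = tri_dir p q y \<tau> z"
      by (simp add: H_def G_def y z)
  qed
qed

section \<open>The left coclosure\<close>

text \<open>For an element \<open>g = (y, k)\<close> of \<open>[q; p]\<^sub>*\<close>, \<open>br_pos q p g\<close> is \<open>y\<close> and, for a direction \<open>z\<close> of \<open>q\<close>
  at \<open>y\<close>, \<open>br_ev q p z g\<close> is \<open>k(z)\<close>.\<close>

definition br_pos :: "'a \<Rightarrow> 'a \<Rightarrow> 'a \<Rightarrow> 'a" where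
  "br_pos q p g = prj2 C (tgt C p) (tgt C q) \<cdot> (br_base C q p \<cdot> g)"

definition br_ev :: "'a \<Rightarrow> 'a \<Rightarrow> 'a \<Rightarrow> 'a \<Rightarrow> 'a" where
  "br_ev q p z g = br_eval C q p \<cdot> pb_pair C (br_exp C q p) (br_base C q p)
     (pair C (tgt C p) (src C q) (bracket C q p \<cdot> g) z) g"

definition br_pt :: "'a \<Rightarrow> 'a \<Rightarrow> 'a \<Rightarrow> 'a \<Rightarrow> bool" where
  "br_pt q p z g \<longleftrightarrow> g \<in> arr C \<and> tgt C g = src C (br_base C q p) \<and> z \<in> arr C \<and> src C z = src C g \<and>
     tgt C z = src C q \<and> q \<cdot> z = br_pos q p g"

lemma br_ptD:
  assumes "br_pt q p z g"
  shows "g \<in> arr C" "tgt C g = src C (br_base C q p)" "z \<in> arr C" "src C z = src C g" "tgt C z = src C q"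
    "q \<cdot> z = br_pos q p g"
  using assms by (auto simp: br_pt_def)

context
  fixes p q
  assumes p: "exponentiable C p" and q: "exponentiable C q"
begin

lemma br_exp: "exponentiable C (br_exp C q p)" "br_exp C q p \<in> arr C"
    "src C (br_exp C q p) = src C (prj1 C (tgt C p) (src C q))" "tgt C (br_exp C q p) = src C (prj1 C (tgt C p) (tgt C q))"
    "prj1 C (tgt C p) (tgt C q) \<cdot> br_exp C q p = prj1 C (tgt C p) (src C q)"
    "prj2 C (tgt C p) (tgt C q) \<cdot> br_exp C q p = q \<cdot> prj2 C (tgt C p) (src C q)"
  using p q exponentiable_idt_prod[of "tgt C p" q] prod_map[of "idt C (tgt C p)" q] unfolding br_exp_def by simp_all

lemma br_arg: "br_arg C q p \<in> arr C" "src C (br_arg C q p) = src C (prj1 C (src C p) (src C q))"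
    "tgt C (br_arg C q p) = src C (prj1 C (tgt C p) (src C q))"
    "prj1 C (tgt C p) (src C q) \<cdot> br_arg C q p = p \<cdot> prj1 C (src C p) (src C q)"
    "prj2 C (tgt C p) (src C q) \<cdot> br_arg C q p = prj2 C (src C p) (src C q)"
  using p q prod_map[of p "idt C (src C q)"] unfolding br_arg_def by simp_all

lemma pi_rep_br: "pi_rep (br_exp C q p) (br_arg C q p) (br_base C q p) (Pi_eval (br_exp C q p) (br_arg C q p))"
  unfolding br_base_def using br_exp br_arg by (intro pi_rep_Pi_eval) auto

lemma br_base: "br_base C q p \<in> arr C" "tgt C (br_base C q p) = src C (prj1 C (tgt C p) (tgt C q))"
  using pi_repD[OF pi_rep_br] br_exp by auto

lemma bracket: "bracket C q p \<in> arr C" "src C (bracket C q p) = src C (br_base C q p)" "tgt C (bracket C q p) = tgt C p"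
  using br_base p q by (simp_all add: bracket_def)

lemma br_pos:
  assumes "g \<in> arr C" "tgt C g = src C (br_base C q p)"
  shows "br_pos q p g \<in> arr C" "src C (br_pos q p g) = src C g" "tgt C (br_pos q p g) = tgt C q"
    "r \<in> arr C \<Longrightarrow> tgt C r = src C g \<Longrightarrow> br_pos q p g \<cdot> r = br_pos q p (g \<cdot> r)"
  using assms br_base p q by (simp_all add: br_pos_def)

lemma br_base_eq:
  assumes "g \<in> arr C" "tgt C g = src C (br_base C q p)"
  shows "br_base C q p \<cdot> g = pair C (tgt C p) (tgt C q) (bracket C q p \<cdot> g) (br_pos q p g)"
  by (rule prod_eqI[of "tgt C p" "tgt C q"]) (use assms br_base bracket br_pos[OF assms] p q in
    \<open>simp_all add: br_pos_def\<close>, simp add: bracket_def)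

text \<open>The \<open>P\<close> component of \<open>g\<close> together with \<open>z\<close> is an
  element of \<open>P \<times> Q\<^sub>*\<close> over the image of \<open>g\<close> in
  \<open>P \<times> Q\<close>, which is where evaluation for \<open>\<Pi>\<close> along
  \<open>id \<times> q\<close> is defined.\<close>

lemma br_pt_square:
  assumes pt: "br_pt q p z g"
  shows "square C (br_exp C q p) (br_base C q p) (pair C (tgt C p) (src C q) (bracket C q p \<cdot> g) z) g"
proof -
  note [simp] = p q br_exp(2-6) br_base bracket br_ptD(1-5)[OF pt] br_pos
  have "br_exp C q p \<cdot> pair C (tgt C p) (src C q) (bracket C q p \<cdot> g) z =
      pair C (tgt C p) (tgt C q) (bracket C q p \<cdot> g) (br_pos q p g)"
    by (rule prod_eqI[of "tgt C p" "tgt C q"]) (simp_all add: br_ptD(6)[OF pt])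
  then show ?thesis by (simp add: square_def br_base_eq)
qed

lemma br_ev_eq:
  assumes pt: "br_pt q p z g"
  shows "br_ev q p z g = prj1 C (src C p) (src C q) \<cdot>
    Pi_eval (br_exp C q p) (br_arg C q p) (pair C (tgt C p) (src C q) (bracket C q p \<cdot> g) z) g"
  using Pi_universal(3)[of "br_exp C q p" "br_arg C q p"] p q br_exp br_arg br_base
    pb_pair[OF _ _ _ br_pt_square[OF pt]]
  unfolding br_ev_def br_eval_def Pi_eval_def br_base_def[symmetric] by (auto simp: hom_iff)

lemma br_ev:
  assumes pt: "br_pt q p z g"
  shows "br_ev q p z g \<in> arr C" "src C (br_ev q p z g) = src C g" "tgt C (br_ev q p z g) = src C p"
    "p \<cdot> br_ev q p z g = bracket C q p \<cdot> g"
    "r \<in> arr C \<Longrightarrow> tgt C r = src C g \<Longrightarrow> br_pt q p (z \<cdot> r) (g \<cdot> r) \<and> br_ev q p z g \<cdot> r = br_ev q p (z \<cdot> r) (g \<cdot> r)"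
proof -
  let ?b = "pair C (tgt C p) (src C q) (bracket C q p \<cdot> g) z"
  note ev = overD[OF pi_repD(3)[OF pi_rep_br] br_pt_square[OF pt]]
  note [simp] = p q br_exp(2-6) br_arg br_base bracket br_ptD(1-5)[OF pt] br_pos ev(1-3)
  show "br_ev q p z g \<in> arr C" "src C (br_ev q p z g) = src C g" "tgt C (br_ev q p z g) = src C p"
    by (simp_all add: br_ev_eq[OF pt])
  \<comment> \<open>\<open>br_arg\<close> is \<open>p \<times> id\<close>, so \<open>p\<close> moves
    past the first projection, and then \<open>br_arg\<close> cancels the evaluation.\<close>
  have "p \<cdot> br_ev q p z g = prj1 C (tgt C p) (src C q) \<cdot> (br_arg C q p \<cdot> Pi_eval (br_exp C q p) (br_arg C q p) ?b g)"
    by (simp add: br_ev_eq[OF pt])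
  then show "p \<cdot> br_ev q p z g = bracket C q p \<cdot> g" unfolding ev(4) by simp
  assume r [simp]: "r \<in> arr C" "tgt C r = src C g"
  have pt': "br_pt q p (z \<cdot> r) (g \<cdot> r)"
    by (simp add: br_pt_def add: br_ptD(6)[OF pt])
  then show "br_pt q p (z \<cdot> r) (g \<cdot> r) \<and> br_ev q p z g \<cdot> r = br_ev q p (z \<cdot> r) (g \<cdot> r)"
    using ev(5)[of r] by (simp add: br_ev_eq[OF pt] br_ev_eq[OF pt'] flip: assoc)
qed

text \<open>Extensionality for the functions \<open>z \<mapsto> k(z)\<close>. Evaluation for
  \<open>\<Pi>\<close> takes values in \<open>P\<^sub>* \<times> Q\<^sub>*\<close>, but the second
  component of its value is \<open>z\<close> itself, so it is enough to compare
  \<open>br_ev\<close>.\<close>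

lemma br_unique:
  assumes k: "k \<in> arr C" "k' \<in> arr C" "src C k = src C k'" "tgt C k = src C (br_base C q p)" "tgt C k' = src C (br_base C q p)"
      "bracket C q p \<cdot> k = bracket C q p \<cdot> k'" "br_pos q p k = br_pos q p k'"
    and eq: "\<And>z s. s \<in> arr C \<Longrightarrow> tgt C s = src C k \<Longrightarrow> br_pt q p z (k \<cdot> s) \<Longrightarrow> br_pt q p z (k' \<cdot> s) \<Longrightarrow>
      br_ev q p z (k \<cdot> s) = br_ev q p z (k' \<cdot> s)"
  shows "k = k'"
proof (rule pi_rep_unique[OF pi_rep_br])
  note [simp] = p q br_exp(2-6) br_arg br_base bracket k(1-5) br_pos
  show "br_base C q p \<cdot> k = br_base C q p \<cdot> k'" using k(6,7) by (simp add: br_base_eq)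
  fix b s assume s: "square C (br_exp C q p) (br_base C q p \<cdot> k) b s"
  note [simp] = squareD(1-5)[OF s]
  let ?z = "prj2 C (tgt C p) (src C q) \<cdot> b"
  have bk: "bracket C q p \<cdot> k \<cdot> s = bracket C q p \<cdot> k' \<cdot> s" using k(6) by simp
  have pk: "br_pos q p (k \<cdot> s) = br_pos q p (k' \<cdot> s)" using k(7) br_pos(4)[of k s] br_pos(4)[of k' s] by simp
  have base: "br_base C q p \<cdot> k \<cdot> s = pair C (tgt C p) (tgt C q) (bracket C q p \<cdot> k \<cdot> s) (br_pos q p (k \<cdot> s))"
    using br_base_eq[of "k \<cdot> s"] by simp
  have "prj1 C (tgt C p) (tgt C q) \<cdot> (br_exp C q p \<cdot> b) = prj1 C (tgt C p) (tgt C q) \<cdot> (br_base C q p \<cdot> k \<cdot> s)"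
    "prj2 C (tgt C p) (tgt C q) \<cdot> (br_exp C q p \<cdot> b) = prj2 C (tgt C p) (tgt C q) \<cdot> (br_base C q p \<cdot> k \<cdot> s)"
    using squareD(6)[OF s] by simp_all
  then have b1: "prj1 C (tgt C p) (src C q) \<cdot> b = bracket C q p \<cdot> k \<cdot> s" and b2: "q \<cdot> ?z = br_pos q p (k \<cdot> s)"
    unfolding base by simp_all
  \<comment> \<open>The first component of a test element of \<open>P \<times> Q\<^sub>*\<close> is
    forced by the stage, so only \<open>?z\<close> varies.\<close>
  have b: "b = pair C (tgt C p) (src C q) (bracket C q p \<cdot> k \<cdot> s) ?z"
    by (rule prod_eqI[of "tgt C p" "src C q"]) (simp_all add: b1)
  have pt: "br_pt q p ?z (k \<cdot> s)" "br_pt q p ?z (k' \<cdot> s)"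
    by (use b2 pk in \<open>simp_all add: br_pt_def\<close>)
  let ?e = "Pi_eval (br_exp C q p) (br_arg C q p) b"
  have sq: "square C (br_exp C q p) (br_base C q p) b (k \<cdot> s)" "square C (br_exp C q p) (br_base C q p) b (k' \<cdot> s)"
    using br_pt_square[OF pt(1)] br_pt_square[OF pt(2)] b bk by simp_all
  note ev1 [simp] = overD(1-4)[OF pi_repD(3)[OF pi_rep_br] sq(1)] and ev2 [simp] = overD(1-4)[OF pi_repD(3)[OF pi_rep_br] sq(2)]
  have 1: "prj2 C (src C p) (src C q) \<cdot> ?e (k \<cdot> s) = ?z"
    using assoc[of "?e (k \<cdot> s)" "br_arg C q p" "prj2 C (tgt C p) (src C q)"] by simp
  have 2: "prj2 C (src C p) (src C q) \<cdot> ?e (k' \<cdot> s) = ?z"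
    using assoc[of "?e (k' \<cdot> s)" "br_arg C q p" "prj2 C (tgt C p) (src C q)"] by simp
  show "?e (k \<cdot> s) = ?e (k' \<cdot> s)"
    by (rule prod_eqI[of "src C p" "src C q"])
      (use eq[OF _ _ pt] b bk in \<open>simp_all add: 1 2 br_ev_eq[OF pt(1)] br_ev_eq[OF pt(2)]\<close>)
qed (use k br_exp in auto)

text \<open>Paired with \<open>z\<close>, the function \<open>K\<close> becomes a map over
  \<open>P \<times> Q\<^sub>*\<close>, and its transpose is the element \<open>(f, K)\<close> over
  \<open>t\<close>. Squares over \<open>id \<times> q\<close> are traded for squares over
  \<open>q\<close> and \<open>f\<close>, since their \<open>P\<close> component is determined by
  \<open>t\<close>.\<close>

lemma br_point:
  assumes t: "t \<in> arr C" "tgt C t = tgt C p" "f \<in> arr C" "tgt C f = tgt C q" "src C t = src C f"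
    and K: "natural q f (src C p) K" "\<And>z s. square C q f z s \<Longrightarrow> p \<cdot> K z s = t \<cdot> s"
  defines "b \<equiv> pair C (tgt C p) (tgt C q) t f"
  defines "z \<equiv> prj2 C (tgt C p) (src C q) \<cdot> pb1 C (br_exp C q p) b" and "s \<equiv> pb2 C (br_exp C q p) b"
  assumes g: "g = Pi_transpose C (br_exp C q p) b (br_arg C q p) (pair C (src C p) (src C q) (K z s) z)"
  shows "g \<in> arr C" "src C g = src C t" "tgt C g = src C (br_base C q p)" "bracket C q p \<cdot> g = t" "br_pos q p g = f"
    "square C q f z' s' \<Longrightarrow> br_pt q p z' (g \<cdot> s') \<and> br_ev q p z' (g \<cdot> s') = K z' s'"
proof -
  note [simp] = p q br_exp(2-6) br_arg br_base bracket t br_pos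
  define H where "H c s = pair C (src C p) (src C q) (K (prj2 C (tgt C p) (src C q) \<cdot> c) s) (prj2 C (tgt C p) (src C q) \<cdot> c)" for c s
  have b [simp]: "b \<in> arr C" "src C b = src C t" "tgt C b = src C (prj1 C (tgt C p) (tgt C q))" by (simp_all add: b_def)
  have comp: "prj1 C (tgt C p) (src C q) \<cdot> c = t \<cdot> s" "square C q f (prj2 C (tgt C p) (src C q) \<cdot> c) s"
    if c: "square C (br_exp C q p) b c s" for c s
  proof -
    note [simp] = squareD(1-5)[OF c]
    have "prj1 C (tgt C p) (tgt C q) \<cdot> (br_exp C q p \<cdot> c) = prj1 C (tgt C p) (tgt C q) \<cdot> (b \<cdot> s)"
      "prj2 C (tgt C p) (tgt C q) \<cdot> (br_exp C q p \<cdot> c) = prj2 C (tgt C p) (tgt C q) \<cdot> (b \<cdot> s)"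
      using squareD(6)[OF c] by simp_all
    then show "prj1 C (tgt C p) (src C q) \<cdot> c = t \<cdot> s" "square C q f (prj2 C (tgt C p) (src C q) \<cdot> c) s"
      by (simp_all add: b_def square_def)
  qed
  have *: "over (br_exp C q p) b (br_arg C q p) H"
    unfolding over_def
  proof (intro allI impI)
    fix c s assume c: "square C (br_exp C q p) b c s"
    note [simp] = squareD(1-5)[OF c] naturalD[OF K(1) comp(2)[OF c]] K(2)[OF comp(2)[OF c]]
    have "br_arg C q p \<cdot> H c s = c"
      by (rule prod_eqI[of "tgt C p" "src C q"]) (simp_all add: H_def comp(1)[OF c])
    then show "H c s \<in> arr C \<and> src C (H c s) = src C s \<and> tgt C (H c s) = src C (br_arg C q p) \<and>
      br_arg C q p \<cdot> H c s = c \<and> (\<forall>r\<in>arr C. tgt C r = src C s \<longrightarrow> H c s \<cdot> r = H (c \<cdot> r) (s \<cdot> r))"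
      by (simp add: H_def)
  qed
  have g': "g = Pi_transpose C (br_exp C q p) b (br_arg C q p) (H (pb1 C (br_exp C q p) b) (pb2 C (br_exp C q p) b))"
    unfolding g H_def z_def s_def ..
  note tr = Pi_transpose[OF br_exp(1) _ _ _ _ * g', folded br_base_def]
  show g1: "g \<in> arr C" "src C g = src C t" "tgt C g = src C (br_base C q p)" using tr(1-3) by simp_all
  note [simp] = g1
  have base: "br_base C q p \<cdot> g = b" using tr(4) by simp
  show 1: "bracket C q p \<cdot> g = t" using base assoc[of g "br_base C q p" "prj1 C (tgt C p) (tgt C q)"]
    by (simp add: bracket_def b_def)
  show 2: "br_pos q p g = f" using base by (simp add: br_pos_def b_def)
  assume s: "square C q f z' s'"
  note [simp] = squareD(1-5)[OF s] naturalD[OF K(1) s]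
  have pt: "br_pt q p z' (g \<cdot> s')"
    by (unfold br_pt_def) (use squareD(6)[OF s] br_pos(4)[of g s'] 2 in simp_all)
  let ?c = "pair C (tgt C p) (src C q) (bracket C q p \<cdot> (g \<cdot> s')) z'"
  have c: "square C (br_exp C q p) b ?c s'"
    using br_pt_square[OF pt] base by (simp add: square_def)
  show "br_pt q p z' (g \<cdot> s') \<and> br_ev q p z' (g \<cdot> s') = K z' s'"
    using tr(5)[OF _ _ _ _ c] pt by (simp add: br_ev_eq[OF pt] H_def)
qed

end

text \<open>\<open>br_map_dir\<close> is a transpose at the generic element. Extended to arbitrary
  elements as \<open>G\<close>, it is described by its position and its evaluations, and these
  determine it.\<close>

lemma br_map:
  assumes \<phi>: "\<phi> \<in> hom (Poly C) p' p" and \<psi>: "\<psi> \<in> hom (Poly C) q q'"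
    and ex: "exponentiable C (bracket C q p)" and ex': "exponentiable C (bracket C q' p')"
  shows "br_map C \<psi> \<phi> \<in> hom (Poly C) (bracket C q' p') (bracket C q p)" "on_pos (br_map C \<psi> \<phi>) = on_pos \<phi>"
    and "square C (on_pos \<phi>) (bracket C q p) t g \<Longrightarrow> br_pos q' p' (dir (br_map C \<psi> \<phi>) t g) = on_pos \<psi> \<cdot> br_pos q p g"
    and "square C (on_pos \<phi>) (bracket C q p) t g \<Longrightarrow> br_pt q' p' z' (dir (br_map C \<psi> \<phi>) t g) \<Longrightarrow>
       z = dir \<psi> (br_pos q p g) z' \<Longrightarrow>
       br_pt q p z g \<and> br_ev q' p' z' (dir (br_map C \<psi> \<phi>) t g) = dir \<phi> t (br_ev q p z g)"
proof -
  note [simp] = hom_PolyD(1-9)[OF \<phi>] hom_PolyD(1-9)[OF \<psi>]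
  have pq: "exponentiable C p" "exponentiable C q" and pq': "exponentiable C p'" "exponentiable C q'" by simp_all
  note [simp] = br_exp(2-6)[OF pq'] bracket[OF pq] bracket[OF pq'] br_base[OF pq] br_base[OF pq'] br_pos[OF pq] br_pos[OF pq']
  show "on_pos (br_map C \<psi> \<phi>) = on_pos \<phi>" by (simp add: br_map_def)
  define f where "f g = on_pos \<psi> \<cdot> br_pos q p g" for g
  define K where "K t g z' s = dir \<phi> (t \<cdot> s) (br_ev q p (dir \<psi> (br_pos q p (g \<cdot> s)) z') (g \<cdot> s))" for t g z' s
  define G where "G t g = (let b = pair C (tgt C p') (tgt C q') t (f g);
     z = prj2 C (tgt C p') (src C q') \<cdot> pb1 C (br_exp C q' p') b; s = pb2 C (br_exp C q' p') b
     in Pi_transpose C (br_exp C q' p') b (br_arg C q' p') (pair C (src C p') (src C q') (K t g z s) z))" for t g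
  have sq\<psi>: "square C (on_pos \<psi>) q' (br_pos q p (g \<cdot> s)) z'" and
      pt: "br_pt q p (dir \<psi> (br_pos q p (g \<cdot> s)) z') (g \<cdot> s)" and
      sq\<phi>: "square C (on_pos \<phi>) p (t \<cdot> s) (br_ev q p (dir \<psi> (br_pos q p (g \<cdot> s)) z') (g \<cdot> s))"
    if tg: "square C (on_pos \<phi>) (bracket C q p) t g" and s: "square C q' (f g) z' s" for t g z' s
  proof -
    note [simp] = squareD(1-5)[OF tg]
    have fg [simp]: "f g \<in> arr C" "src C (f g) = src C g" "tgt C (f g) = tgt C q'" by (simp_all add: f_def)
    note [simp] = squareD(1-5)[OF s]
    have "on_pos \<psi> \<cdot> (br_pos q p g \<cdot> s) = q' \<cdot> z'" using squareD(6)[OF s] by (simp add: f_def flip: assoc)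
    then show sq\<psi>: "square C (on_pos \<psi>) q' (br_pos q p (g \<cdot> s)) z'" by (simp add: square_def)
    note [simp] = dir_hom[OF \<psi> sq\<psi>]
    show pt: "br_pt q p (dir \<psi> (br_pos q p (g \<cdot> s)) z') (g \<cdot> s)" by (simp add: br_pt_def)
    show "square C (on_pos \<phi>) p (t \<cdot> s) (br_ev q p (dir \<psi> (br_pos q p (g \<cdot> s)) z') (g \<cdot> s))"
      using br_ev[OF pq pt] squareD(6)[OF tg] by (simp add: square_def)
  qed
  have K: "natural q' (f g) (src C p') (K t g)" "\<And>z s. square C q' (f g) z s \<Longrightarrow> p' \<cdot> K t g z s = t \<cdot> s"
    if tg: "square C (on_pos \<phi>) (bracket C q p) t g" for t g
  proof -
    note [simp] = squareD(1-5)[OF tg]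
    have fg [simp]: "f g \<in> arr C" "src C (f g) = src C g" "tgt C (f g) = tgt C q'" by (simp_all add: f_def)
    show "natural q' (f g) (src C p') (K t g)"
      unfolding natural_def
    proof (intro allI impI)
      fix z s assume s: "square C q' (f g) z s"
      note [simp] = squareD(1-5)[OF s] dir_hom(1-3)[OF \<phi> sq\<phi>[OF tg s]] br_ev(1-3)[OF pq pt[OF tg s]] dir_hom(1-3)[OF \<psi> sq\<psi>[OF tg s]]
      have "K t g z s \<cdot> r = K t g (z \<cdot> r) (s \<cdot> r)" if [simp]: "r \<in> arr C" "tgt C r = src C s" for r
        using dir_hom(5)[OF \<phi> sq\<phi>[OF tg s], of r] br_ev(5)[OF pq pt[OF tg s], of r] dir_hom(5)[OF \<psi> sq\<psi>[OF tg s], of r]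
        by (simp add: K_def)
      then show "K t g z s \<in> arr C \<and> src C (K t g z s) = src C s \<and> tgt C (K t g z s) = src C p' \<and>
         (\<forall>r\<in>arr C. tgt C r = src C s \<longrightarrow> K t g z s \<cdot> r = K t g (z \<cdot> r) (s \<cdot> r))" by (simp add: K_def)
    qed
    show "p' \<cdot> K t g z s = t \<cdot> s" if s: "square C q' (f g) z s" for z s
      unfolding K_def by (rule dir_hom(4)[OF \<phi> sq\<phi>[OF tg s]])
  qed
  have G: "G t g \<in> arr C" "src C (G t g) = src C t" "tgt C (G t g) = src C (br_base C q' p')" "bracket C q' p' \<cdot> G t g = t"
     "br_pos q' p' (G t g) = f g"
     "\<And>z' s'. square C q' (f g) z' s' \<Longrightarrow> br_pt q' p' z' (G t g \<cdot> s') \<and> br_ev q' p' z' (G t g \<cdot> s') = K t g z' s'"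
    if tg: "square C (on_pos \<phi>) (bracket C q p) t g" for t g
  proof -
    note [simp] = squareD(1-5)[OF tg]
    have fg [simp]: "f g \<in> arr C" "src C (f g) = src C g" "tgt C (f g) = tgt C q'" by (simp_all add: f_def)
    note pt = br_point[OF pq' _ _ _ _ _ K[OF tg], of "G t g"]
    show "G t g \<in> arr C" "src C (G t g) = src C t" "tgt C (G t g) = src C (br_base C q' p')" "bracket C q' p' \<cdot> G t g = t"
     "br_pos q' p' (G t g) = f g"
     "\<And>z' s'. square C q' (f g) z' s' \<Longrightarrow> br_pt q' p' z' (G t g \<cdot> s') \<and> br_ev q' p' z' (G t g \<cdot> s') = K t g z' s'"
      by (rule pt; simp add: G_def Let_def)+
  qed
  have H: "over (on_pos \<phi>) (bracket C q p) (bracket C q' p') G"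
    unfolding over_def
  proof (intro allI impI)
    fix t g assume tg: "square C (on_pos \<phi>) (bracket C q p) t g"
    note [simp] = squareD(1-5)[OF tg] G(1-5)[OF tg]
    have fg [simp]: "f g \<in> arr C" "src C (f g) = src C g" "tgt C (f g) = tgt C q'" by (simp_all add: f_def)
    \<comment> \<open>The two sides are built from transposes over different chosen pullbacks, so
      they are compared through their evaluations.\<close>
    have "G t g \<cdot> r = G (t \<cdot> r) (g \<cdot> r)" if [simp]: "r \<in> arr C" "tgt C r = src C g" for r
    proof (rule br_unique[OF pq'])
      have tgr: "square C (on_pos \<phi>) (bracket C q p) (t \<cdot> r) (g \<cdot> r)" using tg by (intro square_cmp) auto
      have fgr: "f g \<cdot> r = f (g \<cdot> r)" by (simp add: f_def flip: assoc)
      note [simp] = G(1-5)[OF tgr]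
      show "G t g \<cdot> r \<in> arr C" "G (t \<cdot> r) (g \<cdot> r) \<in> arr C" "src C (G t g \<cdot> r) = src C (G (t \<cdot> r) (g \<cdot> r))"
        "tgt C (G t g \<cdot> r) = src C (br_base C q' p')" "tgt C (G (t \<cdot> r) (g \<cdot> r)) = src C (br_base C q' p')"
        "bracket C q' p' \<cdot> (G t g \<cdot> r) = bracket C q' p' \<cdot> G (t \<cdot> r) (g \<cdot> r)" by simp_all
      show "br_pos q' p' (G t g \<cdot> r) = br_pos q' p' (G (t \<cdot> r) (g \<cdot> r))"
        using br_pos(4)[OF pq', of "G t g" r] fgr by simp
      fix z s assume [simp]: "s \<in> arr C" "tgt C s = src C (G t g \<cdot> r)" and pt: "br_pt q' p' z (G t g \<cdot> r \<cdot> s)"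
      have [simp]: "tgt C s = src C r" using \<open>tgt C s = _\<close> by simp
      have "br_pos q' p' (G t g \<cdot> r \<cdot> s) = f g \<cdot> r \<cdot> s" using br_pos(4)[OF pq', of "G t g" "r \<cdot> s"] by simp
      then have s1: "square C q' (f g) z (r \<cdot> s)" and s2: "square C q' (f (g \<cdot> r)) z s"
        using br_ptD[OF pt] by (simp_all add: square_def flip: fgr)
      show "br_ev q' p' z (G t g \<cdot> r \<cdot> s) = br_ev q' p' z (G (t \<cdot> r) (g \<cdot> r) \<cdot> s)"
        using G(6)[OF tg s1] G(6)[OF tgr s2] by (simp add: K_def)
    qed
    then show "G t g \<in> arr C \<and> src C (G t g) = src C g \<and> tgt C (G t g) = src C (bracket C q' p') \<and> bracket C q' p' \<cdot> G t g = t \<and>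
      (\<forall>r\<in>arr C. tgt C r = src C g \<longrightarrow> G t g \<cdot> r = G (t \<cdot> r) (g \<cdot> r))" by simp
  qed
  have "br_map_dir C \<psi> \<phi> = G (pb1 C (on_pos \<phi>) (bracket C q p)) (pb2 C (on_pos \<phi>) (bracket C q p))"
  proof -
    have tg: "square C (on_pos \<phi>) (bracket C q p) (pb1 C (on_pos \<phi>) (bracket C q p)) (pb2 C (on_pos \<phi>) (bracket C q p))" by simp
    let ?t = "pb1 C (on_pos \<phi>) (bracket C q p)" and ?g = "pb2 C (on_pos \<phi>) (bracket C q p)"
    have fg [simp]: "f ?g \<in> arr C" "src C (f ?g) = src C ?t" "tgt C (f ?g) = tgt C q'" by (simp_all add: f_def)
    let ?b = "pair C (tgt C p') (tgt C q') ?t (f ?g)"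
    let ?d = "pb2 C (br_exp C q' p') ?b"
    \<comment> \<open>The \<open>P\<close> component of the test element is expressed through
      \<open>\<phi>\<^sub>1\<close> in \<open>br_map_dir\<close> and through \<open>bracket\<close>
      in \<open>br_ev\<close>; the pullback square identifies the two.\<close>
    have "on_pos \<phi> \<cdot> (?t \<cdot> ?d) = bracket C q p \<cdot> (?g \<cdot> ?d)" using squareD(6)[OF tg] by simp
    moreover have "prj2 C (tgt C p) (tgt C q) \<cdot> (br_base C q p \<cdot> ?g) \<cdot> ?d = br_pos q p (?g \<cdot> ?d)"
      using br_pos(4)[OF pq, of ?g ?d] by (simp add: br_pos_def)
    ultimately show ?thesis
      unfolding br_map_dir_def G_def K_def Let_def f_def br_ev_def
      by (simp add: dir_def br_pos_def)
  qed
  then have bm: "br_map C \<psi> \<phi> = PolyMor (bracket C q' p') (bracket C q p) (on_pos \<phi>)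
      (G (pb1 C (on_pos \<phi>) (bracket C q p)) (pb2 C (on_pos \<phi>) (bracket C q p)))"
    by (simp add: br_map_def)
  note mor = hom_PolyI[OF ex' ex _ _ _ H refl, folded bm]
  show "br_map C \<psi> \<phi> \<in> hom (Poly C) (bracket C q' p') (bracket C q p)" by (rule mor) simp_all
  assume tg: "square C (on_pos \<phi>) (bracket C q p) t g"
  have dir: "dir (br_map C \<psi> \<phi>) t g = G t g" using mor(2)[OF _ _ _ tg] by simp
  show "br_pos q' p' (dir (br_map C \<psi> \<phi>) t g) = on_pos \<psi> \<cdot> br_pos q p g"
    using G(5)[OF tg] by (simp add: dir f_def)
  assume z': "br_pt q' p' z' (dir (br_map C \<psi> \<phi>) t g)" and z: "z = dir \<psi> (br_pos q p g) z'"
  note [simp] = squareD(1-5)[OF tg] G(1-5)[OF tg]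
  have fg [simp]: "f g \<in> arr C" "src C (f g) = src C g" "tgt C (f g) = tgt C q'" by (simp_all add: f_def)
  \<comment> \<open>\<open>G(6)\<close> describes evaluation after a change of stage; the identity
    stage gives evaluation of \<open>G t g\<close> itself.\<close>
  have s: "square C q' (f g) z' (idt C (src C g))"
    using br_ptD[OF z'] by (simp add: square_def dir)
  show "br_pt q p z g \<and> br_ev q' p' z' (dir (br_map C \<psi> \<phi>) t g) = dir \<phi> t (br_ev q p z g)"
    using pt[OF tg s] G(6)[OF tg s] by (simp add: dir K_def z)
qed

section \<open>The bijection\<close>

text \<open>Squares for \<open>\<Pi>\<^sub>r\<close> list the direction first, those for morphisms
  of polynomials the position first; the bijection has to pass between the two conventions.\<close>

lemma square_sym: "square C f g x y \<longleftrightarrow> square C g f y x"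
  by (auto simp: square_def)

text \<open>A morphism \<open>p \<rightarrow> r \<triangleleft> q\<close> and a morphism \<open>[q; p] \<rightarrow> r\<close> both amount to a map \<open>x : P \<rightarrow> R\<close>, a map
  \<open>(t, y) \<mapsto> f\<^sub>t(y) \<in> Q\<close>, and a map \<open>(t, y, z) \<mapsto> e \<in> P\<^sub>*\<close> over \<open>t\<close>, where \<open>y\<close> is a direction of \<open>r\<close>
  at \<open>x(t)\<close> and \<open>z\<close> one of \<open>q\<close> at \<open>f\<^sub>t(y)\<close>. The relation says that these data agree.\<close>

definition transposes :: "'a \<Rightarrow> 'a \<Rightarrow> 'a \<Rightarrow> 'a poly_mor \<Rightarrow> 'a poly_mor \<Rightarrow> bool" where
  "transposes p q r \<alpha> \<beta> \<longleftrightarrow> on_pos \<beta> = tri_base C r q \<cdot> on_pos \<alpha> \<and>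
     (\<forall>t y. square C (on_pos \<beta>) r t y \<longrightarrow>
        br_pos q p (dir \<beta> t y) = tri_ev r q y (on_pos \<alpha> \<cdot> t) \<and>
        (\<forall>z. tri_pt r q y (on_pos \<alpha> \<cdot> t) z \<longrightarrow>
           br_ev q p z (dir \<beta> t y) = dir \<alpha> t (tri_dir r q y (on_pos \<alpha> \<cdot> t) z)))"

lemma transposesD:
  assumes "transposes p q r \<alpha> \<beta>"
  shows "on_pos \<beta> = tri_base C r q \<cdot> on_pos \<alpha>"
    "square C (on_pos \<beta>) r t y \<Longrightarrow> br_pos q p (dir \<beta> t y) = tri_ev r q y (on_pos \<alpha> \<cdot> t)"
    "square C (on_pos \<beta>) r t y \<Longrightarrow> tri_pt r q y (on_pos \<alpha> \<cdot> t) z \<Longrightarrow>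
       br_ev q p z (dir \<beta> t y) = dir \<alpha> t (tri_dir r q y (on_pos \<alpha> \<cdot> t) z)"
  using assms by (auto simp: transposes_def)

text \<open>An element of \<open>[q; p]\<^sub>*\<close> over \<open>t\<close> is determined by its
  position in \<open>q\<close> and its values, and the relation prescribes both from
  \<open>\<alpha>\<close>.\<close>

lemma transposes_unique_right:
  assumes p: "exponentiable C p" and q: "exponentiable C q" and r: "exponentiable C r"
    and \<alpha>: "\<alpha> \<in> hom (Poly C) p (tri C r q)"
    and \<beta>: "\<beta> \<in> hom (Poly C) (bracket C q p) r" "\<beta>' \<in> hom (Poly C) (bracket C q p) r"
    and tr: "transposes p q r \<alpha> \<beta>" "transposes p q r \<alpha> \<beta>'"
  shows "\<beta> = \<beta>'"
proof (rule hom_Poly_eqI[OF \<beta>])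
  note [simp] = bracket[OF p q] br_base[OF p q] tri_base[OF r q] tri[OF r q] br_pos[OF p q]
    hom_PolyD(5-9)[OF \<alpha>] hom_PolyD(5-9)[OF \<beta>(1)] hom_PolyD(5-9)[OF \<beta>(2)]
  show pos: "on_pos \<beta> = on_pos \<beta>'" using transposesD(1)[OF tr(1)] transposesD(1)[OF tr(2)] by simp
  fix t y assume ty: "square C (on_pos \<beta>) r t y"
  have ty': "square C (on_pos \<beta>') r t y" using ty pos by simp
  note [simp] = squareD(1-5)[OF ty] dir_hom(1-3)[OF \<beta>(1) ty] dir_hom(1-3)[OF \<beta>(2) ty']
  show "dir \<beta> t y = dir \<beta>' t y"
  proof (rule br_unique[OF p q])
    show "bracket C q p \<cdot> dir \<beta> t y = bracket C q p \<cdot> dir \<beta>' t y"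
      using dir_hom(4)[OF \<beta>(1) ty] dir_hom(4)[OF \<beta>(2) ty'] by simp
    show "br_pos q p (dir \<beta> t y) = br_pos q p (dir \<beta>' t y)"
      using transposesD(2)[OF tr(1) ty] transposesD(2)[OF tr(2) ty'] by simp
    fix z s assume s [simp]: "s \<in> arr C" "tgt C s = src C (dir \<beta> t y)" and pt: "br_pt q p z (dir \<beta> t y \<cdot> s)"
    have [simp]: "tgt C s = src C y" using s by simp
    have sq: "square C (on_pos \<beta>) r (t \<cdot> s) (y \<cdot> s)" by (rule square_cmp[OF ty]) simp_all
    have sq': "square C (on_pos \<beta>') r (t \<cdot> s) (y \<cdot> s)" using sq pos by simp
    have eq: "dir \<beta> t y \<cdot> s = dir \<beta> (t \<cdot> s) (y \<cdot> s)" "dir \<beta>' t y \<cdot> s = dir \<beta>' (t \<cdot> s) (y \<cdot> s)"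
      using dir_hom(5)[OF \<beta>(1) ty, of s] dir_hom(5)[OF \<beta>(2) ty', of s] by simp_all
    \<comment> \<open>The relation identifies the position of \<open>\<beta>\<^sup>\<sharp>\<close>
      with the one that \<open>\<alpha>\<close> assigns to \<open>y \<cdot> s\<close>, so the test
      element \<open>z\<close> is a direction of \<open>q\<close> there and the clause on values
      applies.\<close>
    have "tri_pt r q (y \<cdot> s) (on_pos \<alpha> \<cdot> (t \<cdot> s)) z"
      using br_ptD[OF pt] transposesD(2)[OF tr(1) sq] squareD(6)[OF sq] transposesD(1)[OF tr(1)]
      dir_hom(1-3)[OF \<beta>(1) sq] by (simp add: tri_pt_def square_def eq)
    then show "br_ev q p z (dir \<beta> t y \<cdot> s) = br_ev q p z (dir \<beta>' t y \<cdot> s)"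
      using transposesD(3)[OF tr(1) sq] transposesD(3)[OF tr(2) sq'] by (simp add: eq)
  qed simp_all
qed

text \<open>Positions of \<open>r \<triangleleft> q\<close> are determined by their base and
  \<open>tri_ev\<close>, both of which the relation expresses through \<open>\<beta>\<close>. A
  direction splits as \<open>(y, z)\<close>, and at such a pair the relation gives the value of
  \<open>\<alpha>\<close>.\<close>

lemma transposes_unique_left:
  assumes p: "exponentiable C p" and q: "exponentiable C q" and r: "exponentiable C r"
    and \<beta>: "\<beta> \<in> hom (Poly C) (bracket C q p) r"
    and \<alpha>: "\<alpha> \<in> hom (Poly C) p (tri C r q)" "\<alpha>' \<in> hom (Poly C) p (tri C r q)"
    and tr: "transposes p q r \<alpha> \<beta>" "transposes p q r \<alpha>' \<beta>"
  shows "\<alpha> = \<alpha>'"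
proof (rule hom_Poly_eqI[OF \<alpha>])
  note [simp] = bracket[OF p q] br_base[OF p q] tri_base[OF r q] tri[OF r q] br_pos[OF p q]
    hom_PolyD(5-9)[OF \<beta>] hom_PolyD(5-9)[OF \<alpha>(1)] hom_PolyD(5-9)[OF \<alpha>(2)]
  note base = transposesD(1)[OF tr(1)] transposesD(1)[OF tr(2)]
  show pos: "on_pos \<alpha> = on_pos \<alpha>'"
  proof (rule tri_unique[OF r q])
    show "tri_base C r q \<cdot> on_pos \<alpha> = tri_base C r q \<cdot> on_pos \<alpha>'" using base by simp
    fix y s assume "square C r (tri_base C r q \<cdot> on_pos \<alpha>) y s"
    then have "square C (on_pos \<beta>) r s y" by (simp add: square_sym[of r] flip: base(1))
    then show "tri_ev r q y (on_pos \<alpha> \<cdot> s) = tri_ev r q y (on_pos \<alpha>' \<cdot> s)"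
      using transposesD(2)[OF tr(1)] transposesD(2)[OF tr(2)] by metis
  qed simp_all
  fix t d assume td: "square C (on_pos \<alpha>) (tri C r q) t d"
  note [simp] = squareD(1-5)[OF td]
  define y where "y = pb1 C r (tri_base C r q) \<cdot> pb1 C (tri_eval C r q) q \<cdot> d"
  define z where "z = pb2 C (tri_eval C r q) q \<cdot> d"
  have d: "tri_pt r q y (on_pos \<alpha> \<cdot> t) z" "d = tri_dir r q y (on_pos \<alpha> \<cdot> t) z"
    using tri_decompose[OF r q, of d] squareD(6)[OF td] by (simp_all add: y_def z_def)
  then have "square C (on_pos \<beta>) r t y"
    using squareD[OF tri_ptD(1)[OF d(1)]] base(1) by (simp add: square_def)
  from transposesD(3)[OF tr(1) this d(1)] transposesD(3)[OF tr(2) this d(1)[unfolded pos]]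
  show "dir \<alpha> t d = dir \<alpha>' t d" unfolding d(2) by (simp add: pos)
qed

text \<open>The direction part of \<open>\<beta>\<close> is a single element \<open>g\<close> of
  \<open>[q; p]\<^sub>*\<close> at the stage \<open>P \<times>\<^sub>R R\<^sub>*\<close>, so
  \<open>br_point\<close> is applied once, at the generic pair \<open>(t, y)\<close>.
  Exponentiability of \<open>bracket\<close> makes its source an object of the category of
  polynomials.\<close>

lemma transposes_ex_right:
  assumes p: "exponentiable C p" and q: "exponentiable C q" and r: "exponentiable C r"
    and br: "exponentiable C (bracket C q p)" and \<alpha>: "\<alpha> \<in> hom (Poly C) p (tri C r q)"
  shows "\<exists>\<beta>\<in>hom (Poly C) (bracket C q p) r. transposes p q r \<alpha> \<beta>"
proof -
  note [simp] = bracket[OF p q] br_base[OF p q] tri_base[OF r q] tri[OF r q] br_pos[OF p q] p q r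
    hom_PolyD(5-9)[OF \<alpha>]
  define x where "x = tri_base C r q \<cdot> on_pos \<alpha>"
  have x [simp]: "x \<in> arr C" "src C x = tgt C p" "tgt C x = tgt C r" by (simp_all add: x_def)
  define t y where "t = pb1 C x r" and "y = pb2 C x r"
  have ty: "square C x r t y" by (simp add: t_def y_def)
  note [simp] = squareD(1-5)[OF ty]
  have y\<tau>: "square C r (tri_base C r q) y (on_pos \<alpha> \<cdot> t)"
    using squareD(6)[OF ty] by (simp add: square_def x_def)
  define f where "f = tri_ev r q y (on_pos \<alpha> \<cdot> t)"
  have f [simp]: "f \<in> arr C" "src C f = src C y" "tgt C f = tgt C q"
    using tri_ev[OF r q y\<tau>] by (simp_all add: f_def)
  have f_cmp: "f \<cdot> s = tri_ev r q (y \<cdot> s) (on_pos \<alpha> \<cdot> t \<cdot> s)" if "s \<in> arr C" "tgt C s = src C y" for s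
    using tri_ev(4)[OF r q y\<tau>, of s] that by (simp add: f_def)
  define K where "K z s = dir \<alpha> (t \<cdot> s) (tri_dir r q (y \<cdot> s) (on_pos \<alpha> \<cdot> t \<cdot> s) z)" for z s
  have pt: "tri_pt r q (y \<cdot> s) (on_pos \<alpha> \<cdot> t \<cdot> s) z"
    and sq: "square C (on_pos \<alpha>) (tri C r q) (t \<cdot> s) (tri_dir r q (y \<cdot> s) (on_pos \<alpha> \<cdot> t \<cdot> s) z)"
    if s: "square C q f z s" for z s
  proof -
    note [simp] = squareD(1-5)[OF s]
    have "square C r (tri_base C r q) (y \<cdot> s) (on_pos \<alpha> \<cdot> t \<cdot> s)" by (rule square_cmp[OF y\<tau>]) simp_all
    then show pt: "tri_pt r q (y \<cdot> s) (on_pos \<alpha> \<cdot> t \<cdot> s) z"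
      using squareD(6)[OF s] f_cmp[of s] by (simp add: tri_pt_def)
    show "square C (on_pos \<alpha>) (tri C r q) (t \<cdot> s) (tri_dir r q (y \<cdot> s) (on_pos \<alpha> \<cdot> t \<cdot> s) z)"
      using tri_dir[OF r q pt] by (simp add: square_def)
  qed
  have K: "natural q f (src C p) K"
    unfolding natural_def
  proof (intro allI impI)
    fix z s assume s: "square C q f z s"
    note [simp] = squareD(1-5)[OF s]
    show "K z s \<in> arr C \<and> src C (K z s) = src C s \<and> tgt C (K z s) = src C p \<and>
      (\<forall>k\<in>arr C. tgt C k = src C s \<longrightarrow> K z s \<cdot> k = K (z \<cdot> k) (s \<cdot> k))"
      using dir_hom[OF \<alpha> sq[OF s]] tri_dir[OF r q pt[OF s]] by (simp add: K_def)
  qed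
  have pK: "p \<cdot> K z s = t \<cdot> s" if "square C q f z s" for z s
    unfolding K_def by (rule dir_hom(4)[OF \<alpha> sq[OF that]])
  obtain g where g: "g \<in> arr C" "src C g = src C t" "tgt C g = src C (br_base C q p)" "bracket C q p \<cdot> g = t" "br_pos q p g = f"
    and ev: "\<And>z s. square C q f z s \<Longrightarrow> br_ev q p z (g \<cdot> s) = K z s"
    using br_point[OF p q _ _ _ _ _ K pK refl] by simp
  note [simp] = g(1-3)
  define \<beta> where "\<beta> = PolyMor (bracket C q p) r x g"
  have H: "over x r (bracket C q p) (\<lambda>t y. g \<cdot> pb_pair C x r t y)"
    by (rule over_pb_pair) (use g in \<open>simp_all add: hom_iff t_def\<close>)
  have g_eq: "g = g \<cdot> pb_pair C x r (pb1 C x r) (pb2 C x r)" using g(2) by (simp add: t_def)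
  note mor = hom_PolyI[OF br r _ _ _ H g_eq, folded \<beta>_def]
  have "transposes p q r \<alpha> \<beta>"
    unfolding transposes_def
  proof (intro conjI allI impI)
    show "on_pos \<beta> = tri_base C r q \<cdot> on_pos \<alpha>" by (simp add: \<beta>_def x_def)
    fix t' y' assume "square C (on_pos \<beta>) r t' y'"
    then have ty': "square C x r t' y'" by (simp add: \<beta>_def)
    \<comment> \<open>An arbitrary pair \<open>(t', y')\<close> is the restriction of the generic
      one along \<open>k\<close>, so the claims reduce to the properties of
      \<open>g\<close>.\<close>
    define k where "k = pb_pair C x r t' y'"
    have k [simp]: "k \<in> arr C" "src C k = src C y'" "tgt C k = src C y" "t \<cdot> k = t'" "y \<cdot> k = y'"
      using pb_pair[OF _ _ _ ty'] by (simp_all add: k_def t_def y_def)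
    have \<alpha>tk: "on_pos \<alpha> \<cdot> t \<cdot> k = on_pos \<alpha> \<cdot> t'" using assoc[of k t "on_pos \<alpha>"] by simp
    have dir: "dir \<beta> t' y' = g \<cdot> k" using mor(2)[OF _ _ _ ty'] by (simp add: k_def)
    show "br_pos q p (dir \<beta> t' y') = tri_ev r q y' (on_pos \<alpha> \<cdot> t')"
      using br_pos(4)[OF p q, of g k] f_cmp[of k] g(5) by (simp add: dir \<alpha>tk)
    fix z assume z: "tri_pt r q y' (on_pos \<alpha> \<cdot> t') z"
    note [simp] = squareD(1-5)[OF ty'] tri_ptD(2-4)[OF z]
    have "square C q f z k"
      using tri_ptD(5)[OF z] f_cmp[of k] by (simp add: square_def \<alpha>tk)
    from ev[OF this] show "br_ev q p z (dir \<beta> t' y') = dir \<alpha> t' (tri_dir r q y' (on_pos \<alpha> \<cdot> t') z)"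
      by (simp add: dir K_def \<alpha>tk)
  qed
  moreover have "\<beta> \<in> hom (Poly C) (bracket C q p) r" by (rule mor) simp_all
  ultimately show ?thesis by blast
qed

text \<open>The position part pairs \<open>\<beta>\<^sub>1\<close> with the position in
  \<open>q\<close> of \<open>\<beta>\<^sup>\<sharp>(t, y)\<close>; a direction \<open>(y, z)\<close>
  goes to the value of \<open>\<beta>\<^sup>\<sharp>(t, y)\<close> at \<open>z\<close>.\<close>

lemma transposes_ex_left:
  assumes p: "exponentiable C p" and q: "exponentiable C q" and r: "exponentiable C r"
    and \<beta>: "\<beta> \<in> hom (Poly C) (bracket C q p) r"
  shows "\<exists>\<alpha>\<in>hom (Poly C) p (tri C r q). transposes p q r \<alpha> \<beta>"
proof -
  note [simp] = bracket[OF p q] br_base[OF p q] tri_base[OF r q] tri[OF r q] tri_eval[OF r q] br_pos[OF p q] p q r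
    hom_PolyD(5-9)[OF \<beta>]
  define F where "F y t = br_pos q p (dir \<beta> t y)" for y t
  have F: "natural r (on_pos \<beta>) (tgt C q) F"
    unfolding natural_def
  proof (intro allI impI)
    fix y t assume "square C r (on_pos \<beta>) y t"
    then have s: "square C (on_pos \<beta>) r t y" by (simp add: square_sym)
    show "F y t \<in> arr C \<and> src C (F y t) = src C t \<and> tgt C (F y t) = tgt C q \<and>
      (\<forall>k\<in>arr C. tgt C k = src C t \<longrightarrow> F y t \<cdot> k = F (y \<cdot> k) (t \<cdot> k))"
      using dir_hom[OF \<beta> s] squareD[OF s] by (simp add: F_def)
  qed
  define a where "a = tri_point C r q (on_pos \<beta>) (F (pb1 C r (on_pos \<beta>)) (pb2 C r (on_pos \<beta>)))"
  note A = tri_point[OF r q _ _ F a_def]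
  have a [simp]: "a \<in> arr C" "src C a = tgt C p" "tgt C a = src C (tri_base C r q)" and base: "tri_base C r q \<cdot> a = on_pos \<beta>"
    using A(1-4) by simp_all
  have ev: "tri_ev r q y (a \<cdot> t) = br_pos q p (dir \<beta> t y)" if "square C (on_pos \<beta>) r t y" for t y
    using A(5)[of y t] that by (simp add: square_sym F_def)
  define H where "H t d = br_ev q p (pb2 C (tri_eval C r q) q \<cdot> d)
     (dir \<beta> t (pb1 C r (tri_base C r q) \<cdot> pb1 C (tri_eval C r q) q \<cdot> d))" for t d
  have dec: "square C (on_pos \<beta>) r t y" "br_pt q p z (dir \<beta> t y)"
    if td: "square C a (tri C r q) t d" and y: "y = pb1 C r (tri_base C r q) \<cdot> pb1 C (tri_eval C r q) q \<cdot> d"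
      and z: "z = pb2 C (tri_eval C r q) q \<cdot> d" for t d y z
  proof -
    note [simp] = squareD(1-5)[OF td]
    have pt: "tri_pt r q y (a \<cdot> t) z"
      using tri_decompose(1)[OF r q, of d] squareD(6)[OF td] by (simp add: y z)
    show s: "square C (on_pos \<beta>) r t y"
      using squareD[OF tri_ptD(1)[OF pt]] base by (simp add: square_def)
    show "br_pt q p z (dir \<beta> t y)"
      using tri_ptD[OF pt] ev[OF s] dir_hom[OF \<beta> s] squareD[OF s] by (simp add: br_pt_def)
  qed
  have H: "over a (tri C r q) p H"
    unfolding over_def
  proof (intro allI impI)
    fix t d assume td: "square C a (tri C r q) t d"
    note [simp] = squareD(1-5)[OF td]
    note s = dec(1)[OF td refl refl] and pt = dec(2)[OF td refl refl]
    show "H t d \<in> arr C \<and> src C (H t d) = src C d \<and> tgt C (H t d) = src C p \<and> p \<cdot> H t d = t \<and>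
      (\<forall>k\<in>arr C. tgt C k = src C d \<longrightarrow> H t d \<cdot> k = H (t \<cdot> k) (d \<cdot> k))"
      using dir_hom[OF \<beta> s] br_ev[OF p q pt] by (simp add: H_def)
  qed
  define \<alpha> where "\<alpha> = PolyMor p (tri C r q) a (H (pb1 C a (tri C r q)) (pb2 C a (tri C r q)))"
  note mor = hom_PolyI[OF p exponentiable_tri[OF r q] _ _ _ H refl, folded \<alpha>_def]
  have pos [simp]: "on_pos \<alpha> = a" by (simp add: \<alpha>_def)
  have "transposes p q r \<alpha> \<beta>"
    unfolding transposes_def
  proof (intro conjI allI impI)
    show "on_pos \<beta> = tri_base C r q \<cdot> on_pos \<alpha>" by (simp add: base)
    fix t y assume s: "square C (on_pos \<beta>) r t y"
    show "br_pos q p (dir \<beta> t y) = tri_ev r q y (on_pos \<alpha> \<cdot> t)" using ev[OF s] by simp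
    fix z assume z: "tri_pt r q y (on_pos \<alpha> \<cdot> t) z"
    note td = tri_dir[OF r q z]
    have "square C a (tri C r q) t (tri_dir r q y (on_pos \<alpha> \<cdot> t) z)"
      using td squareD(1-5)[OF s] by (simp add: square_def)
    from mor(2)[OF _ _ _ this] show "br_ev q p z (dir \<beta> t y) = dir \<alpha> t (tri_dir r q y (on_pos \<alpha> \<cdot> t) z)"
      using td by (simp add: H_def)
  qed
  moreover have "\<alpha> \<in> hom (Poly C) p (tri C r q)" by (rule mor) simp_all
  ultimately show ?thesis by blast
qed

text \<open>Following a pair \<open>(t, y')\<close> through both composites gives the same position
  of \<open>q'\<close>, and at each direction \<open>z'\<close> of \<open>q'\<close> there the same
  direction of \<open>p'\<close>. Stating this for the relation avoids computing with
  transposes.\<close>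

lemma transposes_natural:
  assumes br: "exponentiable C (bracket C q p)" "exponentiable C (bracket C q' p')"
    and \<phi>: "\<phi> \<in> hom (Poly C) p' p" and \<psi>: "\<psi> \<in> hom (Poly C) q q'" and \<chi>: "\<chi> \<in> hom (Poly C) r r'"
    and \<alpha>: "\<alpha> \<in> hom (Poly C) p (tri C r q)" and \<beta>: "\<beta> \<in> hom (Poly C) (bracket C q p) r"
    and tr: "transposes p q r \<alpha> \<beta>"
  defines "\<alpha>' \<equiv> poly_cmp C (poly_cmp C (tri_map C \<chi> \<psi>) \<alpha>) \<phi>"
    and "\<beta>' \<equiv> poly_cmp C (poly_cmp C \<chi> \<beta>) (br_map C \<psi> \<phi>)"
  shows "\<alpha>' \<in> hom (Poly C) p' (tri C r' q')" "\<beta>' \<in> hom (Poly C) (bracket C q' p') r'"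
    "transposes p' q' r' \<alpha>' \<beta>'"
proof -
  note [simp] = hom_PolyD(3-9)[OF \<phi>] hom_PolyD(3-9)[OF \<psi>] hom_PolyD(3-9)[OF \<chi>] hom_PolyD(7-9)[OF \<alpha>] hom_PolyD(7-9)[OF \<beta>]
  have e: "exponentiable C p" "exponentiable C q" "exponentiable C r"
    and e': "exponentiable C p'" "exponentiable C q'" "exponentiable C r'" by simp_all
  note [simp] = bracket[OF e(1,2)] bracket[OF e'(1,2)] br_base[OF e(1,2)] br_base[OF e'(1,2)]
    tri_base[OF e(3,2)] tri_base[OF e'(3,2)] tri[OF e(3,2)] tri[OF e'(3,2)]
  note T = tri_map[OF \<chi> \<psi>] and B = br_map[OF \<phi> \<psi> br]
  note T\<alpha> = hom_Poly_cmp[OF \<alpha> T(1)] and \<chi>\<beta> = hom_Poly_cmp[OF \<beta> \<chi>]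
  note A' = hom_Poly_cmp[OF \<phi> T\<alpha>(1), folded \<alpha>'_def] and B' = hom_Poly_cmp[OF B(1) \<chi>\<beta>(1), folded \<beta>'_def]
  show "\<alpha>' \<in> hom (Poly C) p' (tri C r' q')" "\<beta>' \<in> hom (Poly C) (bracket C q' p') r'" by (rule A' B')+
  let ?m = "on_pos (tri_map C \<chi> \<psi>)"
  note [simp] = T(2-4) B(2)
  have pos\<alpha>: "on_pos \<alpha>' = ?m \<cdot> on_pos \<alpha> \<cdot> on_pos \<phi>" and pos\<beta>: "on_pos \<beta>' = on_pos \<chi> \<cdot> on_pos \<beta> \<cdot> on_pos \<phi>"
    by (simp_all add: \<alpha>'_def \<beta>'_def)
  have base: "tri_base C r q \<cdot> on_pos \<alpha> = on_pos \<beta>" using transposesD(1)[OF tr] by simp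
  show "transposes p' q' r' \<alpha>' \<beta>'"
    unfolding transposes_def
  proof (intro conjI allI impI)
    show "on_pos \<beta>' = tri_base C r' q' \<cdot> on_pos \<alpha>'"
      using T(5) base assoc[of "on_pos \<alpha>" "tri_base C r q" "on_pos \<chi>"] by (simp add: pos\<alpha> pos\<beta>)
    fix t y' assume ty': "square C (on_pos \<beta>') r' t y'"
    note [simp] = squareD(1-5)[OF ty', unfolded pos\<beta>, simplified]
    \<comment> \<open>The data are carried back to \<open>p\<close>, \<open>q\<close>,
      \<open>r\<close>: \<open>t1\<close> is the image in \<open>P\<close>, \<open>y\<close> the
      direction of \<open>r\<close>, \<open>g\<close> the element of \<open>[q; p]\<^sub>*\<close>
      that \<open>\<beta>\<close> assigns to them, and \<open>\<tau>\<close> the position of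
      \<open>r \<triangleleft> q\<close> that \<open>\<alpha>\<close> assigns to
      \<open>t1\<close>.\<close>
    define t1 where "t1 = on_pos \<phi> \<cdot> t"
    have t1 [simp]: "t1 \<in> arr C" "src C t1 = src C y'" "tgt C t1 = tgt C p" by (simp_all add: t1_def)
    have s1: "square C (on_pos \<chi> \<cdot> on_pos \<beta>) r' t1 y'" and s2: "square C (on_pos \<chi>) r' (on_pos \<beta> \<cdot> t1) y'"
      using squareD(6)[OF ty'] by (simp_all add: square_def pos\<beta> t1_def)
    define y where "y = dir \<chi> (on_pos \<beta> \<cdot> t1) y'"
    have y [simp]: "y \<in> arr C" "src C y = src C y'" "tgt C y = src C r" "r \<cdot> y = on_pos \<beta> \<cdot> t1"
      using dir_hom(1-4)[OF \<chi> s2] by (simp_all add: y_def)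
    have s3: "square C (on_pos \<beta>) r t1 y" by (simp add: square_def)
    define g where "g = dir \<beta> t1 y"
    have g [simp]: "g \<in> arr C" "src C g = src C y'" "tgt C g = src C (br_base C q p)" "bracket C q p \<cdot> g = t1"
      using dir_hom(1-4)[OF \<beta> s3] by (simp_all add: g_def)
    have s4: "square C (on_pos \<phi>) (bracket C q p) t g" by (simp add: square_def t1_def)
    have "dir (poly_cmp C \<chi> \<beta>) t1 y' = g" using \<chi>\<beta>(2)[OF s1] by (simp add: g_def y_def)
    then have dir\<beta>': "dir \<beta>' t y' = dir (br_map C \<psi> \<phi>) t g"
      using B'(2)[of t y'] ty' by (simp add: pos\<beta> t1_def)
    define \<tau> where "\<tau> = on_pos \<alpha> \<cdot> t1"
    have \<tau> [simp]: "\<tau> \<in> arr C" "src C \<tau> = src C y'" "tgt C \<tau> = src C (tri_base C r q)" by (simp_all add: \<tau>_def)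
    have base\<tau>: "tri_base C r q \<cdot> \<tau> = on_pos \<beta> \<cdot> t1" using base by (simp add: \<tau>_def)
    have \<alpha>'t: "on_pos \<alpha>' \<cdot> t = ?m \<cdot> \<tau>" by (simp add: pos\<alpha> \<tau>_def t1_def)
    have "tri_base C r' q' \<cdot> (?m \<cdot> \<tau>) = on_pos \<chi> \<cdot> (tri_base C r q \<cdot> \<tau>)" using T(5) by simp
    then have s5: "square C r' (tri_base C r' q') y' (?m \<cdot> \<tau>)"
      using squareD(6)[OF s2] base\<tau> by (simp add: square_def)
    have ev: "tri_ev r' q' y' (?m \<cdot> \<tau>) = on_pos \<psi> \<cdot> tri_ev r q y \<tau>"
      using T(6)[OF _ _ s5] base\<tau> by (simp add: y_def)
    have g_pos: "br_pos q p g = tri_ev r q y \<tau>" using transposesD(2)[OF tr s3] by (simp add: g_def \<tau>_def)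
    show "br_pos q' p' (dir \<beta>' t y') = tri_ev r' q' y' (on_pos \<alpha>' \<cdot> t)"
      using B(3)[OF s4] by (simp add: dir\<beta>' \<alpha>'t ev g_pos)
    fix z' assume "tri_pt r' q' y' (on_pos \<alpha>' \<cdot> t) z'"
    then have pt': "tri_pt r' q' y' (?m \<cdot> \<tau>) z'" by (simp add: \<alpha>'t)
    \<comment> \<open>The direction of \<open>q\<close> at which both composites consult the
      original data; there the hypothesis relating \<open>\<alpha>\<close> and
      \<open>\<beta>\<close> identifies the results.\<close>
    define z where "z = dir \<psi> (tri_ev r q y \<tau>) z'"
    have pt: "tri_pt r q y \<tau> z" and dirT: "dir (tri_map C \<chi> \<psi>) \<tau> (tri_dir r' q' y' (?m \<cdot> \<tau>) z') = tri_dir r q y \<tau> z"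
      using T(7)[OF _ _ pt', of y z] base\<tau> by (simp_all add: y_def z_def)
    note [simp] = tri_dir(1-4)[OF e'(3,2) pt'] tri_ptD(2-4)[OF pt']
    let ?d = "tri_dir r' q' y' (?m \<cdot> \<tau>) z'"
    have m\<tau>: "?m \<cdot> on_pos \<alpha> \<cdot> t1 = ?m \<cdot> \<tau>" by (simp add: \<tau>_def)
    have "square C (?m \<cdot> on_pos \<alpha>) (tri C r' q') t1 ?d" by (simp add: square_def m\<tau>)
    from T\<alpha>(2)[OF this] have "dir (poly_cmp C (tri_map C \<chi> \<psi>) \<alpha>) t1 ?d = dir \<alpha> t1 (tri_dir r q y \<tau> z)"
      using dirT by (simp flip: \<tau>_def)
    moreover have "square C (on_pos \<alpha>') (tri C r' q') t ?d" by (simp add: square_def \<alpha>'t) (simp add: pos\<alpha>)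
    ultimately have dir\<alpha>': "dir \<alpha>' t ?d = dir \<phi> t (dir \<alpha> t1 (tri_dir r q y \<tau> z))"
      using A'(2)[of t ?d] by (simp add: pos\<alpha> t1_def)
    have "br_pos q' p' (dir \<beta>' t y') = tri_ev r' q' y' (?m \<cdot> \<tau>)"
      using B(3)[OF s4] by (simp add: dir\<beta>' ev g_pos)
    then have "br_pt q' p' z' (dir (br_map C \<psi> \<phi>) t g)"
      using tri_ptD(5)[OF pt'] dir_hom(1-3)[OF B(1), of t g] s4 by (simp add: br_pt_def dir\<beta>')
    from B(4)[OF s4 this, of z] have "br_ev q' p' z' (dir \<beta>' t y') = dir \<phi> t (br_ev q p z g)"
      by (simp add: dir\<beta>' z_def g_pos)
    also have "br_ev q p z g = dir \<alpha> t1 (tri_dir r q y \<tau> z)"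
      using transposesD(3)[OF tr s3, of z] pt by (simp add: g_def \<tau>_def)
    finally show "br_ev q' p' z' (dir \<beta>' t y') = dir \<alpha>' t (tri_dir r' q' y' (on_pos \<alpha>' \<cdot> t) z')"
      by (simp add: \<alpha>'t dir\<alpha>')
  qed
qed

end

theorem theorem4p16:
  fixes C :: "('o, 'a) category"
  assumes "category C" and "has_finite_limits C"
  shows "\<exists>\<Phi>.
    (\<forall>p\<in>obj (Poly C). \<forall>q\<in>obj (Poly C). \<forall>r\<in>obj (Poly C).
       exponentiable C (bracket C q p) \<longrightarrow>
       bij_betw (\<Phi> p q r) (hom (Poly C) p (tri C r q)) (hom (Poly C) (bracket C q p) r)) \<and>
    (\<forall>p\<in>obj (Poly C). \<forall>q\<in>obj (Poly C). \<forall>r\<in>obj (Poly C).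
     \<forall>p'\<in>obj (Poly C). \<forall>q'\<in>obj (Poly C). \<forall>r'\<in>obj (Poly C).
       exponentiable C (bracket C q p) \<longrightarrow> exponentiable C (bracket C q' p') \<longrightarrow>
       (\<forall>\<phi>\<in>hom (Poly C) p' p. \<forall>\<psi>\<in>hom (Poly C) q q'. \<forall>\<chi>\<in>hom (Poly C) r r'.
        \<forall>\<alpha>\<in>hom (Poly C) p (tri C r q).
          \<Phi> p' q' r' (tri_map C \<chi> \<psi> \<cdot>\<^bsub>Poly C\<^esub> \<alpha> \<cdot>\<^bsub>Poly C\<^esub> \<phi>) =
          \<chi> \<cdot>\<^bsub>Poly C\<^esub> \<Phi> p q r \<alpha> \<cdot>\<^bsub>Poly C\<^esub> br_map C \<psi> \<phi>))"
proof -
  interpret finite_limits C using assms by (intro finite_limits.intro finite_limits_axioms.intro)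
  \<comment> \<open>The statement quantifies over \<open>\<Phi>\<close> before the polynomials, so
    it must be one function of all arguments; a definite description provides it, with a specified
    value where the relation has a unique solution.\<close>
  define \<Phi> where "\<Phi> p q r \<alpha> = (THE \<beta>. \<beta> \<in> hom (Poly C) (bracket C q p) r \<and> transposes p q r \<alpha> \<beta>)" for p q r \<alpha>
  have \<Phi>_eq: "\<Phi> p q r \<alpha> = \<beta>"
    if "exponentiable C p" "exponentiable C q" "exponentiable C r" "\<alpha> \<in> hom (Poly C) p (tri C r q)"
      "\<beta> \<in> hom (Poly C) (bracket C q p) r" "transposes p q r \<alpha> \<beta>" for p q r \<alpha> \<beta>
    unfolding \<Phi>_def using that transposes_unique_right[OF that(1-4)] by (intro the_equality) auto
  have \<Phi>: "\<Phi> p q r \<alpha> \<in> hom (Poly C) (bracket C q p) r" "transposes p q r \<alpha> (\<Phi> p q r \<alpha>)"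
    if "exponentiable C p" "exponentiable C q" "exponentiable C r" "exponentiable C (bracket C q p)"
      "\<alpha> \<in> hom (Poly C) p (tri C r q)" for p q r \<alpha>
    using transposes_ex_right[OF that] \<Phi>_eq that by auto
  show ?thesis
  proof (intro exI[of _ \<Phi>] conjI ballI impI)
    fix p q r assume "p \<in> obj (Poly C)" "q \<in> obj (Poly C)" "r \<in> obj (Poly C)"
      and br: "exponentiable C (bracket C q p)"
    then have e: "exponentiable C p" "exponentiable C q" "exponentiable C r" by simp_all
    show "bij_betw (\<Phi> p q r) (hom (Poly C) p (tri C r q)) (hom (Poly C) (bracket C q p) r)"
      unfolding bij_betw_def
    proof
      show "inj_on (\<Phi> p q r) (hom (Poly C) p (tri C r q))"
      proof (rule inj_onI)
        fix \<alpha> \<alpha>' assume \<alpha>: "\<alpha> \<in> hom (Poly C) p (tri C r q)" "\<alpha>' \<in> hom (Poly C) p (tri C r q)"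
          and eq: "\<Phi> p q r \<alpha> = \<Phi> p q r \<alpha>'"
        show "\<alpha> = \<alpha>'"
          by (rule transposes_unique_left[OF e \<Phi>(1)[OF e br \<alpha>(1)] \<alpha> \<Phi>(2)[OF e br \<alpha>(1)]])
            (use \<Phi>(2)[OF e br \<alpha>(2)] eq in simp)
      qed
      \<comment> \<open>Surjectivity is totality of the relation from the side of
        \<open>\<beta>\<close>, as injectivity was its uniqueness from that side.\<close>
      have "\<beta> \<in> \<Phi> p q r ` hom (Poly C) p (tri C r q)" if "\<beta> \<in> hom (Poly C) (bracket C q p) r" for \<beta>
        using transposes_ex_left[OF e that] \<Phi>_eq[OF e _ that] by force
      then show "\<Phi> p q r ` hom (Poly C) p (tri C r q) = hom (Poly C) (bracket C q p) r"
        using \<Phi>(1)[OF e br] by blast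
    qed
  next
    fix p q r p' q' r' \<phi> \<psi> \<chi> \<alpha>
    assume "p \<in> obj (Poly C)" "q \<in> obj (Poly C)" "r \<in> obj (Poly C)" "p' \<in> obj (Poly C)" "q' \<in> obj (Poly C)" "r' \<in> obj (Poly C)"
      and br: "exponentiable C (bracket C q p)" "exponentiable C (bracket C q' p')"
      and mor: "\<phi> \<in> hom (Poly C) p' p" "\<psi> \<in> hom (Poly C) q q'" "\<chi> \<in> hom (Poly C) r r'" "\<alpha> \<in> hom (Poly C) p (tri C r q)"
    then have e: "exponentiable C p" "exponentiable C q" "exponentiable C r" "exponentiable C p'" "exponentiable C q'" "exponentiable C r'"
      by simp_all
    note \<Phi>\<alpha> = \<Phi>[OF e(1-3) br(1) mor(4)]
    \<comment> \<open>The right side is related to the composite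
      \<open>p' \<rightarrow> r' \<triangleleft> q'\<close> by stability of the relation, so
      uniqueness makes it the value of \<open>\<Phi>\<close> there.\<close>
    show "\<Phi> p' q' r' (tri_map C \<chi> \<psi> \<cdot>\<^bsub>Poly C\<^esub> \<alpha> \<cdot>\<^bsub>Poly C\<^esub> \<phi>) =
          \<chi> \<cdot>\<^bsub>Poly C\<^esub> \<Phi> p q r \<alpha> \<cdot>\<^bsub>Poly C\<^esub> br_map C \<psi> \<phi>"
      unfolding Poly_simps by (rule \<Phi>_eq[OF e(4-6) transposes_natural[OF br mor \<Phi>\<alpha>]])
  qed
qed

end
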